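(* Let $f$ be a (generic) front diagram of a single-component Legendrian knot in $\mathbf R^3_{xyz}$ with the standard contact structure $\xi=\ker(dz-y\,dx)$, and let $\eta$ be an (ungraded) ruling of $f$. Then $\eta$ is $2$-graded if and only if the surface associated to $\eta$ is orientable.
   Context: A Legendrian knot is a smooth embedding of $S^1$ into $\mathbf R^3_{xyz}$ everywhere tangent to $\xi=\ker(dz-y\,dx)$; a Legendrian link is a finite disjoint union of Legendrian knots. Front diagrams. The front diagram of a Legendrian link is its projection to the $xz$-plane. Generically its singularities are transverse double points (crossings) and equally many left and right cusps; the rest consists of strands, each connecting a left cusp to a right cusp and being a graph over the $x$-axis. We also assume that no two crossings share the same $x$-coordinate. Maslov potential and index. The rotation $r$ of an oriented Legendrian link is, up to sign, the greatest common divisor of the rotation numbers of its components (the rotation number itself for a knot). A Maslov potential is a locally constant function on the strands with values in $\mathbf Z_{2r}=\mathbf Z/2r\mathbf Z$ ($=\mathbf Z$ if $r=0$) such that at each cusp the locally upper strand has potential $1$ higher than the locally lower one. Convention: when the front is oriented, strands oriented to the right (increasing $x$) have even potential. The index of a crossing is the potential of the upper strand minus that of the lower strand; a crossing has even index if and only if it is a positive crossing. Rulings. A ruling of a front diagram is a partial smoothing in which certain crossings, called switches, are replaced by a pair of arcs that are disjoint graphs over the $x$-axis (an upper arc joining the upper left and upper right ends of the crossing, and a lower arc joining the lower left and lower right ends), so that the diagram becomes a union of eyes. An eye is a pair of arcs (one top, one bottom) connecting the same left cusp and right cusp, containing no other cusps, and not meeting each other otherwise, not even at switches (so the two arcs at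 a switch belong to different eyes). The normality condition is required: in the vertical ($x=$ const.) slice through (equivalently, immediately next to) each switch, the intervals cut out by the two eyes meeting at that switch are either disjoint or nested, never interleaved; i.e. either the bottom arc of one eye lies at the switch directly above the top arc of the other, or both top arcs meet at the switch and one interval contains the other, or both bottom arcs meet at the switch and one interval contains the other. Such an object is also called an ungraded ruling. It is $2$-graded if all switches have even index. Surface. The surface associated to a ruling is the abstract surface obtained from one closed disk per eye (bounded by that eye) by attaching, for each switch, a half-twisted band joining the two disks whose eyes meet there, so that the two free edges of the band correspond to the two crossing strands of the original diagram (one joins the left part of the first eye's arc to the right part of the second eye's arc, the other joins the left part of the second to the right part of the first). Its boundary is thus the original link. *)

theory Defs
  imports
    "HOL-Analysis.Analysis"
    "HOL-Complex_Analysis.Complex_Analysis"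
    "HOL-Number_Theory.Cong"
begin

section \<open>Legendrian knots and their fronts\<close>

text \<open>
  The circle is \<open>\<real>/\<int>\<close>: a closed curve is a 1-periodic function on the reals, and two
  parameters denote the same point of the circle iff they differ by an integer. The
  parametrization also orients the knot.
\<close>

abbreviation xco :: "(real \<Rightarrow> real^3) \<Rightarrow> real \<Rightarrow> real" where "xco \<gamma> \<equiv> \<lambda>t. \<gamma> t $ 1"
abbreviation yco :: "(real \<Rightarrow> real^3) \<Rightarrow> real \<Rightarrow> real" where "yco \<gamma> \<equiv> \<lambda>t. \<gamma> t $ 2"
abbreviation zco :: "(real \<Rightarrow> real^3) \<Rightarrow> real \<Rightarrow> real" where "zco \<gamma> \<equiv> \<lambda>t. \<gamma> t $ 3"

definition smooth :: "(real \<Rightarrow> real) \<Rightarrow> bool" where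
  "smooth f \<longleftrightarrow> (\<forall>n t. ((deriv ^^ n) f) differentiable (at t))"

definition legendrian_knot :: "(real \<Rightarrow> real^3) \<Rightarrow> bool" where
  "legendrian_knot \<gamma> \<longleftrightarrow>
     (\<forall>i. smooth (\<lambda>t. \<gamma> t $ i)) \<and>
     (\<forall>t. \<gamma> (t + 1) = \<gamma> t) \<and>
     inj_on \<gamma> {0..<1} \<and>
     (\<forall>t. vector_derivative \<gamma> (at t) \<noteq> 0) \<and>
     (\<forall>t. deriv (zco \<gamma>) t = yco \<gamma> t * deriv (xco \<gamma>) t)"

definition front :: "(real \<Rightarrow> real^3) \<Rightarrow> real \<Rightarrow> real \<times> real" where
  "front \<gamma> t = (xco \<gamma> t, zco \<gamma> t)"

text \<open>
  By the contact condition the front is singular exactly where \<open>x' = 0\<close>. If moreover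
  \<open>x'' \<noteq> 0\<close> there (so \<open>y' \<noteq> 0\<close> by immersivity), the singularity is a semicubical cusp,
  which is a left cusp if \<open>x'' > 0\<close> and a right cusp if \<open>x'' < 0\<close>.
\<close>

definition cusp_parameter :: "(real \<Rightarrow> real^3) \<Rightarrow> real \<Rightarrow> bool" where
  "cusp_parameter \<gamma> t \<longleftrightarrow> deriv (xco \<gamma>) t = 0"

definition left_cusps :: "(real \<Rightarrow> real^3) \<Rightarrow> (real \<times> real) set" where
  "left_cusps \<gamma> = {front \<gamma> t |t. cusp_parameter \<gamma> t \<and> deriv (deriv (xco \<gamma>)) t > 0}"

definition right_cusps :: "(real \<Rightarrow> real^3) \<Rightarrow> (real \<times> real) set" where
  "right_cusps \<gamma> = {front \<gamma> t |t. cusp_parameter \<gamma> t \<and> deriv (deriv (xco \<gamma>)) t < 0}"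

definition crossing_parameters :: "(real \<Rightarrow> real^3) \<Rightarrow> real \<Rightarrow> real \<Rightarrow> bool" where
  "crossing_parameters \<gamma> s t \<longleftrightarrow> s - t \<notin> \<int> \<and> front \<gamma> s = front \<gamma> t"

definition crossings :: "(real \<Rightarrow> real^3) \<Rightarrow> (real \<times> real) set" where
  "crossings \<gamma> = {front \<gamma> s |s. \<exists>t. crossing_parameters \<gamma> s t}"

text \<open>
  The third clause is transversality of the velocities of the front at a double point; as the
  velocity vanishes at a cusp, it also keeps crossings away from cusps. The fourth clause
  excludes triple points.
\<close>

definition generic_front :: "(real \<Rightarrow> real^3) \<Rightarrow> bool" where
  "generic_front \<gamma> \<longleftrightarrow>
     (\<forall>t. cusp_parameter \<gamma> t \<longrightarrow> deriv (deriv (xco \<gamma>)) t \<noteq> 0) \<and>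
     finite (crossings \<gamma>) \<and>
     (\<forall>s t. crossing_parameters \<gamma> s t \<longrightarrow>
        deriv (xco \<gamma>) s * deriv (zco \<gamma>) t \<noteq> deriv (xco \<gamma>) t * deriv (zco \<gamma>) s) \<and>
     (\<forall>s t u. front \<gamma> s = front \<gamma> t \<and> front \<gamma> t = front \<gamma> u \<longrightarrow>
        s - t \<in> \<int> \<or> t - u \<in> \<int> \<or> s - u \<in> \<int>) \<and>
     (\<forall>p\<in>crossings \<gamma>. \<forall>q\<in>crossings \<gamma>. fst p = fst q \<longrightarrow> p = q)"


section \<open>Maslov potentials and the index of a crossing\<close>

text \<open>
  The contact plane at a point is framed by \<open>\<partial>\<^sub>x + y \<partial>\<^sub>z\<close> and \<open>\<partial>\<^sub>y\<close>, and in this frame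
  the velocity of a Legendrian curve has components \<open>(x', y')\<close>. The rotation number is the
  number of turns of this vector; its sign is immaterial below.
\<close>

definition rotation_number :: "(real \<Rightarrow> real^3) \<Rightarrow> int" where
  "rotation_number \<gamma> =
     (THE r. of_int r = winding_number (\<lambda>t. Complex (deriv (xco \<gamma>) t) (deriv (yco \<gamma>) t)) 0)"

text \<open>
  A strand is a maximal arc of the front without interior cusps. A function on the strands with
  values in \<open>\<int>/2r\<int>\<close> is represented by integers \<open>\<mu> t\<close>, attached to the non-cusp
  parameters \<open>t\<close> and considered modulo \<open>2 r\<close> (congruence modulo \<open>0\<close> being equality).
  The fourth clause compares the two strands at a cusp by means of points on the same vertical
  line. The last clause makes sense because \<open>2 r\<close> is even.
\<close>

definition maslov_potential :: "(real \<Rightarrow> real^3) \<Rightarrow> (real \<Rightarrow> int) \<Rightarrow> bool" where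
  "maslov_potential \<gamma> \<mu> \<longleftrightarrow>
     (let m = 2 * rotation_number \<gamma> in
       (\<forall>t. \<not> cusp_parameter \<gamma> t \<longrightarrow> [\<mu> (t + 1) = \<mu> t] (mod m)) \<and>
       (\<forall>s t. s < t \<and> (\<forall>u\<in>{s..t}. \<not> cusp_parameter \<gamma> u) \<longrightarrow> [\<mu> s = \<mu> t] (mod m)) \<and>
       (\<forall>c. cusp_parameter \<gamma> c \<longrightarrow>
          (\<exists>\<delta>>0. \<forall>s\<in>{c-\<delta><..<c+\<delta>}. \<forall>t\<in>{c-\<delta><..<c+\<delta>}.
             xco \<gamma> s = xco \<gamma> t \<and> zco \<gamma> s < zco \<gamma> t \<longrightarrow> [\<mu> t = \<mu> s + 1] (mod m))) \<and>
       (\<forall>t. deriv (xco \<gamma>) t > 0 \<longrightarrow> even (\<mu> t)))"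

text \<open>
  At a crossing with slopes \<open>y s < y t\<close> the strand through \<open>s\<close> is the upper one: it lies
  above the other one just to the left of the crossing, and it is the overcrossing strand when
  the front is viewed with the \<open>y\<close>-axis pointing away from the viewer.
\<close>

definition upper_lower_at_crossing :: "(real \<Rightarrow> real^3) \<Rightarrow> real \<Rightarrow> real \<Rightarrow> bool" where
  "upper_lower_at_crossing \<gamma> s t \<longleftrightarrow> crossing_parameters \<gamma> s t \<and> yco \<gamma> s < yco \<gamma> t"

definition crossing_index :: "(real \<Rightarrow> int) \<Rightarrow> real \<Rightarrow> real \<Rightarrow> int" where
  "crossing_index \<mu> s t = \<mu> s - \<mu> t"

definition two_graded :: "(real \<Rightarrow> real^3) \<Rightarrow> (real \<Rightarrow> int) \<Rightarrow> (real \<times> real) set \<Rightarrow> bool" where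
  "two_graded \<gamma> \<mu> S \<longleftrightarrow>
     (\<forall>s t. upper_lower_at_crossing \<gamma> s t \<and> front \<gamma> s \<in> S \<longrightarrow> even (crossing_index \<mu> s t))"


section \<open>Rulings\<close>

datatype eye = Eye (eye_left: real) (eye_right: real)
  (eye_top: "real \<Rightarrow> real") (eye_bot: "real \<Rightarrow> real")

datatype side = Top | Bot

fun arc :: "eye \<Rightarrow> side \<Rightarrow> real \<Rightarrow> real" where
  "arc e Top = eye_top e"
| "arc e Bot = eye_bot e"

definition eye_curve :: "eye \<Rightarrow> (real \<times> real) set" where
  "eye_curve e = {(x, arc e \<sigma> x) |x \<sigma>. x \<in> {eye_left e..eye_right e}}"

definition is_eye :: "(real \<Rightarrow> real^3) \<Rightarrow> eye \<Rightarrow> bool" where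
  "is_eye \<gamma> e \<longleftrightarrow>
     eye_left e < eye_right e \<and>
     (\<forall>\<sigma>. continuous_on {eye_left e..eye_right e} (arc e \<sigma>)) \<and>
     eye_curve e \<subseteq> range (front \<gamma>) \<and>
     (\<forall>\<sigma>. (eye_left e, arc e \<sigma> (eye_left e)) \<in> left_cusps \<gamma>) \<and>
     (\<forall>\<sigma>. (eye_right e, arc e \<sigma> (eye_right e)) \<in> right_cusps \<gamma>) \<and>
     eye_top e (eye_left e) = eye_bot e (eye_left e) \<and>
     eye_top e (eye_right e) = eye_bot e (eye_right e) \<and>
     (\<forall>x\<in>{eye_left e<..<eye_right e}. eye_bot e x < eye_top e x) \<and>
     (\<forall>x\<in>{eye_left e<..<eye_right e}. \<forall>\<sigma>. (x, arc e \<sigma> x) \<notin> left_cusps \<gamma> \<union> right_cusps \<gamma>)"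

definition arc_through :: "eye set \<Rightarrow> real \<times> real \<Rightarrow> eye \<Rightarrow> side \<Rightarrow> bool" where
  "arc_through E p e \<sigma> \<longleftrightarrow>
     e \<in> E \<and> eye_left e < fst p \<and> fst p < eye_right e \<and> arc e \<sigma> (fst p) = snd p"

text \<open>
  For arcs through a common point \<open>p\<close>: the first one runs above the second one on both sides
  of \<open>p\<close>.
\<close>

definition arc_above :: "real \<times> real \<Rightarrow> eye \<Rightarrow> side \<Rightarrow> eye \<Rightarrow> side \<Rightarrow> bool" where
  "arc_above p e \<sigma> e' \<sigma>' \<longleftrightarrow> (\<forall>\<^sub>F x in at (fst p). arc e' \<sigma>' x < arc e \<sigma> x)"

definition normal_at :: "real \<times> real \<Rightarrow> eye \<Rightarrow> eye \<Rightarrow> bool" where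
  "normal_at p e e' \<longleftrightarrow>
     (\<forall>\<^sub>F x in at (fst p).
        {eye_bot e x..eye_top e x} \<inter> {eye_bot e' x..eye_top e' x} = {} \<or>
        {eye_bot e x..eye_top e x} \<subseteq> {eye_bot e' x..eye_top e' x} \<or>
        {eye_bot e' x..eye_top e' x} \<subseteq> {eye_bot e x..eye_top e x})"

text \<open>
  \<open>S\<close> is the set of switches and \<open>E\<close> the set of eyes into which the front decomposes when it
  is smoothed at \<open>S\<close>. The smoothing is not carried out physically: the upper and the lower arc
  that replace a switch \<open>p\<close> are the limiting ones, which touch at \<open>p\<close> and have a corner there
  (upper left end to upper right end, lower left end to lower right end). At a crossing that is
  not a switch the arcs must follow the two transverse branches of the front; this is the
  differentiability clause, since a path in the front that changes branches at a crossing has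
  a corner. That distinct eyes meet only at crossings says that every other point of the front
  belongs to one eye only; it also prevents two elements of \<open>E\<close> from differing merely in the
  irrelevant values of their arcs outside the interval from left to right cusp.
\<close>

definition ruling :: "(real \<Rightarrow> real^3) \<Rightarrow> (real \<times> real) set \<Rightarrow> eye set \<Rightarrow> bool" where
  "ruling \<gamma> S E \<longleftrightarrow>
     S \<subseteq> crossings \<gamma> \<and>
     finite E \<and>
     (\<forall>e\<in>E. is_eye \<gamma> e) \<and>
     range (front \<gamma>) = (\<Union>e\<in>E. eye_curve e) \<and>
     (\<forall>e\<in>E. \<forall>e'\<in>E. e \<noteq> e' \<longrightarrow> eye_curve e \<inter> eye_curve e' \<subseteq> crossings \<gamma>) \<and>
     (\<forall>e\<in>E. \<forall>\<sigma>. \<forall>x\<in>{eye_left e<..<eye_right e}.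
        (x, arc e \<sigma> x) \<notin> S \<longrightarrow> arc e \<sigma> differentiable (at x)) \<and>
     (\<forall>p\<in>S. \<forall>e e' \<sigma> \<sigma>'. arc_through E p e \<sigma> \<and> arc_through E p e' \<sigma>' \<and> e \<noteq> e' \<longrightarrow>
        (arc_above p e \<sigma> e' \<sigma>' \<or> arc_above p e' \<sigma>' e \<sigma>) \<and> normal_at p e e')"


section \<open>The surface of a ruling\<close>

definition quotient_topology :: "'a topology \<Rightarrow> ('a \<Rightarrow> 'b) \<Rightarrow> 'b topology" where
  "quotient_topology X q =
     topology (\<lambda>U. U \<subseteq> q ` topspace X \<and> openin X {x \<in> topspace X. q x \<in> U})"

lemma openin_quotient_topology:
  "openin (quotient_topology X q) U \<longleftrightarrow>
     U \<subseteq> q ` topspace X \<and> openin X {x \<in> topspace X. q x \<in> U}"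
proof -
  have "istopology (\<lambda>U. U \<subseteq> q ` topspace X \<and> openin X {x \<in> topspace X. q x \<in> U})"
    unfolding istopology_def
  proof (intro conjI allI impI)
    fix S T
    assume "S \<subseteq> q ` topspace X \<and> openin X {x \<in> topspace X. q x \<in> S}"
      and "T \<subseteq> q ` topspace X \<and> openin X {x \<in> topspace X. q x \<in> T}"
    moreover have "{x \<in> topspace X. q x \<in> S \<inter> T} =
        {x \<in> topspace X. q x \<in> S} \<inter> {x \<in> topspace X. q x \<in> T}"
      by auto
    ultimately show "S \<inter> T \<subseteq> q ` topspace X" "openin X {x \<in> topspace X. q x \<in> S \<inter> T}"
      by auto
  next
    fix K
    assume K: "\<forall>S\<in>K. S \<subseteq> q ` topspace X \<and> openin X {x \<in> topspace X. q x \<in> S}"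
    then show "\<Union>K \<subseteq> q ` topspace X"
      by blast
    have "{x \<in> topspace X. q x \<in> \<Union>K} = (\<Union>S\<in>K. {x \<in> topspace X. q x \<in> S})"
      by auto
    then show "openin X {x \<in> topspace X. q x \<in> \<Union>K}"
      using K by auto
  qed
  then show ?thesis
    by (simp add: quotient_topology_def topology_inverse')
qed

text \<open>
  The pieces are one disk per eye, namely the closed region bounded by the eye, and one band
  \<open>[0,1] \<times> [-1,1]\<close> per switch, to be attached along \<open>{0} \<times> [-1,1]\<close> and
  \<open>{1} \<times> [-1,1]\<close>.
\<close>

datatype piece = Disk eye | Band "real \<times> real"

fun piece_region :: "piece \<Rightarrow> (real \<times> real) set" where
  "piece_region (Disk e) =
     {(x, z). eye_left e \<le> x \<and> x \<le> eye_right e \<and> eye_bot e x \<le> z \<and> z \<le> eye_top e x}"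
| "piece_region (Band p) = {0..1} \<times> {-1..1}"

definition pieces :: "(real \<times> real) set \<Rightarrow> eye set \<Rightarrow> (piece \<times> real \<times> real) topology" where
  "pieces S E = sum_topology (\<lambda>i. top_of_set (piece_region i)) (Disk ` E \<union> Band ` S)"

text \<open>
  With \<open>\<epsilon>\<close> the half-width of the attaching arcs, the two ends of the band at a switch
  \<open>p = (c, w)\<close> are attached to the upper and the lower arc at \<open>p\<close>, over
  \<open>[c - \<epsilon>, c + \<epsilon>]\<close>, in opposite horizontal directions. This is the half twist: the free
  edge \<open>[0,1] \<times> {-1}\<close> joins the left part of the upper arc to the right part of the lower arc,
  and the free edge \<open>[0,1] \<times> {1}\<close> joins the right part of the upper arc to the left part of
  the lower arc, as the two crossing strands do.
\<close>

definition upper_at :: "eye set \<Rightarrow> real \<times> real \<Rightarrow> eye \<Rightarrow> side \<Rightarrow> bool" where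
  "upper_at E p e \<sigma> \<longleftrightarrow>
     arc_through E p e \<sigma> \<and> (\<exists>e' \<sigma>'. arc_through E p e' \<sigma>' \<and> arc_above p e \<sigma> e' \<sigma>')"

definition lower_at :: "eye set \<Rightarrow> real \<times> real \<Rightarrow> eye \<Rightarrow> side \<Rightarrow> bool" where
  "lower_at E p e \<sigma> \<longleftrightarrow>
     arc_through E p e \<sigma> \<and> (\<exists>e' \<sigma>'. arc_through E p e' \<sigma>' \<and> arc_above p e' \<sigma>' e \<sigma>)"

inductive_set gluing ::
    "real \<Rightarrow> (real \<times> real) set \<Rightarrow> eye set \<Rightarrow> ((piece \<times> real \<times> real) \<times> (piece \<times> real \<times> real)) set"
  for \<epsilon> S E where
  attach_upper: "p \<in> S \<Longrightarrow> upper_at E p e \<sigma> \<Longrightarrow> s \<in> {-1..1} \<Longrightarrow>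
     ((Band p, 0, s), (Disk e, fst p + \<epsilon> * s, arc e \<sigma> (fst p + \<epsilon> * s))) \<in> gluing \<epsilon> S E"
| attach_lower: "p \<in> S \<Longrightarrow> lower_at E p e \<sigma> \<Longrightarrow> s \<in> {-1..1} \<Longrightarrow>
     ((Band p, 1, s), (Disk e, fst p - \<epsilon> * s, arc e \<sigma> (fst p - \<epsilon> * s))) \<in> gluing \<epsilon> S E"

definition ruling_surface ::
    "real \<Rightarrow> (real \<times> real) set \<Rightarrow> eye set \<Rightarrow> (piece \<times> real \<times> real) set topology" where
  "ruling_surface \<epsilon> S E =
     quotient_topology (pieces S E) (\<lambda>a. (gluing \<epsilon> S E \<union> (gluing \<epsilon> S E)\<inverse>)\<^sup>* `` {a})"

text \<open>
  Since switches have distinct \<open>x\<close>-coordinates, every sufficiently small positive \<open>\<epsilon>\<close> is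
  admissible.
\<close>

definition admissible_width :: "real \<Rightarrow> (real \<times> real) set \<Rightarrow> eye set \<Rightarrow> bool" where
  "admissible_width \<epsilon> S E \<longleftrightarrow>
     0 < \<epsilon> \<and>
     (\<forall>p\<in>S. \<forall>e \<sigma>. arc_through E p e \<sigma> \<longrightarrow> eye_left e < fst p - \<epsilon> \<and> fst p + \<epsilon> < eye_right e) \<and>
     (\<forall>p\<in>S. \<forall>q\<in>S. p \<noteq> q \<longrightarrow> 2 * \<epsilon> < \<bar>fst p - fst q\<bar>)"


section \<open>Orientability of topological surfaces\<close>

text \<open>
  A homeomorphism between open sets of the plane preserves orientation iff it maps small
  positively oriented circles around each point to curves of winding number \<open>1\<close> around the
  image point (its local degree is \<open>1\<close>).
\<close>

definition orientation_preserving_on :: "complex set \<Rightarrow> (complex \<Rightarrow> complex) \<Rightarrow> bool" where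
  "orientation_preserving_on W h \<longleftrightarrow>
     (\<forall>z\<in>W. \<forall>\<^sub>F r in at_right 0. winding_number (h \<circ> circlepath z r) (h z) = 1)"

definition planar_chart :: "'a topology \<Rightarrow> 'a set \<Rightarrow> ('a \<Rightarrow> complex) \<Rightarrow> bool" where
  "planar_chart X U \<phi> \<longleftrightarrow>
     openin X U \<and> open (\<phi> ` U) \<and>
     homeomorphic_map (subtopology X U) (top_of_set (\<phi> ` U)) \<phi>"

definition manifold_interior :: "'a topology \<Rightarrow> 'a set" where
  "manifold_interior X = {p. \<exists>U \<phi>. planar_chart X U \<phi> \<and> p \<in> U}"

text \<open>
  A surface with boundary is orientable iff its interior has an atlas all of whose transition
  maps preserve orientation.
\<close>

definition orientable_surface :: "'a topology \<Rightarrow> bool" where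
  "orientable_surface X \<longleftrightarrow>
     (\<exists>A. (\<forall>(U, \<phi>)\<in>A. planar_chart X U \<phi>) \<and>
          manifold_interior X = (\<Union>(U, \<phi>)\<in>A. U) \<and>
          (\<forall>(U, \<phi>)\<in>A. \<forall>(V, \<psi>)\<in>A.
             orientation_preserving_on (\<phi> ` (U \<inter> V)) (\<psi> \<circ> inv_into U \<phi>)))"

end

theory Submission
  imports Defs
begin

text \<open>
  Give every eye an orientation, recorded by a Boolean \<open>\<kappa> e\<close>: it says that the top arc runs to
  the right, so that the bottom arc runs to the left. With this convention the arc \<open>\<sigma>\<close> of \<open>e\<close>
  runs to the right iff \<open>(\<sigma> = Top) = \<kappa> e\<close>. Call \<open>\<kappa>\<close> coherent if at every switch the two arcs
  run in the same horizontal direction. Coherent orientations link the two sides of the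
  equivalence.

  The band at a switch carries a half twist, so the orientations of the two disks extend over it
  iff the two boundary arcs run in the same direction there. Hence the surface is orientable iff a
  coherent \<open>\<kappa>\<close> exists. The disk of an eye together with the bands that leave it, each without its
  far end, is flattened into the plane; on a band the two flattenings differ by a rigid motion,
  which is direct or opposite according to the sides of the eyes on which the band is attached.
  If \<open>\<kappa>\<close> is coherent, reflecting the flattenings with \<open>\<not> \<kappa> e\<close> makes all changes of coordinates
  direct (\<open>orientable_if_coherent\<close>). Conversely an oriented atlas gives every flattened piece a
  sign, namely the local degree of the charts in flat coordinates, and comparing signs along a
  band shows that they form a coherent \<open>\<kappa>\<close> (\<open>coherent_if_orientable\<close>). Points of the boundary of
  the surface cause no trouble: the flattenings are injective but need not be open, and by
  invariance of domain they become charts wherever a planar chart exists at all.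

  On the other side, the parity of a Maslov potential at a point of the knot tells whether the
  knot runs to the right there, so a crossing has even index iff its two branches run in the same
  horizontal direction. If this holds at all switches, then the direction of the knot is constant
  along each arc of each eye, because at a crossing that is not a switch the arc follows a branch,
  and at the two arcs of an eye it is opposite, because at a cusp the knot turns back. This is a
  coherent \<open>\<kappa>\<close> (\<open>coherent_orientation_exists\<close>). Conversely, given a coherent \<open>\<kappa>\<close>, compare along
  the knot the direction of the knot with the direction that \<open>\<kappa>\<close> assigns to the arc on which the
  point lies. Passing a crossing, a switch or a cusp does not alter the answer: at a cusp both
  directions are reversed, and at a switch the two arcs have the same direction. As there is only
  one component, the answer is the same everywhere, in particular on the two branches at a
  switch (\<open>coherent_imp_same_direction\<close>).
\<close>

section \<open>Local degree of maps of the plane\<close>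

definition local_degree :: "(complex \<Rightarrow> complex) \<Rightarrow> complex \<Rightarrow> complex \<Rightarrow> bool" where
  "local_degree h z n \<longleftrightarrow>
     (\<forall>\<^sub>F r in at_right 0. winding_number (h \<circ> circlepath z r) (h z) = n)"

lemma local_degree_unique:
  assumes "local_degree h z m" "local_degree h z n"
  shows "m = n"
proof -
  have "\<forall>\<^sub>F r in at_right (0::real). m = n"
    using assms[unfolded local_degree_def] by eventually_elim simp
  then show ?thesis by (simp add: trivial_limit_at_right_real)
qed

lemma eventually_small_radius:
  assumes "R > (0::real)"
  shows "\<forall>\<^sub>F r in at_right 0. r \<in> {0<..<R}"
  using eventually_at_right_real[OF assms] .

lemma circlepath_in_ball:
  assumes "0 < r" "r < R"
  shows "circlepath z r t \<in> ball z R - {z}"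
proof -
  have "dist z (circlepath z r t) = r"
    using assms by (simp add: circlepath dist_norm norm_mult flip: mult.assoc)
  then show ?thesis using assms by auto
qed

lemma local_degree_cong:
  assumes "\<forall>\<^sub>F w in nhds z. g w = h w"
  shows "local_degree g z n \<longleftrightarrow> local_degree h z n"
proof -
  obtain R where R: "R > 0" "\<And>w. w \<in> ball z R \<Longrightarrow> g w = h w"
    using assms by (auto simp: eventually_nhds_metric dist_commute)
  have "\<forall>\<^sub>F r in at_right (0::real). r \<in> {0<..<R}"
    using R(1) by (rule eventually_small_radius)
  then have *: "\<forall>\<^sub>F r in at_right 0. winding_number (g \<circ> circlepath z r) (g z) =
      winding_number (h \<circ> circlepath z r) (h z)"
  proof eventually_elim
    case (elim r)
    have "g \<circ> circlepath z r = h \<circ> circlepath z r"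
      using circlepath_in_ball[of r R z] elim R by fastforce
    then show ?case using R by auto
  qed
  show ?thesis unfolding local_degree_def
    using * by (auto elim: eventually_elim2)
qed

lemma winding_number_exp_circle:
  assumes "a \<noteq> 0" "k \<in> {1, -1}"
  shows "winding_number (\<lambda>t. w + a * exp (2 * of_real pi * \<i> * k * of_real t)) w = k"
proof -
  let ?q = "linepath (Ln a) (Ln a + 2 * of_real pi * \<i> * k)"
  have "(\<lambda>t. (w + a * exp (2 * of_real pi * \<i> * k * of_real t)) - w) = exp \<circ> ?q"
  proof
    fix t :: real
    have "?q t = Ln a + 2 * of_real pi * \<i> * k * of_real t"
      by (simp add: linepath_def scaleR_conv_of_real algebra_simps)
    then show "(w + a * exp (2 * of_real pi * \<i> * k * of_real t)) - w = (exp \<circ> ?q) t"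
      using assms by (simp add: exp_add)
  qed
  then show ?thesis
    using winding_number_compose_exp[of ?q] assms
    by (subst winding_number_offset) simp
qed

lemma local_degree_rotation:
  assumes "a \<noteq> 0"
  shows "local_degree (\<lambda>w. a * w + b) z 1"
proof -
  have "\<forall>\<^sub>F r in at_right (0::real). r > 0" by (simp add: eventually_at_right_less)
  then show ?thesis unfolding local_degree_def
  proof eventually_elim
    case (elim r)
    have "(\<lambda>w. a * w + b) \<circ> circlepath z r =
       (\<lambda>t. (a * z + b) + (a * r) * exp (2 * of_real pi * \<i> * 1 * of_real t))"
      by (auto simp: circlepath fun_eq_iff algebra_simps)
    then show ?case using winding_number_exp_circle[of "a * r" 1 "a*z+b"] assms elim by simp
  qed
qed

lemma local_degree_reflection:
  assumes "a \<noteq> 0"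
  shows "local_degree (\<lambda>w. a * cnj w + b) z (-1)"
proof -
  have "\<forall>\<^sub>F r in at_right (0::real). r > 0" by (simp add: eventually_at_right_less)
  then show ?thesis unfolding local_degree_def
  proof eventually_elim
    case (elim r)
    have "(\<lambda>w. a * cnj w + b) \<circ> circlepath z r =
       (\<lambda>t. (a * cnj z + b) + (a * r) * exp (2 * of_real pi * \<i> * (-1) * of_real t))"
      by (auto simp: circlepath fun_eq_iff algebra_simps exp_cnj)
    then show ?case using winding_number_exp_circle[of "a * r" "-1" "a*cnj z+b"] assms elim by simp
  qed
qed

text \<open>
  The image of the open ball is connected, and it is both open and closed in the complement of the
  Jordan curve that is the image of the circle; so it lies inside that curve, where the winding
  number is constantly \<open>1\<close> or constantly \<open>-1\<close>.
\<close>

lemma winding_number_injective_image_circle: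
  assumes cont: "continuous_on (ball z R) h" and inj: "inj_on h (ball z R)"
    and r: "0 < r" "r < R"
  shows "\<exists>n\<in>{1,-1}. \<forall>w\<in>ball z r. winding_number (h \<circ> circlepath z r) (h w) = n"
proof -
  let ?p = "h \<circ> circlepath z r"
  have sub: "sphere z r \<subseteq> ball z R" "cball z r \<subseteq> ball z R" "ball z r \<subseteq> ball z R"
    using r by auto
  have img: "path_image ?p = h ` sphere z r"
    using r by (simp add: path_image_compose)
  have sp: "simple_path ?p"
    using r sub
    by (intro simple_path_continuous_image)
      (auto intro: continuous_on_subset[OF cont] inj_on_subset[OF inj] simp: simple_path_circlepath)
  have "open (h ` ball z r)"
    using sub by (intro invariance_of_domain) (auto intro: continuous_on_subset[OF cont] inj_on_subset[OF inj])
  have cb: "h ` cball z r = h ` ball z r \<union> h ` sphere z r"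
    using r by (auto simp: image_Un[symmetric] cball_diff_sphere[symmetric])
  have cpt: "compact (h ` cball z r)"
    using sub by (intro compact_continuous_image) (auto intro: continuous_on_subset[OF cont])
  have disj: "h ` ball z r \<inter> h ` sphere z r = {}"
    using inj_on_image_Int[OF inj sub(3) sub(1)] by auto
  have "h w \<in> inside (path_image ?p)" if w: "w \<in> ball z r" for w
  proof -
    let ?C = "connected_component_set (- path_image ?p) (h w)"
    have nin: "h w \<in> - path_image ?p" using w disj unfolding img by blast
    have "h ` ball z r \<inter> ?C = {} \<or> - h ` cball z r \<inter> ?C = {}"
    proof (rule connectedD[OF connected_connected_component])
      show "open (h ` ball z r)" by fact
      show "open (- h ` cball z r)" using cpt compact_imp_closed by blast
      show "h ` ball z r \<inter> - h ` cball z r \<inter> ?C = {}" using cb by auto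
      show "?C \<subseteq> h ` ball z r \<union> - h ` cball z r"
        using connected_component_subset[of "- path_image ?p" "h w"] img cb by auto
    qed
    moreover have "h w \<in> ?C \<inter> h ` ball z r" using nin w by (simp add: connected_component_refl)
    ultimately have "?C \<subseteq> h ` cball z r" by blast
    then have "bounded ?C" using cpt compact_imp_bounded bounded_subset by blast
    then show ?thesis using nin by (simp add: inside_def)
  qed
  then show ?thesis
    using simple_closed_path_winding_number_inside[OF sp] by (metis insertI1 insertI2)
qed

text \<open>
  The homotopy interpolates linearly between logarithms. The real part of the logarithm stays
  below \<open>ln R\<close> by convexity, so the homotopy stays in the punctured ball, and not just in the
  punctured plane; this is what allows injective maps defined only on the ball to be applied.
\<close>

lemma loop_homotopic_to_small_circle:
  assumes p: "path p" "pathfinish p = pathstart p" "path_image p \<subseteq> ball w R - {w}"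
    and n: "winding_number p w = 1" and \<rho>: "0 < \<rho>" "\<rho> < R"
  shows "homotopic_loops (ball w R - {w}) p (circlepath w \<rho>)"
proof -
  obtain q where q: "path q" "pathfinish q - pathstart q = 2 * of_real pi * \<i> * winding_number p w"
      "\<And>t. t \<in> {0..1} \<Longrightarrow> p t = w + exp (q t)"
    using winding_number_as_continuous_log[OF p(1), of w] p(3) by blast
  define c where "c = (\<lambda>t::real. of_real (ln \<rho>) + 2 * of_real pi * \<i> * of_real t)"
  define H where "H = (\<lambda>(s,t). w + exp ((1 - of_real s) * q t + of_real s * c t))"
  have "continuous_on ({0..1} \<times> {0..1}) H"
    using q(1) unfolding H_def c_def split_def path_def
    by (intro continuous_intros continuous_on_compose2[of "{0..1}" q _ snd]) auto
  moreover have Hin: "H (s,t) \<in> ball w R - {w}" if "s \<in> {0..1}" "t \<in> {0..1}" for s t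
  proof -
    have "p t \<in> ball w R" using p(3) that unfolding path_image_def by blast
    then have "exp (Re (q t)) < R" using q(3)[OF that(2)] by (simp add: dist_norm)
    moreover have "R > 0" using \<rho> by simp
    ultimately have "Re (q t) < ln R" by (metis exp_gt_zero ln_exp ln_less_cancel_iff)
    moreover have "ln \<rho> < ln R" using \<rho> by simp
    ultimately have "(1 - s) * Re (q t) + s * ln \<rho> < ln R"
      using that(1) by (intro convex_bound_lt) auto
    moreover have "Re ((1 - of_real s) * q t + of_real s * c t) = (1 - s) * Re (q t) + s * ln \<rho>"
      by (simp add: c_def)
    ultimately have "exp (Re ((1 - of_real s) * q t + of_real s * c t)) < R"
      by (metis \<open>R > 0\<close> exp_less_mono exp_ln)
    then show ?thesis by (simp add: H_def dist_norm)
  qed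
  then have "H ` ({0..1} \<times> {0..1}) \<subseteq> ball w R - {w}" by blast
  moreover have "H (0,t) = p t" if "t \<in> {0..1}" for t using q(3) that by (simp add: H_def)
  moreover have "H (1,t) = circlepath w \<rho> t" for t
    using \<rho> by (simp add: H_def c_def circlepath exp_add exp_of_real)
  moreover have "H (s,1) = H (s,0)" for s
  proof -
    have "q 1 = q 0 + 2 * of_real pi * \<i>" using q(2) n by (simp add: pathfinish_def pathstart_def algebra_simps)
    then have "(1 - of_real s) * q 1 + of_real s * c 1 =
        ((1 - of_real s) * q 0 + of_real s * c 0) + 2 * of_real pi * \<i>"
      by (simp add: c_def algebra_simps)
    then have "exp ((1 - of_real s) * q 1 + of_real s * c 1) = exp ((1 - of_real s) * q 0 + of_real s * c 0)"
      using exp_add[of "(1 - of_real s) * q 0 + of_real s * c 0" "2 * of_real pi * \<i>"]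
      by (simp only: exp_two_pi_i mult_1_right)
    then show ?thesis by (simp add: H_def)
  qed
  ultimately show ?thesis
    unfolding homotopic_loops by (intro exI[of _ H]) (simp add: pathfinish_def pathstart_def image_subset_iff_funcset)
qed

text \<open>
  The chain rule for degrees in disguise: up to homotopy in the punctured ball, \<open>p\<close> is a small
  circle run once in either direction.
\<close>

lemma winding_number_injective_image_loop:
  assumes g: "continuous_on (ball w R) g" "inj_on g (ball w R)"
    and p: "path p" "pathfinish p = pathstart p" "path_image p \<subseteq> ball w R - {w}"
    and n: "winding_number p w = n" "n \<in> {1,-1}" and \<rho>: "0 < \<rho>" "\<rho> < R"
  shows "winding_number (g \<circ> p) (g w) = n * winding_number (g \<circ> circlepath w \<rho>) (g w)"
proof -
  have *: "winding_number (g \<circ> p) (g w) = winding_number (g \<circ> circlepath w \<rho>) (g w)"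
    if p: "path p" "pathfinish p = pathstart p" "path_image p \<subseteq> ball w R - {w}" "winding_number p w = 1" for p
  proof (rule winding_number_homotopic_loops)
    have "R > 0" using \<rho> by simp
    show "homotopic_loops (- {g w}) (g \<circ> p) (g \<circ> circlepath w \<rho>)"
      using loop_homotopic_to_small_circle[OF p \<rho>]
      by (rule homotopic_loops_continuous_image)
        (use g \<open>R > 0\<close> in \<open>auto intro: continuous_on_subset simp: inj_on_def\<close>)
  qed
  show ?thesis
  proof (cases "n = 1")
    case True then show ?thesis using *[OF p] n by simp
  next
    case False
    then have n: "n = -1" "winding_number p w = -1" using n by auto
    have "winding_number (reversepath p) w = 1"
      using p n by (subst winding_number_reversepath) auto
    then have "winding_number (g \<circ> reversepath p) (g w) = winding_number (g \<circ> circlepath w \<rho>) (g w)"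
      using p by (intro *) auto
    moreover have "g \<circ> reversepath p = reversepath (g \<circ> p)" by (auto simp: reversepath_def)
    moreover have "- winding_number (g \<circ> p) (g w) = winding_number (reversepath (g \<circ> p)) (g w)"
    proof (rule winding_number_reversepath[symmetric])
      show "path (g \<circ> p)" using p g by (intro path_continuous_image) (auto intro: continuous_on_subset)
      show "g w \<notin> path_image (g \<circ> p)" using p(3) g(2) \<rho> by (fastforce simp: path_image_compose inj_on_def)
    qed
    ultimately show ?thesis using n(1) by (metis minus_minus mult_minus1)
  qed
qed

lemma local_degree_locally_constant:
  assumes cont: "continuous_on (ball z R) h" and inj: "inj_on h (ball z R)" and R: "R > 0"
  shows "\<exists>n\<in>{1,-1}. \<forall>\<^sub>F w in nhds z. local_degree h w n"
proof -
  \<comment> \<open>Then the circle of radius \<open>r\<close> about \<open>z\<close> lies in the ball of radius \<open>2 r\<close> about any \<open>w\<close> within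
    distance \<open>r\<close> of \<open>z\<close>, and that ball lies in the domain of \<open>h\<close>.\<close>
  define r where "r = R / 3"
  have r: "0 < r" "r < R" using R by (auto simp: r_def)
  obtain n where n: "n \<in> {1,-1}" and wn: "\<And>w. w \<in> ball z r \<Longrightarrow> winding_number (h \<circ> circlepath z r) (h w) = n"
    using winding_number_injective_image_circle[OF cont inj r] by blast
  have "local_degree h w n" if w: "w \<in> ball z r" for w
  proof -
    have sub: "ball w (2 * r) \<subseteq> ball z R"
    proof
      fix v assume "v \<in> ball w (2 * r)"
      then show "v \<in> ball z R" using w dist_triangle[of z v w] by (auto simp: r_def)
    qed
    have sph: "path_image (circlepath z r) \<subseteq> ball w (2 * r) - {w}"
    proof -
      have "v \<in> ball w (2 * r) - {w}" if "v \<in> sphere z r" for v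
        using w that dist_triangle[of w v z] by (auto simp: dist_commute)
      then show ?thesis using r by (simp add: subset_iff)
    qed
    have 1: "winding_number (circlepath z r) w = 1"
      using w by (intro winding_number_circlepath) (simp add: dist_norm norm_minus_commute)
    have "\<forall>\<^sub>F \<rho> in at_right (0::real). \<rho> \<in> {0<..<2*r}"
      using r(1) by (intro eventually_small_radius) simp
    then show ?thesis unfolding local_degree_def
    proof eventually_elim
      case (elim \<rho>)
      have "winding_number (h \<circ> circlepath z r) (h w) = 1 * winding_number (h \<circ> circlepath w \<rho>) (h w)"
        using elim sph 1 by (intro winding_number_injective_image_loop[where R="2*r"])
          (auto intro: continuous_on_subset[OF cont sub] inj_on_subset[OF inj sub])
      then show ?case using wn[OF w] by simp
    qed
  qed
  then show ?thesis using n r(1) unfolding eventually_nhds_metric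
    by (intro bexI[of _ n] exI[of _ r]) (auto simp: dist_commute)
qed

lemma local_degree_compose:
  assumes h: "continuous_on (ball z Q) h" "inj_on h (ball z Q)" "Q > 0"
    and g: "continuous_on (ball (h z) R) g" "inj_on g (ball (h z) R)" "R > 0"
    and m: "local_degree g (h z) m" and n: "local_degree h z n" "n \<in> {1,-1}"
  shows "local_degree (g \<circ> h) z (n * m)"
proof -
  obtain q where q: "q > 0" "q \<le> Q" "h ` ball z q \<subseteq> ball (h z) R"
  proof -
    have "continuous (at z) h" using h continuous_on_eq_continuous_at[of "ball z Q" h] by auto
    then obtain d where d: "d > 0" "h ` ball z d \<subseteq> ball (h z) R"
      using g(3) unfolding continuous_at_ball by blast
    show ?thesis by (rule that[of "min d Q"]) (use d h(3) in auto)
  qed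
  obtain \<rho> where \<rho>: "0 < \<rho>" "\<rho> < R" "winding_number (g \<circ> circlepath (h z) \<rho>) (g (h z)) = m"
  proof -
    have "\<forall>\<^sub>F \<rho> in at_right (0::real). \<rho> \<in> {0<..<R}"
      using g(3) by (rule eventually_small_radius)
    with m[unfolded local_degree_def]
    have "\<forall>\<^sub>F \<rho> in at_right (0::real). \<rho> \<in> {0<..<R} \<and> winding_number (g \<circ> circlepath (h z) \<rho>) (g (h z)) = m"
      by eventually_elim auto
    then obtain \<rho> where "\<rho> \<in> {0<..<R} \<and> winding_number (g \<circ> circlepath (h z) \<rho>) (g (h z)) = m"
      using eventually_happens'[OF trivial_limit_at_right_real] by blast
    then show ?thesis using that by auto
  qed
  have "\<forall>\<^sub>F r in at_right (0::real). r \<in> {0<..<q}"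
    using q(1) by (rule eventually_small_radius)
  with n(1)[unfolded local_degree_def] show ?thesis
    unfolding local_degree_def
  proof eventually_elim
    case (elim r)
    have sub: "sphere z r \<subseteq> ball z q" using elim by auto
    have sub': "sphere z r \<subseteq> ball z Q" using sub q by auto
    have "h z \<notin> h ` sphere z r"
    proof
      assume "h z \<in> h ` sphere z r"
      then obtain v where "v \<in> sphere z r" "h z = h v" by auto
      then show False using inj_onD[OF h(2), of z v] sub' h(3) elim by auto
    qed
    moreover have "h ` sphere z r \<subseteq> ball (h z) R" using q(3) sub by blast
    ultimately have "path_image (h \<circ> circlepath z r) \<subseteq> ball (h z) R - {h z}"
      using elim by (simp add: path_image_compose subset_Diff_insert)
    moreover have "path (h \<circ> circlepath z r)"
      using elim sub' by (intro path_continuous_image) (auto intro: continuous_on_subset[OF h(1)])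
    ultimately have "winding_number (g \<circ> (h \<circ> circlepath z r)) (g (h z)) =
        n * winding_number (g \<circ> circlepath (h z) \<rho>) (g (h z))"
      using elim n(2) \<rho> g by (intro winding_number_injective_image_loop) (auto simp: pathfinish_compose pathstart_compose)
    then show ?case using \<rho> by (simp add: o_assoc)
  qed
qed

section \<open>Charts and orientations of topological surfaces\<close>

lemma planar_chart_facts:
  assumes "planar_chart X U \<phi>"
  shows planar_chart_open: "openin X U" and planar_chart_subset: "U \<subseteq> topspace X"
    and planar_chart_inj: "inj_on \<phi> U"
    and planar_chart_continuous: "continuous_map (subtopology X U) euclidean \<phi>"
    and planar_chart_inv_into_continuous: "continuous_map (top_of_set (\<phi> ` U)) X (inv_into U \<phi>)"
    and planar_chart_open_image: "\<And>V. openin X V \<Longrightarrow> V \<subseteq> U \<Longrightarrow> open (\<phi> ` V)"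
proof -
  show op: "openin X U" using assms by (simp add: planar_chart_def)
  then show U: "U \<subseteq> topspace X" by (simp add: openin_subset)
  have hom: "homeomorphic_map (subtopology X U) (top_of_set (\<phi> ` U)) \<phi>" and opi: "open (\<phi> ` U)"
    using assms by (auto simp: planar_chart_def)
  have [simp]: "topspace X \<inter> U = U" using U by auto
  show inj: "inj_on \<phi> U"
    using homeomorphic_imp_injective_map[OF hom] by simp
  show "continuous_map (subtopology X U) euclidean \<phi>"
    using homeomorphic_imp_continuous_map[OF hom] by (simp add: continuous_map_in_subtopology)
  obtain g where g: "homeomorphic_maps (subtopology X U) (top_of_set (\<phi> ` U)) \<phi> g"
    using hom by (auto simp: homeomorphic_map_maps)
  then have "continuous_map (top_of_set (\<phi> ` U)) X g"
    by (simp add: homeomorphic_maps_def continuous_map_in_subtopology)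
  moreover have "g y = inv_into U \<phi> y" if "y \<in> \<phi> ` U" for y
    using g that inj by (auto simp: homeomorphic_maps_def)
  ultimately show "continuous_map (top_of_set (\<phi> ` U)) X (inv_into U \<phi>)"
    using continuous_map_eq[of "top_of_set (\<phi> ` U)" X g "inv_into U \<phi>"] by simp
  show "open (\<phi> ` V)" if "openin X V" "V \<subseteq> U" for V
  proof -
    have "openin (subtopology X U) V"
      using that by (simp add: openin_subset_topspace_eq[symmetric] openin_open_subtopology op)
    then have "openin (top_of_set (\<phi> ` U)) (\<phi> ` V)"
      using homeomorphic_map_openness[OF hom, of V] that by (simp add: )
    then show ?thesis using opi by (simp add: openin_open_eq)
  qed
qed

text \<open>
  Invariance of domain, transported by \<open>\<phi>\<close>: any continuous injective map on a surface is a chart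
  near a point that has a chart.
\<close>

lemma planar_chart_of_injective_map:
  assumes chart: "planar_chart X U0 \<phi>" and U: "openin X U" "U \<subseteq> U0"
    and K: "continuous_map (subtopology X U) euclidean K" "inj_on K U"
  shows "planar_chart X U K"
proof -
  note \<phi> = planar_chart_facts[OF chart]
  have top: "topspace (subtopology X U) = U" using U(1) openin_subset by force
  have img: "open (K ` V)" if V: "openin X V" "V \<subseteq> U" for V
  proof -
    have oV: "open (\<phi> ` V)" using \<phi>(6) V U(2) by blast
    have inv: "inv_into U0 \<phi> (\<phi> x) = x" if "x \<in> V" for x
      using that \<phi>(3) V(2) U(2) by (simp add: subset_iff)
    have "continuous_map (top_of_set (\<phi> ` V)) X (inv_into U0 \<phi>)"
      by (rule continuous_map_from_subtopology_mono[OF \<phi>(5)]) (use V U(2) in auto)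
    then have "continuous_map (top_of_set (\<phi> ` V)) (subtopology X U) (inv_into U0 \<phi>)"
      using inv V by (auto simp: continuous_map_in_subtopology)
    then have "continuous_map (top_of_set (\<phi> ` V)) euclidean (K \<circ> inv_into U0 \<phi>)"
      using K(1) continuous_map_compose by blast
    moreover have "inj_on (K \<circ> inv_into U0 \<phi>) (\<phi> ` V)"
    proof -
      have "inv_into U0 \<phi> ` \<phi> ` V = V" using inv V U(2) by (force simp: image_image)
      then show ?thesis
        using V U(2) by (intro comp_inj_on inj_on_inv_into) (auto intro: inj_on_subset[OF K(2)])
    qed
    ultimately have "open ((K \<circ> inv_into U0 \<phi>) ` (\<phi> ` V))"
      using oV by (intro invariance_of_domain) auto
    moreover have "(K \<circ> inv_into U0 \<phi>) ` (\<phi> ` V) = K ` V" using inv V U(2) by (force simp: image_image)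
    ultimately show ?thesis by simp
  qed
  have "homeomorphic_map (subtopology X U) (top_of_set (K ` U)) K"
  proof (rule bijective_open_imp_homeomorphic_map)
    show "continuous_map (subtopology X U) (top_of_set (K ` U)) K"
      using K(1) top by (auto simp: continuous_map_in_subtopology)
    show "open_map (subtopology X U) (top_of_set (K ` U)) K"
      unfolding open_map_def
    proof (intro allI impI)
      fix V assume "openin (subtopology X U) V"
      then have "openin X V" "V \<subseteq> U" using U(1) by (auto simp: openin_open_subtopology)
      then show "openin (top_of_set (K ` U)) (K ` V)"
        by (intro open_subset img) auto
    qed
    show "K ` topspace (subtopology X U) = topspace (top_of_set (K ` U))" using top by simp
    show "inj_on K (topspace (subtopology X U))" using K(2) top by simp
  qed
  then show ?thesis using U(1) img[OF U(1)] by (simp add: planar_chart_def)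
qed

lemma transition_map_facts:
  assumes "planar_chart X U \<phi>" "planar_chart X V \<psi>"
  shows "open (\<phi> ` (U \<inter> V))" "continuous_on (\<phi> ` (U \<inter> V)) (\<psi> \<circ> inv_into U \<phi>)"
    "inj_on (\<psi> \<circ> inv_into U \<phi>) (\<phi> ` (U \<inter> V))"
proof -
  note \<phi> = planar_chart_facts[OF assms(1)] and \<psi> = planar_chart_facts[OF assms(2)]
  show "open (\<phi> ` (U \<inter> V))" using \<phi>(6)[of "U \<inter> V"] \<phi>(1) \<psi>(1) by auto
  have inv: "inv_into U \<phi> (\<phi> x) = x" if "x \<in> U" for x using that \<phi>(3) by simp
  have "continuous_map (top_of_set (\<phi> ` (U \<inter> V))) X (inv_into U \<phi>)"
    by (rule continuous_map_from_subtopology_mono[OF \<phi>(5)]) auto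
  then have "continuous_map (top_of_set (\<phi> ` (U \<inter> V))) (subtopology X V) (inv_into U \<phi>)"
    using inv by (auto simp: continuous_map_in_subtopology)
  then show "continuous_on (\<phi> ` (U \<inter> V)) (\<psi> \<circ> inv_into U \<phi>)"
    using continuous_map_compose[OF _ \<psi>(4)] by fastforce
  have "inv_into U \<phi> ` \<phi> ` (U \<inter> V) = U \<inter> V" using inv by (force simp: image_image)
  then show "inj_on (\<psi> \<circ> inv_into U \<phi>) (\<phi> ` (U \<inter> V))"
    by (intro comp_inj_on inj_on_inv_into) (auto intro: inj_on_subset[OF \<psi>(3)])
qed

text \<open>
  The images of the maps \<open>K i\<close> need not be open; on a surface with boundary they are not. Their
  restrictions to domains of planar charts are charts, and these cover the interior of the
  surface, so no description of the boundary is required.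
\<close>

lemma orientable_surface_by_charts:
  fixes X :: "'a topology" and N :: "'i \<Rightarrow> 'a set" and K :: "'i \<Rightarrow> 'a \<Rightarrow> complex"
  assumes open_N: "\<And>i. i \<in> I \<Longrightarrow> openin X (N i)"
    and cover: "topspace X \<subseteq> (\<Union>i\<in>I. N i)"
    and K: "\<And>i. i \<in> I \<Longrightarrow> continuous_map (subtopology X (N i)) euclidean (K i)"
      "\<And>i. i \<in> I \<Longrightarrow> inj_on (K i) (N i)"
    and trans: "\<And>i j x. i \<in> I \<Longrightarrow> j \<in> I \<Longrightarrow> x \<in> N i \<Longrightarrow> x \<in> N j \<Longrightarrow>
      \<exists>V a b. openin X V \<and> x \<in> V \<and> a \<noteq> 0 \<and> (\<forall>y\<in>V \<inter> N i \<inter> N j. K j y = a * K i y + b)"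
  shows "orientable_surface X"
proof -
  define A where "A = {(U, K i) |U i. i \<in> I \<and> U \<subseteq> N i \<and> planar_chart X U (K i)}"
  have "manifold_interior X \<subseteq> (\<Union>(U,\<phi>)\<in>A. U)"
  proof
    fix x assume "x \<in> manifold_interior X"
    then obtain U0 \<phi> where ch: "planar_chart X U0 \<phi>" and x: "x \<in> U0" by (auto simp: manifold_interior_def)
    have "x \<in> topspace X" using planar_chart_subset[OF ch] x by auto
    then obtain i where i: "i \<in> I" "x \<in> N i" using cover by auto
    have "planar_chart X (U0 \<inter> N i) (K i)"
    proof (rule planar_chart_of_injective_map[OF ch])
      show "openin X (U0 \<inter> N i)" using planar_chart_open[OF ch] open_N[OF i(1)] by auto
      show "continuous_map (subtopology X (U0 \<inter> N i)) euclidean (K i)"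
        by (rule continuous_map_from_subtopology_mono[OF K(1)[OF i(1)]]) auto
    qed (use K(2)[OF i(1)] in \<open>auto intro: inj_on_subset\<close>)
    then have "(U0 \<inter> N i, K i) \<in> A" using i by (auto simp: A_def)
    then show "x \<in> (\<Union>(U,\<phi>)\<in>A. U)" using x i by blast
  qed
  moreover have "orientation_preserving_on (K i ` (U \<inter> V)) (K j \<circ> inv_into U (K i))"
    if i: "i \<in> I" "U \<subseteq> N i" "planar_chart X U (K i)" and j: "j \<in> I" "V \<subseteq> N j" "planar_chart X V (K j)"
    for i j U V
    unfolding orientation_preserving_on_def
  proof
    fix z assume "z \<in> K i ` (U \<inter> V)"
    then obtain x where x: "x \<in> U" "x \<in> V" "z = K i x" by auto
    note \<phi> = planar_chart_facts[OF i(3)] and \<psi> = planar_chart_facts[OF j(3)]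
    obtain V' a b where V': "openin X V'" "x \<in> V'" "a \<noteq> 0" "\<And>y. y \<in> V' \<inter> N i \<inter> N j \<Longrightarrow> K j y = a * K i y + b"
      using trans[of i j x] i j x by blast
    have "open (K i ` (U \<inter> V \<inter> V'))" using \<phi>(6)[of "U \<inter> V \<inter> V'"] \<phi>(1) \<psi>(1) V'(1) by auto
    moreover have "z \<in> K i ` (U \<inter> V \<inter> V')" using x V' by auto
    moreover have "(K j \<circ> inv_into U (K i)) w = a * w + b" if "w \<in> K i ` (U \<inter> V \<inter> V')" for w
    proof -
      obtain y where y: "y \<in> U" "y \<in> V" "y \<in> V'" "w = K i y" using \<open>w \<in> _\<close> by blast
      then have "K j y = a * K i y + b" using V'(4)[of y] i(2) j(2) by blast
      then show ?thesis using y \<phi>(3) by simp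
    qed
    ultimately have "\<forall>\<^sub>F w in nhds z. (K j \<circ> inv_into U (K i)) w = a * w + b"
      unfolding eventually_nhds by blast
    then have "local_degree (K j \<circ> inv_into U (K i)) z 1"
      using local_degree_rotation[OF V'(3), of b z] local_degree_cong[of "K j \<circ> inv_into U (K i)" "\<lambda>w. a * w + b" z 1] by simp
    then show "\<forall>\<^sub>F r in at_right 0. winding_number (K j \<circ> inv_into U (K i) \<circ> circlepath z r) ((K j \<circ> inv_into U (K i)) z) = 1"
      by (simp add: local_degree_def)
  qed
  moreover have "(\<Union>(U,\<phi>)\<in>A. U) \<subseteq> manifold_interior X"
    unfolding A_def manifold_interior_def by blast
  ultimately have "(\<forall>(U, \<phi>)\<in>A. planar_chart X U \<phi>) \<and> manifold_interior X = (\<Union>(U, \<phi>)\<in>A. U) \<and>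
      (\<forall>(U, \<phi>)\<in>A. \<forall>(V, \<psi>)\<in>A. orientation_preserving_on (\<phi> ` (U \<inter> V)) (\<psi> \<circ> inv_into U \<phi>))"
    unfolding A_def by blast
  then show ?thesis unfolding orientable_surface_def by blast
qed

text \<open>
  A connected parametrized patch of an oriented surface has a sign: locally the degree of a chart
  read in the patch is constant, and changing the chart multiplies it by the degree of a
  transition map, which is \<open>1\<close>.
\<close>

lemma orientation_sign_of_patch:
  assumes charts: "\<forall>(U, \<phi>)\<in>A. planar_chart X U \<phi>"
    and cover: "manifold_interior X = (\<Union>(U, \<phi>)\<in>A. U)"
    and oriented: "\<forall>(U, \<phi>)\<in>A. \<forall>(V, \<psi>)\<in>A. orientation_preserving_on (\<phi> ` (U \<inter> V)) (\<psi> \<circ> inv_into U \<phi>)"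
    and W: "open W" "connected W"
    and j: "continuous_map (top_of_set W) X j" "inj_on j W" "j ` W \<subseteq> manifold_interior X"
  shows "\<exists>n\<in>{1,-1}. \<forall>w\<in>W. \<forall>(U, \<phi>)\<in>A. j w \<in> U \<longrightarrow> local_degree (\<phi> \<circ> j) w n"
proof -
  define Sg where "Sg n w \<longleftrightarrow> (\<forall>(U, \<phi>)\<in>A. j w \<in> U \<longrightarrow> local_degree (\<phi> \<circ> j) w n)" for n w
  have facts: "open {v \<in> W. j v \<in> U}" "continuous_on {v \<in> W. j v \<in> U} (\<phi> \<circ> j)" "inj_on (\<phi> \<circ> j) {v \<in> W. j v \<in> U}"
    if "(U, \<phi>) \<in> A" for U \<phi>
  proof -
    note ch = planar_chart_facts[of X U \<phi>]
    have pc: "planar_chart X U \<phi>" using charts that by auto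
    have "openin (top_of_set W) {v \<in> topspace (top_of_set W). j v \<in> U}"
      using j(1) ch(1)[OF pc] by (rule openin_continuous_map_preimage)
    then show "open {v \<in> W. j v \<in> U}" using W(1) by (simp add: openin_open_eq)
    have "continuous_map (top_of_set {v \<in> W. j v \<in> U}) X j"
      using continuous_map_from_subtopology_mono[OF j(1), of "{v \<in> W. j v \<in> U}"] by auto
    then have "continuous_map (top_of_set {v \<in> W. j v \<in> U}) (subtopology X U) j"
      by (auto simp: continuous_map_in_subtopology)
    then have "continuous_map (top_of_set {v \<in> W. j v \<in> U}) euclidean (\<phi> \<circ> j)"
      using continuous_map_compose[OF _ ch(4)[OF pc]] by blast
    then show "continuous_on {v \<in> W. j v \<in> U} (\<phi> \<circ> j)" by simp
    show "inj_on (\<phi> \<circ> j) {v \<in> W. j v \<in> U}"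
      using ch(3)[OF pc] j(2) by (auto simp: inj_on_def)
  qed
  have ex: "\<exists>n\<in>{1,-1}. \<forall>\<^sub>F v in nhds w. Sg n v" if w: "w \<in> W" for w
  proof -
    have "j w \<in> manifold_interior X" using j(3) w by blast
    then have "j w \<in> (\<Union>(U, \<phi>)\<in>A. U)" unfolding cover .
    then obtain U \<phi> where U: "(U, \<phi>) \<in> A" "j w \<in> U" by auto
    define Q where "Q = {v \<in> W. j v \<in> U}"
    note F = facts[OF U(1), folded Q_def]
    have pU: "planar_chart X U \<phi>" using charts U by auto
    have "w \<in> Q" using w U by (simp add: Q_def)
    then obtain R where R: "R > 0" "ball w R \<subseteq> Q" using F(1) open_contains_ball by blast
    obtain n where n: "n \<in> {1,-1}" "\<forall>\<^sub>F v in nhds w. local_degree (\<phi> \<circ> j) v n"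
      using local_degree_locally_constant[of w R "\<phi> \<circ> j"] R(1)
        continuous_on_subset[OF F(2) R(2)] inj_on_subset[OF F(3) R(2)] by blast
    have "\<forall>\<^sub>F v in nhds w. v \<in> Q" using F(1) \<open>w \<in> Q\<close> by (rule eventually_nhds_in_open)
    with n(2) have "\<forall>\<^sub>F v in nhds w. Sg n v"
    proof eventually_elim
      case (elim v)
      show ?case unfolding Sg_def
      proof (clarify)
        fix V \<psi> assume V: "(V, \<psi>) \<in> A" "j v \<in> V"
        have pV: "planar_chart X V \<psi>" using charts V by auto
        let ?g = "\<psi> \<circ> inv_into U \<phi>"
        note T = transition_map_facts[OF pU pV]
        have in_UV: "(\<phi> \<circ> j) v \<in> \<phi> ` (U \<inter> V)" using elim V by (auto simp: Q_def)
        obtain R2 where R2: "R2 > 0" "ball ((\<phi> \<circ> j) v) R2 \<subseteq> \<phi> ` (U \<inter> V)"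
          using T(1) in_UV open_contains_ball by blast
        obtain R1 where R1: "R1 > 0" "ball v R1 \<subseteq> Q" using F(1) elim open_contains_ball by blast
        have "local_degree ?g ((\<phi> \<circ> j) v) 1"
          using oriented U(1) V(1) in_UV unfolding orientation_preserving_on_def local_degree_def by blast
        then have "local_degree (?g \<circ> (\<phi> \<circ> j)) v (n * 1)"
          by (intro local_degree_compose[of v R1 "\<phi> \<circ> j" R2] elim(1) n(1)
              continuous_on_subset[OF F(2) R1(2)] inj_on_subset[OF F(3) R1(2)] R1(1)
              continuous_on_subset[OF T(2) R2(2)] inj_on_subset[OF T(3) R2(2)] R2(1))
        moreover have "\<forall>\<^sub>F u in nhds v. (?g \<circ> (\<phi> \<circ> j)) u = (\<psi> \<circ> j) u"
          using eventually_nhds_in_open[OF F(1) elim(2)]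
          by eventually_elim (use planar_chart_inj[OF pU] in \<open>simp add: Q_def\<close>)
        ultimately show "local_degree (\<psi> \<circ> j) v n" using local_degree_cong by fastforce
      qed
    qed
    with n(1) show ?thesis by blast
  qed
  define T where "T n = {w. \<forall>\<^sub>F v in nhds w. Sg n v}" for n
  have oT: "open (T n)" for n
  proof -
    have "T n = \<Union>{Q. open Q \<and> (\<forall>w\<in>Q. Sg n w)}" unfolding T_def eventually_nhds by blast
    then show ?thesis by auto
  qed
  have disj: "T 1 \<inter> T (-1) \<inter> W = {}"
  proof -
    have False if "w \<in> W" "w \<in> T 1" "w \<in> T (-1)" for w
    proof -
      have s: "Sg 1 w" "Sg (-1) w" using that by (auto simp: T_def dest: eventually_nhds_x_imp_x)
      have "j w \<in> manifold_interior X" using j(3) that by blast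
      then have "j w \<in> (\<Union>(U, \<phi>)\<in>A. U)" unfolding cover .
      then obtain U \<phi> where U: "(U, \<phi>) \<in> A" "j w \<in> U" by auto
      then have "local_degree (\<phi> \<circ> j) w 1" "local_degree (\<phi> \<circ> j) w (-1)"
        using s by (auto simp: Sg_def)
      then show False using local_degree_unique by fastforce
    qed
    then show ?thesis by blast
  qed
  have "W \<subseteq> T 1 \<union> T (-1)" using ex by (auto simp: T_def)
  with connectedD[OF W(2) oT oT disj] have "W \<subseteq> T 1 \<or> W \<subseteq> T (-1)" by blast
  then obtain n where n: "n \<in> {1,-1}" "W \<subseteq> T n" by blast
  have "Sg n w" if "w \<in> W" for w
    using n(2) that eventually_nhds_x_imp_x[of "Sg n" w] by (auto simp: T_def)
  then show ?thesis using n(1) unfolding Sg_def by blast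
qed

text \<open>
  A continuous injection of a compact set into the plane is a homeomorphism onto its image, so the
  inverse of \<open>K\<close> is continuous over \<open>W\<close>.
\<close>

lemma planar_chart_of_compact:
  assumes N: "openin X N" and K: "continuous_map (subtopology X N) euclidean K" "inj_on K N"
    and C: "compactin X C" "C \<subseteq> N" and W: "open W" "W \<subseteq> K ` C"
  shows "planar_chart X {x \<in> N. K x \<in> W} K" "K ` {x \<in> N. K x \<in> W} = W"
proof -
  let ?U = "{x \<in> N. K x \<in> W}"
  have top: "topspace (subtopology X N) = N" using N openin_subset by fastforce
  have "openin (subtopology X N) {x \<in> topspace (subtopology X N). K x \<in> W}"
    using K(1) W(1) by (intro openin_continuous_map_preimage[where Y=euclidean]) auto
  then have oU: "openin X ?U" using N top by (metis openin_open_subtopology)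
  show KU: "K ` ?U = W" using W(2) C(2) by auto
  have UC: "?U \<subseteq> C"
  proof
    fix x assume x: "x \<in> ?U"
    then obtain c where c: "c \<in> C" "K x = K c" using W(2) by auto
    then have "x = c" using inj_onD[OF K(2)] x C(2) by blast
    then show "x \<in> C" using c by simp
  qed
  have Ct: "topspace (subtopology X C) = C" using C(1) by (simp add: compactin_subset_topspace Int_absorb1)
  have "homeomorphic_map (subtopology X C) (top_of_set (K ` C)) K"
  proof (rule continuous_imp_homeomorphic_map)
    show "continuous_map (subtopology X C) (top_of_set (K ` C)) K"
      using continuous_map_from_subtopology_mono[OF K(1) C(2)] Ct by (auto simp: continuous_map_in_subtopology)
    show "compact_space (subtopology X C)" using C(1) by (simp add: compact_space_subtopology)
    show "Hausdorff_space (top_of_set (K ` C))" by (simp add: Hausdorff_space_subtopology)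
    show "K ` topspace (subtopology X C) = topspace (top_of_set (K ` C))" using Ct by simp
    show "inj_on K (topspace (subtopology X C))" using Ct K(2) C(2) inj_on_subset by metis
  qed
  then have "homeomorphic_map (subtopology (subtopology X C) ?U) (subtopology (top_of_set (K ` C)) W) K"
  proof (rule homeomorphic_map_subtopologies)
    show "K ` (topspace (subtopology X C) \<inter> ?U) = topspace (top_of_set (K ` C)) \<inter> W"
    proof -
      have "C \<inter> ?U = ?U" "K ` C \<inter> W = W" using UC W(2) by blast+
      then show ?thesis unfolding Ct topspace_euclidean_subtopology by (simp only: KU)
    qed
  qed
  moreover have "subtopology (subtopology X C) ?U = subtopology X ?U"
    using UC by (simp add: subtopology_subtopology Int_absorb1)
  moreover have "subtopology (top_of_set (K ` C)) W = top_of_set W"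
    using W(2) by (simp add: subtopology_subtopology Int_absorb1)
  ultimately show "planar_chart X ?U K"
    unfolding planar_chart_def KU using oU W(1) by simp
qed

section \<open>Gluing along a matching\<close>

text \<open>
  Every point is glued to at most one other point, so the equivalence classes have at most two
  elements.
\<close>

lemma rtrancl_matching:
  assumes "single_valued G" "single_valued (G\<inverse>)" "Domain G \<inter> Range G = {}"
  shows "(G \<union> G\<inverse>)\<^sup>* = Id \<union> G \<union> G\<inverse>"
proof
  show "(G \<union> G\<inverse>)\<^sup>* \<subseteq> Id \<union> G \<union> G\<inverse>"
  proof
    fix x assume "x \<in> (G \<union> G\<inverse>)\<^sup>*"
    then have "(fst x, snd x) \<in> (G \<union> G\<inverse>)\<^sup>*" by simp
    then have "(fst x, snd x) \<in> Id \<union> G \<union> G\<inverse>"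
    proof (induction rule: rtrancl_induct)
      case (step y z)
      then show ?case using assms unfolding single_valued_def by blast
    qed simp
    then show "x \<in> Id \<union> G \<union> G\<inverse>" by simp
  qed
qed auto

lemma quotient_topology_facts:
  fixes q :: "'a \<Rightarrow> 'b"
  shows topspace_quotient_topology: "topspace (quotient_topology P q) = q ` topspace P"
    and continuous_map_quotient_topology: "continuous_map P (quotient_topology P q) q"
proof -
  have "openin (quotient_topology P q) (q ` topspace P)"
  proof -
    have "{x \<in> topspace P. q x \<in> q ` topspace P} = topspace P" by auto
    then show ?thesis unfolding openin_quotient_topology by simp
  qed
  moreover have "U \<subseteq> q ` topspace P" if "openin (quotient_topology P q) U" for U
    using that unfolding openin_quotient_topology by simp
  ultimately show top: "topspace (quotient_topology P q) = q ` topspace P"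
    by (meson openin_subset openin_topspace subset_antisym)
  show "continuous_map P (quotient_topology P q) q"
    unfolding continuous_map_def top openin_quotient_topology by auto
qed

lemma openin_quotient_saturated:
  assumes "openin P Q" "\<And>a b. a \<in> topspace P \<Longrightarrow> b \<in> Q \<Longrightarrow> q a = q b \<Longrightarrow> a \<in> Q"
  shows "openin (quotient_topology P q) (q ` Q)"
proof -
  have "Q \<subseteq> topspace P" using assms(1) openin_subset by blast
  then have "{x \<in> topspace P. q x \<in> q ` Q} = Q" using assms(2) by blast
  then show ?thesis using assms(1) \<open>Q \<subseteq> topspace P\<close> unfolding openin_quotient_topology by auto
qed

section \<open>Orientability of the surface of a ruling\<close>

text \<open>
  Here \<open>\<kappa> e\<close> means that the boundary of \<open>e\<close> is oriented with its top arc running to the right;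
  then \<open>(\<sigma> = Top) = \<kappa> e\<close> says that the arc \<open>\<sigma>\<close> of \<open>e\<close> runs to the right.
\<close>

definition coherent_orientation ::
    "(real \<times> real) set \<Rightarrow> eye set \<Rightarrow> (eye \<Rightarrow> bool) \<Rightarrow> bool" where
  "coherent_orientation S E \<kappa> \<longleftrightarrow>
     (\<forall>p\<in>S. \<forall>e \<sigma> e' \<sigma>'. arc_through E p e \<sigma> \<and> arc_through E p e' \<sigma>' \<longrightarrow>
        ((\<sigma> = Top) = \<kappa> e) = ((\<sigma>' = Top) = \<kappa> e'))"

lemma max_thickness:
  fixes \<eta> h :: real
  assumes "0 < \<eta>" "0 \<le> z" "z \<le> h"
  shows "0 \<le> z / max h \<eta>" "z / max h \<eta> \<le> 1"
  using assms by (auto simp: divide_le_eq_1 max_def)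

text \<open>
  The structure of a ruling near its switches that determines the surface. The two ends of the
  band at \<open>p\<close> are told apart by a Boolean, which is \<open>True\<close> at the end \<open>t = 0\<close> that is attached to
  the upper arc.
\<close>

locale banded_disks =
  fixes S :: "(real \<times> real) set" and E :: "eye set" and \<epsilon> :: real
    and at_eye :: "real \<times> real \<Rightarrow> bool \<Rightarrow> eye" and at_side :: "real \<times> real \<Rightarrow> bool \<Rightarrow> side"
  assumes finite_S: "finite S"
    and eye_nonempty: "e \<in> E \<Longrightarrow> eye_left e < eye_right e"
    and arc_continuous: "e \<in> E \<Longrightarrow> continuous_on {eye_left e..eye_right e} (arc e \<sigma>)"
    and eye_ends: "e \<in> E \<Longrightarrow> eye_top e (eye_left e) = eye_bot e (eye_left e)"
      "e \<in> E \<Longrightarrow> eye_top e (eye_right e) = eye_bot e (eye_right e)"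
    and eye_inside: "e \<in> E \<Longrightarrow> eye_left e < x \<Longrightarrow> x < eye_right e \<Longrightarrow> eye_bot e x < eye_top e x"
    and upper: "p \<in> S \<Longrightarrow> upper_at E p e \<sigma> \<longleftrightarrow> e = at_eye p True \<and> \<sigma> = at_side p True"
    and lower: "p \<in> S \<Longrightarrow> lower_at E p e \<sigma> \<longleftrightarrow> e = at_eye p False \<and> \<sigma> = at_side p False"
    and arcs: "p \<in> S \<Longrightarrow> arc_through E p e \<sigma> \<Longrightarrow> \<exists>b. e = at_eye p b \<and> \<sigma> = at_side p b"
    and distinct_eyes: "p \<in> S \<Longrightarrow> at_eye p True \<noteq> at_eye p False"
    and width: "admissible_width \<epsilon> S E"
begin

lemma at_eye_inj: "p \<in> S \<Longrightarrow> at_eye p b = at_eye p b' \<longleftrightarrow> b = b'"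
  using distinct_eyes[of p] by (cases b; cases b') auto

lemma at_arc: "p \<in> S \<Longrightarrow> arc_through E p (at_eye p b) (at_side p b)"
  using upper[of p "at_eye p True" "at_side p True"] lower[of p "at_eye p False" "at_side p False"]
  by (cases b) (auto simp: upper_at_def lower_at_def)

lemma at_eye_E: "p \<in> S \<Longrightarrow> at_eye p b \<in> E"
  using at_arc by (auto simp: arc_through_def)

lemma eps_pos: "\<epsilon> > 0" using width by (simp add: admissible_width_def)

lemma switch_inside_eye: "p \<in> S \<Longrightarrow> eye_left (at_eye p b) < fst p - \<epsilon> \<and> fst p + \<epsilon> < eye_right (at_eye p b)"
  using width at_arc unfolding admissible_width_def by blast

lemma switch_separation: "p \<in> S \<Longrightarrow> p' \<in> S \<Longrightarrow> \<bar>fst p - fst p'\<bar> \<le> 2 * \<epsilon> \<Longrightarrow> p = p'"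
  using width unfolding admissible_width_def by (metis linorder_not_less)

lemma eye_thick: "e \<in> E \<Longrightarrow> eye_left e \<le> x \<Longrightarrow> x \<le> eye_right e \<Longrightarrow> eye_bot e x \<le> eye_top e x"
  using eye_ends[of e] eye_inside[of e x] by (cases "x = eye_left e \<or> x = eye_right e") auto

text \<open>
  In coordinates adapted to the end \<open>b\<close> of a band, \<open>xpos\<close> is the abscissa of the point to which
  the parameter \<open>s\<close> is attached, and \<open>depth\<close> the distance from that end.
\<close>

definition xpos :: "real \<times> real \<Rightarrow> bool \<Rightarrow> real \<Rightarrow> real" where
  "xpos p b s = (if b then fst p + \<epsilon> * s else fst p - \<epsilon> * s)"

definition depth :: "bool \<Rightarrow> real \<Rightarrow> real" where
  "depth b t = (if b then t else 1 - t)"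

lemma xpos_bounds:
  assumes "s \<in> {-1..1}"
  shows "fst p - \<epsilon> \<le> xpos p b s" "xpos p b s \<le> fst p + \<epsilon>"
proof -
  have "\<bar>\<epsilon> * s\<bar> \<le> \<epsilon>" using assms eps_pos by (simp add: abs_mult mult_left_le abs_le_iff)
  then show "fst p - \<epsilon> \<le> xpos p b s" "xpos p b s \<le> fst p + \<epsilon>" by (auto simp: xpos_def abs_le_iff)
qed

lemma xpos_inside_eye:
  assumes "p \<in> S" "s \<in> {-1..1}"
  shows "eye_left (at_eye p b) < xpos p b s" "xpos p b s < eye_right (at_eye p b)"
  using xpos_bounds[OF assms(2), of p b] switch_inside_eye[OF assms(1), of b] by auto

lemma gluing_iff:
  "(u, v) \<in> gluing \<epsilon> S E \<longleftrightarrow> (\<exists>p\<in>S. \<exists>b. \<exists>s\<in>{-1..1}. u = (Band p, (if b then 0 else 1), s) \<and>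
     v = (Disk (at_eye p b), xpos p b s, arc (at_eye p b) (at_side p b) (xpos p b s)))"
  (is "?l \<longleftrightarrow> ?r")
proof
  obtain i t r j x z where uv: "u = (i, t, r)" "v = (j, x, z)" by (cases u; cases v)
  assume ?l
  then have "((i, t, r), (j, x, z)) \<in> gluing \<epsilon> S E" by (simp add: uv)
  then show ?r
  proof cases
    case (attach_upper p e \<sigma>)
    then show ?thesis using upper
      by (intro bexI[of _ p] exI[of _ True] bexI[of _ r]) (auto simp: xpos_def uv)
  next
    case (attach_lower p e \<sigma>)
    then show ?thesis using lower
      by (intro bexI[of _ p] exI[of _ False] bexI[of _ r]) (auto simp: xpos_def uv)
  qed
next
  assume ?r
  then obtain p b s where *: "p \<in> S" "s \<in> {-1..1}" "u = (Band p, (if b then 0 else 1), s)"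
    "v = (Disk (at_eye p b), xpos p b s, arc (at_eye p b) (at_side p b) (xpos p b s))" by blast
  show ?l
  proof (cases b)
    case True
    then show ?thesis using * upper gluing.attach_upper[of p S E "at_eye p True" "at_side p True" s \<epsilon>]
      by (simp add: xpos_def)
  next
    case False
    then show ?thesis using * lower gluing.attach_lower[of p S E "at_eye p False" "at_side p False" s \<epsilon>]
      by (simp add: xpos_def)
  qed
qed

definition glued :: "((piece \<times> real \<times> real) \<times> (piece \<times> real \<times> real)) set" where
  "glued = (gluing \<epsilon> S E \<union> (gluing \<epsilon> S E)\<inverse>)\<^sup>*"

lemma glued_eq: "glued = Id \<union> gluing \<epsilon> S E \<union> (gluing \<epsilon> S E)\<inverse>"
  unfolding glued_def
proof (rule rtrancl_matching)
  show "single_valued (gluing \<epsilon> S E)"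
    unfolding single_valued_def gluing_iff by (auto split: if_splits)
  have same: "p = p' \<and> b = b' \<and> s = s'"
    if "p \<in> S" "p' \<in> S" "s \<in> {-1..1}" "s' \<in> {-1..1}" "at_eye p b = at_eye p' b'" "xpos p b s = xpos p' b' s'"
    for p p' b b' s s'
  proof -
    have "\<bar>fst p - fst p'\<bar> \<le> 2 * \<epsilon>"
      using xpos_bounds[OF that(3), of p b] xpos_bounds[OF that(4), of p' b'] that(6) by linarith
    then have "p = p'" by (rule switch_separation[OF that(1,2)])
    moreover have "b = b'" using at_eye_inj[OF that(1), of b b'] that(5) \<open>p = p'\<close> by simp
    ultimately show ?thesis using that(6) eps_pos by (auto simp: xpos_def split: if_splits)
  qed
  show "single_valued ((gluing \<epsilon> S E)\<inverse>)"
  proof (rule single_valuedI, unfold converse_iff)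
    fix v u u' assume "(u, v) \<in> gluing \<epsilon> S E" "(u', v) \<in> gluing \<epsilon> S E"
    then obtain p b s p' b' s' where "p \<in> S" "p' \<in> S" "s \<in> {-1..1}" "s' \<in> {-1..1}"
      "u = (Band p, (if b then 0 else 1), s)" "u' = (Band p', (if b' then 0 else 1), s')"
      "v = (Disk (at_eye p b), xpos p b s, arc (at_eye p b) (at_side p b) (xpos p b s))"
      "v = (Disk (at_eye p' b'), xpos p' b' s', arc (at_eye p' b') (at_side p' b') (xpos p' b' s'))"
      unfolding gluing_iff by blast
    then show "u = u'" using same[of p p' s s' b b'] by simp
  qed
  show "Domain (gluing \<epsilon> S E) \<inter> Range (gluing \<epsilon> S E) = {}"
    by (auto simp: gluing_iff)
qed

definition cls :: "piece \<times> real \<times> real \<Rightarrow> (piece \<times> real \<times> real) set" where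
  "cls a = glued `` {a}"

lemma cls_eq_iff: "cls a = cls b \<longleftrightarrow> (a, b) \<in> glued"
proof -
  have "equiv UNIV glued"
    unfolding glued_def by (intro equivI refl_rtrancl trans_rtrancl sym_rtrancl sym_Un_converse) auto
  then show ?thesis unfolding cls_def by (simp add: eq_equiv_class_iff)
qed

abbreviation "Surf \<equiv> ruling_surface \<epsilon> S E"

lemma Surf_eq: "Surf = quotient_topology (pieces S E) cls"
  unfolding ruling_surface_def cls_def[abs_def] glued_def ..

lemma topspace_pieces: "topspace (pieces S E) = Sigma (Disk ` E \<union> Band ` S) piece_region"
  by (simp add: pieces_def o_def)

lemma openin_pieces:
  "openin (pieces S E) Q \<longleftrightarrow> Q \<subseteq> topspace (pieces S E) \<and>
     (\<forall>i\<in>Disk ` E \<union> Band ` S. openin (top_of_set (piece_region i)) {y. (i, y) \<in> Q})"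
  unfolding topspace_pieces unfolding pieces_def openin_sum_topology by (simp add: o_def)

text \<open>
  The attaching arcs avoid the cusps by the admissibility of \<open>\<epsilon>\<close>, so over each of them the eye has
  a positive minimal height.
\<close>

lemma thickness_exists:
  "\<exists>\<eta>>0. \<forall>p\<in>S. \<forall>b. \<forall>x\<in>{fst p - \<epsilon>..fst p + \<epsilon>}. \<eta> \<le> eye_top (at_eye p b) x - eye_bot (at_eye p b) x"
proof -
  have one: "\<exists>\<eta>>0. \<forall>x\<in>{fst p - \<epsilon>..fst p + \<epsilon>}. \<eta> \<le> eye_top (at_eye p b) x - eye_bot (at_eye p b) x"
    if p: "p \<in> S" for p b
  proof -
    let ?e = "at_eye p b" let ?I = "{fst p - \<epsilon>..fst p + \<epsilon>}"
    have sub: "?I \<subseteq> {eye_left ?e..eye_right ?e}" using switch_inside_eye[OF p, of b] by auto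
    have "continuous_on ?I (\<lambda>x. eye_top ?e x - eye_bot ?e x)"
      using continuous_on_subset[OF arc_continuous[OF at_eye_E[OF p], of b Top] sub]
        continuous_on_subset[OF arc_continuous[OF at_eye_E[OF p], of b Bot] sub]
      by (intro continuous_intros) auto
    moreover have "?I \<noteq> {}" using eps_pos by simp
    ultimately obtain x0 where x0: "x0 \<in> ?I" "\<And>x. x \<in> ?I \<Longrightarrow> eye_top ?e x0 - eye_bot ?e x0 \<le> eye_top ?e x - eye_bot ?e x"
      using continuous_attains_inf[OF compact_Icc, of "fst p - \<epsilon>" "fst p + \<epsilon>"] by blast
    have "eye_top ?e x0 - eye_bot ?e x0 > 0"
      using eye_inside[OF at_eye_E[OF p], of b x0] switch_inside_eye[OF p, of b] x0(1) by auto
    then show ?thesis using x0(2) by blast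
  qed
  have "\<forall>i\<in>S \<times> UNIV. \<exists>\<eta>>0. \<forall>x\<in>{fst (fst i) - \<epsilon>..fst (fst i) + \<epsilon>}.
      \<eta> \<le> eye_top (at_eye (fst i) (snd i)) x - eye_bot (at_eye (fst i) (snd i)) x"
    using one by (auto simp: mem_Times_iff)
  then obtain f where f: "\<And>i. i \<in> S \<times> UNIV \<Longrightarrow> f i > 0 \<and> (\<forall>x\<in>{fst (fst i) - \<epsilon>..fst (fst i) + \<epsilon>}.
      f i \<le> eye_top (at_eye (fst i) (snd i)) x - eye_bot (at_eye (fst i) (snd i)) x)"
    by metis
  define \<eta> where "\<eta> = Min (insert 1 (f ` (S \<times> UNIV)))"
  have fin: "finite (f ` (S \<times> (UNIV::bool set)))" using finite_S by simp
  have "\<eta> > 0" unfolding \<eta>_def using fin f by (subst Min_gr_iff) auto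
  moreover have "\<eta> \<le> eye_top (at_eye p b) x - eye_bot (at_eye p b) x"
    if p: "p \<in> S" and x: "x \<in> {fst p - \<epsilon>..fst p + \<epsilon>}" for p b x
  proof -
    have "f (p, b) \<le> eye_top (at_eye p b) x - eye_bot (at_eye p b) x"
      using f[of "(p, b)"] p x by auto
    moreover have "\<eta> \<le> f (p, b)" unfolding \<eta>_def using fin p by (intro Min_le) auto
    ultimately show ?thesis by linarith
  qed
  ultimately show ?thesis by blast
qed

end

locale flattened_disks = banded_disks +
  fixes \<eta> :: real
  assumes eta_pos: "\<eta> > 0"
    and thick: "p \<in> S \<Longrightarrow> fst p - \<epsilon> \<le> x \<Longrightarrow> x \<le> fst p + \<epsilon> \<Longrightarrow> \<eta> \<le> eye_top (at_eye p b) x - eye_bot (at_eye p b) x"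
begin

text \<open>
  Heights in the eye are divided by its height, but near the cusps only by \<open>\<eta>\<close>, which keeps the map
  continuous there. As the eye has height at least \<open>\<eta>\<close> over the attaching arcs, these become
  segments on the lines of ordinates \<open>0\<close> and \<open>1\<close>, and the bands become rectangles below and above
  them.
\<close>

definition flat :: "eye \<Rightarrow> piece \<times> real \<times> real \<Rightarrow> complex" where
  "flat e a = (case a of
      (Disk e', x, z) \<Rightarrow> Complex x ((z - eye_bot e' x) / max (eye_top e' x - eye_bot e' x) \<eta>)
    | (Band p, t, s) \<Rightarrow> (let b = (at_eye p True = e) in
        Complex (xpos p b s) (if at_side p b = Top then 1 + depth b t else - depth b t)))"

lemma flat_Disk: "flat e (Disk e', x, z) = Complex x ((z - eye_bot e' x) / max (eye_top e' x - eye_bot e' x) \<eta>)"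
  by (simp add: flat_def)

lemma flat_Band:
  assumes "p \<in> S"
  shows "flat (at_eye p b) (Band p, t, s) = Complex (xpos p b s) (if at_side p b = Top then 1 + depth b t else - depth b t)"
proof -
  have "(at_eye p True = at_eye p b) = b" using at_eye_inj[OF assms, of True b] by auto
  then show ?thesis by (simp add: flat_def)
qed

text \<open>
  The disk of \<open>e\<close> with the bands attached to it. Without their far ends these form an open set that
  is saturated for the gluing, although the bands lead on to other eyes.
\<close>

definition star_dom :: "eye \<Rightarrow> (piece \<times> real \<times> real) set" where
  "star_dom e = {a \<in> topspace (pieces S E). case a of (Disk e', y) \<Rightarrow> e' = e
     | (Band p, t, s) \<Rightarrow> \<exists>b. at_eye p b = e \<and> depth b t < 1}"

lemma star_dom_Disk: "(Disk e', x, z) \<in> star_dom e \<longleftrightarrow>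
    e' = e \<and> e \<in> E \<and> eye_left e \<le> x \<and> x \<le> eye_right e \<and> eye_bot e x \<le> z \<and> z \<le> eye_top e x"
  by (auto simp: star_dom_def topspace_pieces)

lemma star_dom_Band: "(Band p, t, s) \<in> star_dom e \<longleftrightarrow>
    p \<in> S \<and> t \<in> {0..1} \<and> s \<in> {-1..1} \<and> (\<exists>b. at_eye p b = e \<and> depth b t < 1)"
  by (auto simp: star_dom_def topspace_pieces)

lemma flat_continuous_Disk:
  assumes "e' \<in> E"
  shows "continuous_on (piece_region (Disk e')) (\<lambda>y. flat e (Disk e', y))"
proof -
  let ?R = "piece_region (Disk e')"
  have arc: "continuous_on ?R (\<lambda>y. arc e' \<sigma> (fst y))" for \<sigma>
    by (rule continuous_on_compose2[OF arc_continuous[OF assms]]) (auto intro!: continuous_intros)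
  have "continuous_on ?R (\<lambda>y. of_real (fst y) + \<i> * of_real ((snd y - eye_bot e' (fst y)) / max (eye_top e' (fst y) - eye_bot e' (fst y)) \<eta>))"
    using arc[of Top] arc[of Bot] eta_pos by (intro continuous_intros) (auto simp: max_def)
  moreover have "flat e (Disk e', y) = of_real (fst y) + \<i> * of_real ((snd y - eye_bot e' (fst y)) / max (eye_top e' (fst y) - eye_bot e' (fst y)) \<eta>)" for y
    by (cases y) (simp add: flat_Disk Complex_eq)
  ultimately show ?thesis by simp
qed

lemma flat_continuous_Band: "continuous_on A (\<lambda>y. flat e (Band p, y))"
proof -
  let ?b = "at_eye p True = e"
  have "continuous_on A (\<lambda>y. of_real (xpos p ?b (snd y)) + \<i> * of_real (if at_side p ?b = Top then 1 + depth ?b (fst y) else - depth ?b (fst y)))"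
    unfolding xpos_def depth_def
    by (cases ?b; cases "at_side p ?b") (auto intro!: continuous_intros)
  moreover have "flat e (Band p, y) = of_real (xpos p ?b (snd y)) + \<i> * of_real (if at_side p ?b = Top then 1 + depth ?b (fst y) else - depth ?b (fst y))" for y
    by (cases y) (simp add: flat_def Let_def Complex_eq)
  ultimately show ?thesis by simp
qed

lemma glued_star_dom:
  assumes uv: "(u, v) \<in> gluing \<epsilon> S E"
  shows "u \<in> star_dom e \<longleftrightarrow> v \<in> star_dom e" "u \<in> star_dom e \<Longrightarrow> flat e u = flat e v"
proof -
  obtain p b s where *: "p \<in> S" "s \<in> {-1..1}" "u = (Band p, (if b then 0 else 1), s)"
    "v = (Disk (at_eye p b), xpos p b s, arc (at_eye p b) (at_side p b) (xpos p b s))"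
    using uv gluing_iff by blast
  let ?x = "xpos p b s"
  have x: "eye_left (at_eye p b) < ?x" "?x < eye_right (at_eye p b)" using xpos_inside_eye[OF *(1,2)] by auto
  have le: "eye_bot (at_eye p b) ?x < eye_top (at_eye p b) ?x" using eye_inside[OF at_eye_E[OF *(1)] x] .
  have ueq: "u \<in> star_dom e \<longleftrightarrow> at_eye p b = e"
  proof
    assume "u \<in> star_dom e"
    then obtain b' where "at_eye p b' = e" "depth b' (if b then 0 else 1) < 1" unfolding * star_dom_Band by blast
    moreover then have "b' = b" by (auto simp: depth_def split: if_splits)
    ultimately show "at_eye p b = e" by simp
  next
    assume "at_eye p b = e"
    then show "u \<in> star_dom e" using *(1,2) unfolding *(3) star_dom_Band
      by (auto simp: depth_def intro!: exI[of _ b])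
  qed
  have veq: "v \<in> star_dom e \<longleftrightarrow> at_eye p b = e"
    unfolding *(4) star_dom_Disk using x le at_eye_E[OF *(1)] by (cases "at_side p b") auto
  show "u \<in> star_dom e \<longleftrightarrow> v \<in> star_dom e" using ueq veq by simp
  assume "u \<in> star_dom e"
  then have e: "e = at_eye p b" using ueq by simp
  have th: "\<eta> \<le> eye_top e ?x - eye_bot e ?x" unfolding e using thick[OF *(1)] xpos_bounds[OF *(2)] by auto
  then have mx: "max (eye_top e ?x - eye_bot e ?x) \<eta> = eye_top e ?x - eye_bot e ?x" by simp
  have "eye_top e ?x - eye_bot e ?x \<noteq> 0" using th eta_pos by simp
  then show "flat e u = flat e v"
    using mx unfolding *(3,4) e flat_Band[OF *(1)] flat_Disk
    by (cases "at_side p b") (auto simp: depth_def)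
qed

lemma star_dom_saturated:
  assumes "cls a = cls b" "b \<in> star_dom e"
  shows "a \<in> star_dom e" "flat e a = flat e b"
  using assms glued_star_dom[of a b e] glued_star_dom[of b a e]
  unfolding cls_eq_iff glued_eq by auto

text \<open>
  Disk and bands occupy the ordinates in \<open>[0,1]\<close> and outside \<open>(0,1)\<close> respectively, so they meet
  only in attaching arcs, and different bands on one side have disjoint ranges of abscissae.
\<close>

lemma flat_injective:
  assumes a: "a \<in> star_dom e" and a': "a' \<in> star_dom e" and eq: "flat e a = flat e a'"
  shows "cls a = cls a'"
proof -
  have mixed: "(a, a') \<in> gluing \<epsilon> S E" if a: "a \<in> star_dom e" and a': "a' \<in> star_dom e"
    and eq: "flat e a = flat e a'" and band: "a = (Band p, t, s)" and disk: "a' = (Disk e', x, z)" for a a' p t s e' x z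
  proof -
    obtain b where p: "p \<in> S" "t \<in> {0..1}" "s \<in> {-1..1}" and b: "at_eye p b = e" "depth b t < 1"
      using a unfolding band star_dom_Band by blast
    have e': "e' = e" "eye_bot e x \<le> z" "z \<le> eye_top e x" using a' unfolding disk star_dom_Disk by auto
    have x: "x = xpos p b s" and im: "(if at_side p b = Top then 1 + depth b t else - depth b t) =
        (z - eye_bot e x) / max (eye_top e x - eye_bot e x) \<eta>"
      using eq flat_Band[OF p(1), of b t s] unfolding band disk flat_Disk b(1) e'(1) by auto
    have d0: "depth b t \<ge> 0" using p(2) by (auto simp: depth_def)
    have bounds: "0 \<le> (z - eye_bot e x) / max (eye_top e x - eye_bot e x) \<eta>" "(z - eye_bot e x) / max (eye_top e x - eye_bot e x) \<eta> \<le> 1"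
      using max_thickness[OF eta_pos, of "z - eye_bot e x" "eye_top e x - eye_bot e x"] e' by auto
    have mpos: "max (eye_top e x - eye_bot e x) \<eta> > 0" using eta_pos by (simp add: max_def)
    have d: "depth b t = 0" using im bounds d0 by (auto split: if_splits)
    then have t: "t = (if b then 0 else 1)" by (auto simp: depth_def split: if_splits)
    have z: "z = arc e (at_side p b) x"
    proof (cases "at_side p b")
      case Top
      then have "z - eye_bot e x = max (eye_top e x - eye_bot e x) \<eta>" using im d mpos by (simp add: divide_eq_eq)
      then have "z = eye_top e x" using e' by (auto simp: max_def split: if_splits)
      then show ?thesis using Top by simp
    next
      case Bot
      then have "z = eye_bot e x" using im d mpos by (simp add: eq_divide_eq)
      then show ?thesis using Bot by simp
    qed
    show ?thesis unfolding gluing_iff band disk using p b(1) e'(1) t x z by blast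
  qed
  obtain i y1 y2 where ai: "a = (i, y1, y2)" by (cases a)
  obtain i' y1' y2' where ai': "a' = (i', y1', y2')" by (cases a')
  show ?thesis
  proof (cases i; cases i')
    fix e1 e2 assume i: "i = Disk e1" "i' = Disk e2"
    have "e1 = e" "e2 = e" using a a' unfolding ai ai' i star_dom_Disk by auto
    moreover have "max (eye_top e x - eye_bot e x) \<eta> \<noteq> 0" for x using eta_pos by (simp add: max_def)
    ultimately show ?thesis using eq unfolding ai ai' i flat_Disk by auto
  next
    fix e1 p assume i: "i = Disk e1" "i' = Band p"
    then have "(a', a) \<in> gluing \<epsilon> S E" using mixed[OF a' a eq[symmetric]] ai ai' by blast
    then show ?thesis unfolding cls_eq_iff glued_eq by blast
  next
    fix e1 p assume i: "i = Band p" "i' = Disk e1"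
    then have "(a, a') \<in> gluing \<epsilon> S E" using mixed[OF a a' eq] ai ai' by blast
    then show ?thesis unfolding cls_eq_iff glued_eq by blast
  next
    fix p p' assume i: "i = Band p" "i' = Band p'"
    obtain b where p: "p \<in> S" "y2 \<in> {-1..1}" and b: "at_eye p b = e"
      using a unfolding ai i star_dom_Band by blast
    obtain b' where p': "p' \<in> S" "y2' \<in> {-1..1}" and b': "at_eye p' b' = e"
      using a' unfolding ai' i star_dom_Band by blast
    have F: "Complex (xpos p b y2) (if at_side p b = Top then 1 + depth b y1 else - depth b y1) =
       Complex (xpos p' b' y2') (if at_side p' b' = Top then 1 + depth b' y1' else - depth b' y1')"
      using eq flat_Band[OF p(1), of b y1 y2] flat_Band[OF p'(1), of b' y1' y2'] b b' unfolding ai ai' i by simp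
    then have x: "xpos p b y2 = xpos p' b' y2'" by simp
    have "\<bar>fst p - fst p'\<bar> \<le> 2 * \<epsilon>"
      using xpos_bounds[OF p(2), of p b] xpos_bounds[OF p'(2), of p' b'] x by linarith
    then have "p = p'" by (rule switch_separation[OF p(1) p'(1)])
    moreover have "b = b'" using at_eye_inj[OF p(1), of b b'] b b' \<open>p = p'\<close> by simp
    ultimately have "y2 = y2'" "y1 = y1'" "i = i'"
      using F eps_pos i by (auto simp: xpos_def depth_def split: if_splits)
    then show ?thesis by (simp add: ai ai')
  qed
qed

lemma openin_flat_preimage:
  assumes e: "e \<in> E" and V: "open V"
  shows "openin (pieces S E) {a \<in> star_dom e. flat e a \<in> V}"
  unfolding openin_pieces
proof (intro conjI ballI)
  show "{a \<in> star_dom e. flat e a \<in> V} \<subseteq> topspace (pieces S E)" by (auto simp: star_dom_def)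
  fix i assume i: "i \<in> Disk ` E \<union> Band ` S"
  then consider e' where "i = Disk e'" "e' \<in> E" | p where "i = Band p" "p \<in> S" by blast
  then show "openin (top_of_set (piece_region i)) {y. (i, y) \<in> {a \<in> star_dom e. flat e a \<in> V}}"
  proof cases
    case (1 e')
    show ?thesis
    proof (cases "e' = e")
      case True
      have "{y. (i, y) \<in> {a \<in> star_dom e. flat e a \<in> V}} = piece_region i \<inter> (\<lambda>y. flat e (i, y)) -` V"
        using 1 True by (auto simp: star_dom_Disk)
      then show ?thesis using continuous_openin_preimage_gen[OF flat_continuous_Disk[OF 1(2)] V] 1 by simp
    next
      case False
      then have "{y. (i, y) \<in> {a \<in> star_dom e. flat e a \<in> V}} = {}" using 1 by (auto simp: star_dom_Disk)
      then show ?thesis by (simp only: openin_empty)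
    qed
  next
    case (2 p)
    define Q where "Q = {y::real \<times> real. \<exists>b. at_eye p b = e \<and> depth b (fst y) < 1}"
    have "Q = (\<Union>b\<in>{b. at_eye p b = e}. {y. depth b (fst y) < 1})" by (auto simp: Q_def)
    moreover have "open {y::real \<times> real. depth b (fst y) < 1}" for b
      unfolding depth_def by (cases b) (auto intro!: open_Collect_less continuous_intros)
    ultimately have "open Q" by auto
    then have "openin (top_of_set (piece_region i)) (piece_region i \<inter> Q)" by (simp add: openin_open_Int)
    moreover have "openin (top_of_set (piece_region i)) (piece_region i \<inter> (\<lambda>y. flat e (i, y)) -` V)"
      using continuous_openin_preimage_gen[OF flat_continuous_Band V] 2 by simp
    moreover have "{y. (i, y) \<in> {a \<in> star_dom e. flat e a \<in> V}} = (piece_region i \<inter> Q) \<inter> (piece_region i \<inter> (\<lambda>y. flat e (i, y)) -` V)"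
      using 2 by (auto simp: star_dom_Band Q_def)
    ultimately show ?thesis by (metis openin_Int)
  qed
qed

definition star :: "eye \<Rightarrow> (piece \<times> real \<times> real) set set" where
  "star e = cls ` star_dom e"

definition chart :: "eye \<Rightarrow> (piece \<times> real \<times> real) set \<Rightarrow> complex" where
  "chart e x = flat e (SOME a. a \<in> star_dom e \<and> cls a = x)"

lemma chart_cls: "a \<in> star_dom e \<Longrightarrow> chart e (cls a) = flat e a"
proof -
  assume a: "a \<in> star_dom e"
  have "(SOME b. b \<in> star_dom e \<and> cls b = cls a) \<in> star_dom e \<and> cls (SOME b. b \<in> star_dom e \<and> cls b = cls a) = cls a"
    by (rule someI[of _ a]) (use a in simp)
  then show ?thesis using star_dom_saturated(2) a unfolding chart_def by blast
qed

lemma openin_star_part: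
  assumes "e \<in> E" "open V"
  shows "openin Surf {x \<in> star e. chart e x \<in> V}"
proof -
  have "{x \<in> star e. chart e x \<in> V} = cls ` {a \<in> star_dom e. flat e a \<in> V}"
    using chart_cls by (auto simp: star_def)
  moreover have "openin Surf (cls ` {a \<in> star_dom e. flat e a \<in> V})"
    unfolding Surf_eq
  proof (rule openin_quotient_saturated[OF openin_flat_preimage[OF assms]])
    fix a b assume b: "b \<in> {a \<in> star_dom e. flat e a \<in> V}" and ab: "cls a = cls b"
    then have "b \<in> star_dom e" "flat e b \<in> V" by simp_all
    then show "a \<in> {a \<in> star_dom e. flat e a \<in> V}"
      using star_dom_saturated[OF ab] by simp
  qed
  ultimately show ?thesis by simp
qed

lemma star_open: "e \<in> E \<Longrightarrow> openin Surf (star e)"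
  using openin_star_part[of e UNIV] by simp

lemma chart_continuous:
  assumes "e \<in> E"
  shows "continuous_map (subtopology Surf (star e)) euclidean (chart e)"
proof -
  have "topspace (subtopology Surf (star e)) = star e"
    using star_open[OF assms] openin_subset by fastforce
  then show ?thesis
    using openin_star_part[OF assms] openin_open_subtopology[OF star_open[OF assms]]
    by (auto simp: continuous_map_def)
qed

lemma chart_injective: "inj_on (chart e) (star e)"
proof (rule inj_onI)
  fix x y assume "x \<in> star e" "y \<in> star e" and eq: "chart e x = chart e y"
  then obtain a b where ab: "a \<in> star_dom e" "b \<in> star_dom e" "x = cls a" "y = cls b"
    unfolding star_def by blast
  have "flat e a = flat e b" using eq chart_cls[OF ab(1)] chart_cls[OF ab(2)] ab(3,4) by simp
  then show "x = y" using flat_injective[OF ab(1,2)] ab(3,4) by simp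
qed

lemma stars_cover: "topspace Surf \<subseteq> (\<Union>e\<in>E. star e)"
proof
  fix x assume "x \<in> topspace Surf"
  then obtain a where a: "a \<in> topspace (pieces S E)" "x = cls a"
    unfolding Surf_eq topspace_quotient_topology by blast
  obtain i y1 y2 where ai: "a = (i, y1, y2)" by (cases a)
  have "\<exists>e\<in>E. a \<in> star_dom e"
  proof (cases i)
    case (Disk e)
    then show ?thesis using a(1) unfolding ai topspace_pieces by (intro bexI[of _ e]) (auto simp: star_dom_Disk)
  next
    case (Band p)
    then have p: "p \<in> S" "y1 \<in> {0..1}" "y2 \<in> {-1..1}" using a(1) unfolding ai topspace_pieces by auto
    define b where "b \<longleftrightarrow> y1 < 1"
    have "a \<in> star_dom (at_eye p b)"
      unfolding ai Band star_dom_Band using p by (auto simp: b_def depth_def intro!: exI[of _ b])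
    then show ?thesis using at_eye_E[OF p(1)] by blast
  qed
  then show "x \<in> (\<Union>e\<in>E. star e)" using a(2) by (auto simp: star_def)
qed

text \<open>
  A band attached at the bottom hangs down and is reflected by the flattening, while a band
  attached at the top stands upright. The other end of the band contributes a rotation by a half
  turn.
\<close>

lemma flat_Band_rigid:
  assumes p: "p \<in> S"
  shows "\<exists>a c. a \<in> {1,-1} \<and> (\<forall>t s. flat (at_eye p b) (Band p, t, s) =
    a * (if at_side p b = Top then Complex (\<epsilon> * s) t else cnj (Complex (\<epsilon> * s) t)) + c)"
  unfolding flat_Band[OF p]
proof (cases b)
  case True
  then show "\<exists>a c. a \<in> {1,-1} \<and> (\<forall>t s. Complex (xpos p b s) (if at_side p b = Top then 1 + depth b t else - depth b t) =
    a * (if at_side p b = Top then Complex (\<epsilon> * s) t else cnj (Complex (\<epsilon> * s) t)) + c)"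
    by (intro exI[of _ "1::complex"] exI[of _ "Complex (fst p) (if at_side p b = Top then 1 else 0)"])
      (simp add: complex_eq_iff xpos_def depth_def)
next
  case False
  then show "\<exists>a c. a \<in> {1,-1} \<and> (\<forall>t s. Complex (xpos p b s) (if at_side p b = Top then 1 + depth b t else - depth b t) =
    a * (if at_side p b = Top then Complex (\<epsilon> * s) t else cnj (Complex (\<epsilon> * s) t)) + c)"
    by (intro exI[of _ "-1::complex"] exI[of _ "Complex (fst p) (if at_side p b = Top then 2 else -1)"])
      (simp add: complex_eq_iff xpos_def depth_def)
qed

lemma open_band:
  assumes p: "p \<in> S"
  shows "openin Surf (cls ` {(Band p, t, s) |t s. t \<in> {0<..<1} \<and> s \<in> {-1..1}})"
  unfolding Surf_eq
proof (rule openin_quotient_saturated)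
  let ?Q = "{(Band p, t, s) |t s. t \<in> {0<..<1} \<and> s \<in> {-1..1}}"
  show "openin (pieces S E) ?Q"
    unfolding openin_pieces
  proof (intro conjI ballI)
    show "?Q \<subseteq> topspace (pieces S E)" using p by (auto simp: topspace_pieces)
    fix i assume "i \<in> Disk ` E \<union> Band ` S"
    show "openin (top_of_set (piece_region i)) {y. (i, y) \<in> ?Q}"
    proof (cases "i = Band p")
      case True
      have "{y. (i, y) \<in> ?Q} = piece_region i \<inter> ({0<..<1} \<times> UNIV)" using True by auto
      moreover have "open ({0<..<1::real} \<times> (UNIV::real set))" by (intro open_Times) auto
      ultimately show ?thesis by (simp add: openin_open_Int)
    next
      case False
      then have empty: "{y. (i, y) \<in> ?Q} = {}" by auto
      show ?thesis by (subst empty) (rule openin_empty)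
    qed
  qed
  fix a b assume "b \<in> ?Q" "cls a = cls b"
  then show "a \<in> ?Q" unfolding cls_eq_iff glued_eq by (auto simp: gluing_iff split: if_splits)
qed

lemma stars_overlap:
  assumes x: "x \<in> star e" "x \<in> star e'" and ne: "e \<noteq> e'"
  shows "\<exists>p\<in>S. \<exists>b. \<exists>t\<in>{0<..<1}. \<exists>s\<in>{-1..1}. e = at_eye p b \<and> e' = at_eye p (\<not> b) \<and> x = cls (Band p, t, s)"
proof -
  obtain a where a: "a \<in> star_dom e" "x = cls a" using x(1) by (auto simp: star_def)
  obtain a' where a': "a' \<in> star_dom e'" "x = cls a'" using x(2) by (auto simp: star_def)
  have ae': "a \<in> star_dom e'" using star_dom_saturated(1) a a' by metis
  obtain i y1 y2 where ai: "a = (i, y1, y2)" by (cases a)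
  show ?thesis
  proof (cases i)
    case (Disk e1)
    then show ?thesis using a(1) ae' ne by (auto simp: ai star_dom_Disk)
  next
    case (Band p)
    obtain b where b: "p \<in> S" "y1 \<in> {0..1}" "y2 \<in> {-1..1}" "at_eye p b = e" "depth b y1 < 1"
      using a(1) unfolding ai Band star_dom_Band by blast
    obtain b' where b': "at_eye p b' = e'" "depth b' y1 < 1"
      using ae' unfolding ai Band star_dom_Band by blast
    have "b' = (\<not> b)" using b(4) b'(1) ne by (cases b; cases b') auto
    moreover then have "y1 \<in> {0<..<1}" using b(2,5) b'(2) by (auto simp: depth_def split: if_splits)
    ultimately show ?thesis using b b' a(2) ai Band by blast
  qed
qed

text \<open>
  Two stars overlap only in open bands. There the flattenings, reflected for the eyes with
  \<open>\<not> \<kappa> e\<close>, are both direct or both opposite in the coordinates of the band, by coherence.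
\<close>

lemma orientable_if_coherent:
  assumes coh: "coherent_orientation S E \<kappa>"
  shows "orientable_surface Surf"
proof (rule orientable_surface_by_charts[where I=E and N=star and K="\<lambda>e x. if \<kappa> e then chart e x else cnj (chart e x)"])
  show "openin Surf (star e)" if "e \<in> E" for e using star_open[OF that] .
  show "topspace Surf \<subseteq> (\<Union>e\<in>E. star e)" by (rule stars_cover)
  show "continuous_map (subtopology Surf (star e)) euclidean (\<lambda>x. if \<kappa> e then chart e x else cnj (chart e x))" if "e \<in> E" for e
  proof (cases "\<kappa> e")
    case True then show ?thesis using chart_continuous[OF that] by simp
  next
    case False
    have "continuous_map euclidean euclidean cnj" by (simp add: continuous_on_cnj)
    from continuous_map_compose[OF chart_continuous[OF that] this] show ?thesis using False by (simp add: o_def)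
  qed
  show "inj_on (\<lambda>x. if \<kappa> e then chart e x else cnj (chart e x)) (star e)" for e
    using chart_injective[of e] by (auto simp: inj_on_def)
  show "\<exists>V a b. openin Surf V \<and> x \<in> V \<and> a \<noteq> 0 \<and> (\<forall>y\<in>V \<inter> star e \<inter> star e'.
      (if \<kappa> e' then chart e' y else cnj (chart e' y)) = a * (if \<kappa> e then chart e y else cnj (chart e y)) + b)"
    if e: "e \<in> E" "e' \<in> E" and x: "x \<in> star e" "x \<in> star e'" for e e' x
  proof (cases "e = e'")
    case True
    show ?thesis by (rule exI[of _ "star e"], rule exI[of _ 1], rule exI[of _ 0]) (use True e x star_open in simp)
  next
    case False
    obtain p b t s where p: "p \<in> S" "t \<in> {0<..<1}" "s \<in> {-1..1}" "e = at_eye p b" "e' = at_eye p (\<not> b)" "x = cls (Band p, t, s)"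
      using stars_overlap[OF x False] by blast
    have co: "((at_side p b = Top) = \<kappa> e) = ((at_side p (\<not> b) = Top) = \<kappa> e')"
      using coh p(1) at_arc[OF p(1), of b] at_arc[OF p(1), of "\<not> b"] p(4,5) unfolding coherent_orientation_def by blast
    define \<beta> where "\<beta> t s = (if (at_side p b = Top) = \<kappa> e then Complex (\<epsilon> * s) t else cnj (Complex (\<epsilon> * s) t))" for t s
    have form: "\<exists>a c. a \<in> {1,-1} \<and> (\<forall>t s. (if \<kappa> (at_eye p b') then flat (at_eye p b') (Band p, t, s) else cnj (flat (at_eye p b') (Band p, t, s))) = a * \<beta> t s + c)"
      if "((at_side p b' = Top) = \<kappa> (at_eye p b')) = ((at_side p b = Top) = \<kappa> e)" for b'
    proof -
      obtain a c where ac: "a \<in> {1,-1}" "\<And>t s. flat (at_eye p b') (Band p, t, s) =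
        a * (if at_side p b' = Top then Complex (\<epsilon> * s) t else cnj (Complex (\<epsilon> * s) t)) + c"
        using flat_Band_rigid[OF p(1), of b'] by blast
      have ca: "cnj a = a" using ac(1) by auto
      show ?thesis
      proof (cases "\<kappa> (at_eye p b')")
        case True
        then show ?thesis using ac that by (intro exI[of _ a] exI[of _ c]) (auto simp: \<beta>_def)
      next
        case False
        then show ?thesis using ac that ca by (intro exI[of _ a] exI[of _ "cnj c"]) (auto simp: \<beta>_def)
      qed
    qed
    obtain a1 c1 where 1: "a1 \<in> {1,-1}" "\<And>t s. (if \<kappa> e then flat e (Band p, t, s) else cnj (flat e (Band p, t, s))) = a1 * \<beta> t s + c1"
      using form[of b] p(4) by auto
    obtain a2 c2 where 2: "a2 \<in> {1,-1}" "\<And>t s. (if \<kappa> e' then flat e' (Band p, t, s) else cnj (flat e' (Band p, t, s))) = a2 * \<beta> t s + c2"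
      using form[of "\<not> b"] p(5) co by auto
    let ?V = "cls ` {(Band p, t, s) |t s. t \<in> {0<..<1} \<and> s \<in> {-1..1}}"
    have main: "(if \<kappa> e' then chart e' y else cnj (chart e' y)) = a2 * a1 * (if \<kappa> e then chart e y else cnj (chart e y)) + (c2 - a2 * a1 * c1)"
      if y: "y \<in> ?V" for y
    proof -
      obtain t s where ts: "y = cls (Band p, t, s)" "t \<in> {0<..<1}" "s \<in> {-1..1}" using y by blast
      have "(Band p, t, s) \<in> star_dom (at_eye p c)" for c
        unfolding star_dom_Band using p(1) ts(2,3) by (auto simp: depth_def intro!: exI[of _ c])
      then have "(Band p, t, s) \<in> star_dom e" "(Band p, t, s) \<in> star_dom e'" unfolding p(4,5) by blast+
      then have vals: "chart e y = flat e (Band p, t, s)" "chart e' y = flat e' (Band p, t, s)" using chart_cls ts(1) by auto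
      have "a1 * a1 = 1" using 1(1) by auto
      then have "a2 * \<beta> t s + c2 = a2 * a1 * (a1 * \<beta> t s + c1) + (c2 - a2 * a1 * c1)"
        by (simp add: algebra_simps)
      then show ?thesis unfolding vals 1(2)[of t s] 2(2)[of t s] .
    qed
    show ?thesis
    proof (intro exI conjI ballI)
      show "openin Surf ?V" by (rule open_band[OF p(1)])
      show "x \<in> ?V" using p by blast
      show "a2 * a1 \<noteq> 0" using 1(1) 2(1) by auto
      fix y assume "y \<in> ?V \<inter> star e \<inter> star e'"
      then show "(if \<kappa> e' then chart e' y else cnj (chart e' y)) = a2 * a1 * (if \<kappa> e then chart e y else cnj (chart e y)) + (c2 - a2 * a1 * c1)"
        using main by blast
    qed
  qed
qed

definition thickness :: "eye \<Rightarrow> real \<Rightarrow> real" where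
  "thickness e x = (eye_top e x - eye_bot e x) / max (eye_top e x - eye_bot e x) \<eta>"

definition core :: "eye \<Rightarrow> complex set" where
  "core e = {w. eye_left e < Re w \<and> Re w < eye_right e \<and> 0 < Im w \<and> Im w < thickness e (Re w)}"

definition strip :: "real \<times> real \<Rightarrow> bool \<Rightarrow> complex set" where
  "strip p b = {w. fst p - \<epsilon> < Re w \<and> Re w < fst p + \<epsilon> \<and>
     (if at_side p b = Top then 0 < Im w \<and> Im w < 7/4 else -3/4 < Im w \<and> Im w < 1)}"

text \<open>
  An open connected set of interior points of the flattened star. Bands are cut off at depth \<open>3/4\<close>:
  the part that remains lies in a compact set, while the parts that remain at the two ends of a
  band still overlap.
\<close>

definition flat_domain :: "eye \<Rightarrow> complex set" where
  "flat_domain e = \<Union>({core e} \<union> (\<lambda>(p, b). core e \<union> strip p b) ` {(p, b). p \<in> S \<and> at_eye p b = e})"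

lemma max_eta_pos: "max h \<eta> > 0"
  using eta_pos by (simp add: max_def)

lemma thickness_continuous:
  assumes "e \<in> E"
  shows "continuous_on {eye_left e..eye_right e} (thickness e)"
  unfolding thickness_def
  using arc_continuous[OF assms, of Top] arc_continuous[OF assms, of Bot] max_eta_pos
  by (intro continuous_intros) (auto simp: less_imp_neq[THEN not_sym])

lemma thickness_pos: "e \<in> E \<Longrightarrow> eye_left e < x \<Longrightarrow> x < eye_right e \<Longrightarrow> 0 < thickness e x"
  unfolding thickness_def using eye_inside[of e x] max_eta_pos by simp

lemma thickness_at_switch:
  assumes "p \<in> S" "fst p - \<epsilon> \<le> x" "x \<le> fst p + \<epsilon>"
  shows "thickness (at_eye p b) x = 1"
proof -
  have "\<eta> \<le> eye_top (at_eye p b) x - eye_bot (at_eye p b) x" using thick[OF assms] .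
  then show ?thesis using eta_pos unfolding thickness_def by (simp add: max_absorb1)
qed

lemma core_open: "e \<in> E \<Longrightarrow> open (core e)"
proof -
  assume e: "e \<in> E"
  let ?R = "{w. eye_left e < Re w \<and> Re w < eye_right e}"
  have oR: "open ?R" by (intro open_Collect_conj open_Collect_less continuous_intros)
  have "continuous_on ?R (\<lambda>w. thickness e (Re w) - Im w)"
    by (intro continuous_intros continuous_on_compose2[OF thickness_continuous[OF e]]) auto
  then have "open (?R \<inter> (\<lambda>w. thickness e (Re w) - Im w) -` {0<..})"
    using oR by (rule continuous_open_preimage) auto
  moreover have "open {w. 0 < Im w}" by (intro open_Collect_less continuous_intros)
  ultimately have "open ((?R \<inter> (\<lambda>w. thickness e (Re w) - Im w) -` {0<..}) \<inter> {w. 0 < Im w})"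
    by (rule open_Int)
  moreover have "core e = (?R \<inter> (\<lambda>w. thickness e (Re w) - Im w) -` {0<..}) \<inter> {w. 0 < Im w}"
    by (auto simp: core_def)
  ultimately show ?thesis by simp
qed

lemma core_connected:
  assumes e: "e \<in> E"
  shows "connected (core e)"
proof -
  let ?Q = "{eye_left e<..<eye_right e} \<times> {0<..<1::real}"
  let ?f = "\<lambda>y. of_real (fst y) + \<i> * of_real (snd y * thickness e (fst y))"
  have "core e = ?f ` ?Q"
  proof
    show "core e \<subseteq> ?f ` ?Q"
    proof
      fix w assume w: "w \<in> core e"
      then have m: "thickness e (Re w) > 0" using thickness_pos[OF e] by (simp add: core_def)
      have "w = ?f (Re w, Im w / thickness e (Re w))" using m by (simp add: complex_eq_iff)
      moreover have "(Re w, Im w / thickness e (Re w)) \<in> ?Q" using w m by (simp add: core_def)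
      ultimately show "w \<in> ?f ` ?Q" by blast
    qed
    show "?f ` ?Q \<subseteq> core e"
    proof
      fix w assume "w \<in> ?f ` ?Q"
      then obtain y where "w = ?f y" "y \<in> ?Q" by blast
      then obtain x u where xu: "w = ?f (x, u)" "eye_left e < x" "x < eye_right e" "0 < u" "u < 1"
        by (cases y) auto
      then show "w \<in> core e" using thickness_pos[OF e xu(2,3)] by (simp add: core_def)
    qed
  qed
  moreover have "connected (?f ` ?Q)"
  proof (rule connected_continuous_image)
    show "continuous_on ?Q ?f"
      by (intro continuous_intros continuous_on_compose2[OF thickness_continuous[OF e]]) auto
    show "connected ?Q" by (intro convex_connected convex_Times convex_real_interval)
  qed
  ultimately show ?thesis by simp
qed

lemma strip_open: "open (strip p b)"
  unfolding strip_def by (cases "at_side p b") (auto intro!: open_Collect_conj open_Collect_less continuous_intros)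

lemma strip_connected: "connected (strip p b)"
proof -
  have "convex ({w. Re w > fst p - \<epsilon>} \<inter> {w. Re w < fst p + \<epsilon>} \<inter> {w. Im w > u} \<inter> {w. Im w < v})" for u v
    by (intro convex_Int convex_halfspace_Re_gt convex_halfspace_Re_lt convex_halfspace_Im_gt convex_halfspace_Im_lt)
  moreover have "strip p b = {w. Re w > fst p - \<epsilon>} \<inter> {w. Re w < fst p + \<epsilon>} \<inter>
      {w. Im w > (if at_side p b = Top then 0 else -3/4)} \<inter> {w. Im w < (if at_side p b = Top then 7/4 else 1)}"
    by (auto simp: strip_def split: if_splits)
  ultimately show ?thesis by (metis convex_connected)
qed

lemma core_meets_strip:
  assumes "p \<in> S"
  shows "core (at_eye p b) \<inter> strip p b \<noteq> {}"
proof -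
  have "Complex (fst p) (1/2) \<in> core (at_eye p b)"
    using thickness_at_switch[OF assms, of "fst p" b] switch_inside_eye[OF assms, of b] eps_pos by (simp add: core_def)
  moreover have "Complex (fst p) (1/2) \<in> strip p b" using eps_pos by (simp add: strip_def)
  ultimately show ?thesis by blast
qed

lemma flat_domain_open: "e \<in> E \<Longrightarrow> open (flat_domain e)"
  unfolding flat_domain_def using core_open strip_open by (intro open_Union) auto

lemma flat_domain_connected:
  assumes e: "e \<in> E"
  shows "connected (flat_domain e)"
  unfolding flat_domain_def
proof (rule connected_Union)
  let ?F = "{core e} \<union> (\<lambda>(p, b). core e \<union> strip p b) ` {(p, b). p \<in> S \<and> at_eye p b = e}"
  have "Complex ((eye_left e + eye_right e) / 2) (thickness e ((eye_left e + eye_right e) / 2) / 2) \<in> core e"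
    using eye_nonempty[OF e] thickness_pos[OF e, of "(eye_left e + eye_right e) / 2"] by (simp add: core_def)
  then show "\<Inter>?F \<noteq> {}" by auto
  fix s assume "s \<in> ?F"
  then consider "s = core e" | p b where "p \<in> S" "at_eye p b = e" "s = core e \<union> strip p b" by auto
  then show "connected s"
  proof cases
    case 1
    then show ?thesis using core_connected[OF e] by simp
  next
    case (2 p b)
    then show ?thesis using core_connected[OF e] strip_connected core_meets_strip[OF 2(1), of b]
      by (simp add: connected_Un)
  qed
qed

lemma strip_subset:
  assumes "p \<in> S"
  shows "strip p b \<subseteq> flat_domain (at_eye p b)"
proof -
  let ?F = "(\<lambda>(p', b'). core (at_eye p b) \<union> strip p' b') ` {(p', b'). p' \<in> S \<and> at_eye p' b' = at_eye p b}"
  have "core (at_eye p b) \<union> strip p b \<in> ?F"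
    by (rule image_eqI[where x="(p, b)"]) (use assms in auto)
  then have "core (at_eye p b) \<union> strip p b \<subseteq> \<Union>({core (at_eye p b)} \<union> ?F)"
    by (intro Union_upper UnI2)
  then show ?thesis unfolding flat_domain_def by (rule subset_trans[OF Un_upper2])
qed

text \<open>
  A compact part of the star whose image covers the flat domain.
\<close>

definition thin_star :: "eye \<Rightarrow> (piece \<times> real \<times> real) set" where
  "thin_star e = Pair (Disk e) ` piece_region (Disk e) \<union>
     (\<Union>(p, b)\<in>{(p, b). p \<in> S \<and> at_eye p b = e}. Pair (Band p) ` ({t\<in>{0..1}. depth b t \<le> 3/4} \<times> {-1..1}))"

lemma thin_star_subset: "e \<in> E \<Longrightarrow> thin_star e \<subseteq> star_dom e"
  unfolding thin_star_def by (force simp: star_dom_Disk star_dom_Band)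

lemma compact_disk:
  assumes e: "e \<in> E"
  shows "compact (piece_region (Disk e))"
proof -
  let ?I = "{eye_left e..eye_right e}"
  let ?f = "\<lambda>y. (fst y, eye_bot e (fst y) + snd y * (eye_top e (fst y) - eye_bot e (fst y)))"
  have arc: "continuous_on (?I \<times> {0..1::real}) (\<lambda>y. arc e \<sigma> (fst y))" for \<sigma>
    by (rule continuous_on_compose2[OF arc_continuous[OF e]]) (auto intro!: continuous_intros)
  have "continuous_on (?I \<times> {0..1}) ?f" using arc[of Top] arc[of Bot] by (intro continuous_intros) auto
  then have "compact (?f ` (?I \<times> {0..1}))" by (intro compact_continuous_image compact_Times compact_Icc)
  moreover have "?f ` (?I \<times> {0..1}) = piece_region (Disk e)"
  proof
    show "?f ` (?I \<times> {0..1}) \<subseteq> piece_region (Disk e)"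
    proof
      fix v assume "v \<in> ?f ` (?I \<times> {0..1})"
      then obtain y where "v = ?f y" "y \<in> ?I \<times> {0..1}" by blast
      then obtain x u where xu: "v = ?f (x, u)" "x \<in> ?I" "u \<in> {0..1}" by (cases y) auto
      have h: "eye_top e x - eye_bot e x \<ge> 0" using eye_thick[OF e, of x] xu(2) by simp
      have "u * (eye_top e x - eye_bot e x) \<ge> 0" "u * (eye_top e x - eye_bot e x) \<le> eye_top e x - eye_bot e x"
        using h xu(3) by (auto intro: mult_left_le_one_le)
      then show "v \<in> piece_region (Disk e)" using xu by simp
    qed
    show "piece_region (Disk e) \<subseteq> ?f ` (?I \<times> {0..1})"
    proof
      fix v assume v: "v \<in> piece_region (Disk e)"
      obtain x z where xz: "v = (x, z)" by (cases v)
      define h where "h = eye_top e x - eye_bot e x"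
      have b: "x \<in> ?I" "0 \<le> z - eye_bot e x" "z - eye_bot e x \<le> h" using v xz by (auto simp: h_def)
      have "v = ?f (x, (z - eye_bot e x) / h)" using b xz by (auto simp: h_def[symmetric])
      moreover have "(z - eye_bot e x) / h \<in> {0..1}" using b by (auto simp: divide_le_eq_1)
      ultimately show "v \<in> ?f ` (?I \<times> {0..1})" using b(1) by blast
    qed
  qed
  ultimately show ?thesis by simp
qed

lemma compactin_piece:
  assumes "i \<in> Disk ` E \<union> Band ` S" "compact A" "A \<subseteq> piece_region i"
  shows "compactin (pieces S E) (Pair i ` A)"
proof (rule image_compactin)
  show "compactin (top_of_set (piece_region i)) A" using assms by (simp add: compactin_subtopology)
  show "continuous_map (top_of_set (piece_region i)) (pieces S E) (Pair i)"
    unfolding pieces_def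
    using continuous_map_component_injection[OF assms(1), of "\<lambda>i. top_of_set (piece_region i)"] by simp
qed

lemma thin_star_compact:
  assumes e: "e \<in> E"
  shows "compactin Surf (cls ` thin_star e)"
proof (rule image_compactin)
  have "compactin (pieces S E) (Pair (Band p) ` ({t\<in>{0..1}. depth b t \<le> 3/4} \<times> {-1..1}))" if "p \<in> S" for p b
  proof (rule compactin_piece)
    have "{t\<in>{0..1}. depth b t \<le> 3/4} = (if b then {0..3/4} else {1/4..1})" by (auto simp: depth_def)
    then show "compact ({t\<in>{0..1}. depth b t \<le> 3/4} \<times> {-1..1::real})" by (simp add: compact_Times)
  qed (use that in auto)
  moreover have "finite {(p, b). p \<in> S \<and> at_eye p b = e}"
    by (rule finite_subset[of _ "S \<times> UNIV"]) (use finite_S in auto)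
  moreover have "compactin (pieces S E) (Pair (Disk e) ` piece_region (Disk e))"
    using e compact_disk by (intro compactin_piece) auto
  ultimately show "compactin (pieces S E) (thin_star e)"
    unfolding thin_star_def by (intro compactin_Un compactin_Union) auto
  show "continuous_map (pieces S E) Surf cls" unfolding Surf_eq by (rule continuous_map_quotient_topology)
qed

lemma disk_point_flat:
  assumes e: "e \<in> E" and x: "eye_left e \<le> x" "x \<le> eye_right e" and y: "0 \<le> y" "y \<le> thickness e x"
  shows "Complex x y \<in> flat e ` thin_star e"
proof -
  let ?h = "eye_top e x - eye_bot e x"
  let ?z = "eye_bot e x + y * max ?h \<eta>"
  have "flat e (Disk e, x, ?z) = Complex x y"
    unfolding flat_Disk using max_eta_pos[of ?h] by (simp add: complex_eq_iff)
  moreover have "y * max ?h \<eta> \<le> ?h" using y(2) max_eta_pos[of ?h] unfolding thickness_def by (simp add: pos_le_divide_eq)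
  then have "(Disk e, x, ?z) \<in> thin_star e"
    unfolding thin_star_def using x y(1) max_eta_pos[of ?h] by auto
  ultimately show ?thesis by (metis image_eqI)
qed

definition band_point :: "real \<times> real \<Rightarrow> bool \<Rightarrow> real \<Rightarrow> real \<Rightarrow> piece \<times> real \<times> real" where
  "band_point p b x d = (Band p, (if b then d else 1 - d), (if b then 1 else -1) * (x - fst p) / \<epsilon>)"

lemma flat_band_point:
  assumes "p \<in> S"
  shows "flat (at_eye p b) (band_point p b x d) = Complex x (if at_side p b = Top then 1 + d else - d)"
  unfolding band_point_def flat_Band[OF assms] using eps_pos by (simp add: xpos_def depth_def)

lemma band_point_thin:
  assumes p: "p \<in> S" and x: "fst p - \<epsilon> < x" "x < fst p + \<epsilon>" and d: "0 \<le> d" "d \<le> 3/4"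
  shows "band_point p b x d \<in> thin_star (at_eye p b)"
proof -
  have "(if b then 1 else -1) * (x - fst p) / \<epsilon> \<in> {-1..1}"
    using x eps_pos by (auto simp: divide_le_eq_1 field_simps)
  moreover have "(if b then d else 1 - d) \<in> {t\<in>{0..1}. depth b t \<le> 3/4}" using d by (auto simp: depth_def)
  ultimately have "band_point p b x d \<in> Pair (Band p) ` ({t\<in>{0..1}. depth b t \<le> 3/4} \<times> {-1..1})"
    unfolding band_point_def by blast
  then show ?thesis unfolding thin_star_def using p by blast
qed

lemma flat_domain_covered:
  assumes e: "e \<in> E"
  shows "flat_domain e \<subseteq> flat e ` thin_star e"
proof
  fix w assume "w \<in> flat_domain e"
  then consider "w \<in> core e" | p b where "p \<in> S" "at_eye p b = e" "w \<in> strip p b"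
    unfolding flat_domain_def by auto
  then show "w \<in> flat e ` thin_star e"
  proof cases
    case 1
    then show ?thesis using disk_point_flat[OF e, of "Re w" "Im w"] by (simp add: core_def)
  next
    case (2 p b)
    have x: "fst p - \<epsilon> < Re w" "Re w < fst p + \<epsilon>" using 2(3) by (auto simp: strip_def)
    have band: "w \<in> flat e ` thin_star e"
      if "0 \<le> d" "d \<le> 3/4" "Im w = (if at_side p b = Top then 1 + d else - d)" for d
    proof -
      have "flat e (band_point p b (Re w) d) = w"
        using flat_band_point[OF 2(1), of b "Re w" d] 2(2) that(3) by (simp add: complex_eq_iff)
      then show ?thesis using band_point_thin[OF 2(1) x that(1,2), of b] 2(2) by (metis image_eqI)
    qed
    show ?thesis
    proof (cases "0 \<le> Im w \<and> Im w \<le> 1")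
      case True
      moreover have "thickness e (Re w) = 1" using thickness_at_switch[OF 2(1), of "Re w" b] x 2(2) by simp
      moreover have "eye_left e \<le> Re w" "Re w \<le> eye_right e"
        using switch_inside_eye[OF 2(1), of b] x 2(2) by auto
      ultimately show ?thesis using disk_point_flat[OF e, of "Re w" "Im w"] by simp
    next
      case False
      show ?thesis
      proof (cases "at_side p b")
        case Top
        then show ?thesis using band[of "Im w - 1"] False 2(3) by (auto simp: strip_def)
      next
        case Bot
        then show ?thesis using band[of "- Im w"] False 2(3) by (auto simp: strip_def)
      qed
    qed
  qed
qed

definition flat_star :: "eye \<Rightarrow> (piece \<times> real \<times> real) set set" where
  "flat_star e = {x \<in> star e. chart e x \<in> flat_domain e}"

lemma flat_star_chart:
  assumes e: "e \<in> E"
  shows "planar_chart Surf (flat_star e) (chart e)" "chart e ` flat_star e = flat_domain e"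
proof -
  have sub: "cls ` thin_star e \<subseteq> star e" using thin_star_subset[OF e] by (auto simp: star_def)
  have "chart e ` cls ` thin_star e = flat e ` thin_star e"
    unfolding image_image using thin_star_subset[OF e] chart_cls by (intro image_cong) auto
  then have "flat_domain e \<subseteq> chart e ` cls ` thin_star e" using flat_domain_covered[OF e] by simp
  then show "planar_chart Surf (flat_star e) (chart e)" "chart e ` flat_star e = flat_domain e"
    unfolding flat_star_def
    using planar_chart_of_compact[OF star_open[OF e] chart_continuous[OF e] chart_injective thin_star_compact[OF e] sub flat_domain_open[OF e]]
    by blast+
qed

text \<open>
  Let \<open>n e\<close> be the sign of the flattened star of \<open>e\<close> in an oriented atlas. The centre of a band
  lies in both stars; there the degree of a chart in the coordinates of the band equals \<open>n e\<close> up to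
  the degree of the rigid motion \<open>M\<close>, which depends on the side of attachment. Computing it from
  both ends yields coherence of \<open>\<lambda>e. n e = 1\<close>.
\<close>

lemma coherent_if_orientable:
  assumes "orientable_surface Surf"
  shows "\<exists>\<kappa>. coherent_orientation S E \<kappa>"
proof -
  obtain A where A: "\<forall>(U, \<phi>)\<in>A. planar_chart Surf U \<phi>" "manifold_interior Surf = (\<Union>(U, \<phi>)\<in>A. U)"
    "\<forall>(U, \<phi>)\<in>A. \<forall>(V, \<psi>)\<in>A. orientation_preserving_on (\<phi> ` (U \<inter> V)) (\<psi> \<circ> inv_into U \<phi>)"
    using assms unfolding orientable_surface_def by blast
  define J where "J e = inv_into (flat_star e) (chart e)" for e
  have "\<exists>n\<in>{1,-1}. \<forall>w\<in>flat_domain e. \<forall>(U, \<phi>)\<in>A. J e w \<in> U \<longrightarrow> local_degree (\<phi> \<circ> J e) w n" if e: "e \<in> E" for e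
  proof (rule orientation_sign_of_patch[OF A flat_domain_open[OF e] flat_domain_connected[OF e]])
    note pc = flat_star_chart[OF e]
    show "continuous_map (top_of_set (flat_domain e)) Surf (J e)"
      using planar_chart_inv_into_continuous[OF pc(1)] unfolding pc(2) J_def .
    show "inj_on (J e) (flat_domain e)" unfolding J_def pc(2)[symmetric] by (rule inj_on_inv_into) simp
    show "J e ` flat_domain e \<subseteq> manifold_interior Surf"
    proof
      fix x assume "x \<in> J e ` flat_domain e"
      then obtain w where "w \<in> chart e ` flat_star e" "x = inv_into (flat_star e) (chart e) w"
        unfolding J_def pc(2)[symmetric] by blast
      then have "x \<in> flat_star e" by (simp add: inv_into_into)
      then show "x \<in> manifold_interior Surf" unfolding manifold_interior_def using pc(1) by blast
    qed
  qed
  then have "\<forall>e\<in>E. \<exists>n. n \<in> {1,-1} \<and> (\<forall>w\<in>flat_domain e. \<forall>(U, \<phi>)\<in>A. J e w \<in> U \<longrightarrow> local_degree (\<phi> \<circ> J e) w n)"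
    by blast
  then obtain n where "\<forall>e\<in>E. n e \<in> {1,-1} \<and> (\<forall>w\<in>flat_domain e. \<forall>(U, \<phi>)\<in>A. J e w \<in> U \<longrightarrow> local_degree (\<phi> \<circ> J e) w (n e))"
    by (rule bchoice[THEN exE])
  then have n: "\<And>e. e \<in> E \<Longrightarrow> n e \<in> {1,-1}"
    "\<And>e w U \<phi>. e \<in> E \<Longrightarrow> w \<in> flat_domain e \<Longrightarrow> (U, \<phi>) \<in> A \<Longrightarrow> J e w \<in> U \<Longrightarrow> local_degree (\<phi> \<circ> J e) w (n e)"
    by blast+
  define mid where "mid p t s = cls (Band p, t, s)" for p t s
  have sgn: "local_degree (\<phi> \<circ> (\<lambda>\<beta>. mid p (Im \<beta>) (Re \<beta> / \<epsilon>))) (\<i> / 2) ((if at_side p b = Top then 1 else -1) * n (at_eye p b))"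
    if p: "p \<in> S" and U: "(U, \<phi>) \<in> A" "mid p (1/2) 0 \<in> U" for p b U \<phi>
  proof -
    let ?e = "at_eye p b"
    have e: "?e \<in> E" using at_eye_E[OF p] .
    obtain a c where ac: "a \<in> {1,-1}" "\<And>t s. flat ?e (Band p, t, s) =
        a * (if at_side p b = Top then Complex (\<epsilon> * s) t else cnj (Complex (\<epsilon> * s) t)) + c"
      using flat_Band_rigid[OF p, of b] by blast
    define M where "M \<beta> = a * (if at_side p b = Top then \<beta> else cnj \<beta>) + c" for \<beta>
    have M: "flat ?e (Band p, Im \<beta>, Re \<beta> / \<epsilon>) = M \<beta>" for \<beta>
      unfolding M_def ac(2) using eps_pos by (simp add: complex_eq_iff)
    \<comment> \<open>The part of the band that lies in the flat domains of both of its ends.\<close>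
    define B where "B = {\<beta>. - \<epsilon> < Re \<beta> \<and> Re \<beta> < \<epsilon> \<and> 1/4 < Im \<beta> \<and> Im \<beta> < 3/4}"
    have oB: "open B" unfolding B_def by (intro open_Collect_conj open_Collect_less continuous_intros)
    have bB: "\<i> / 2 \<in> B" using eps_pos by (simp add: B_def)
    have JM: "M \<beta> \<in> flat_domain ?e" "J ?e (M \<beta>) = mid p (Im \<beta>) (Re \<beta> / \<epsilon>)" if \<beta>: "\<beta> \<in> B" for \<beta>
    proof -
      have "\<bar>Re \<beta>\<bar> \<le> \<epsilon>" using \<beta> by (auto simp: B_def)
      then have s: "Re \<beta> / \<epsilon> \<in> {-1..1}" using eps_pos by (auto simp: field_simps abs_le_iff)
      have dom: "(Band p, Im \<beta>, Re \<beta> / \<epsilon>) \<in> star_dom ?e"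
        unfolding star_dom_Band using p \<beta> s by (auto simp: B_def depth_def intro!: exI[of _ b])
      have "M \<beta> \<in> strip p b"
        unfolding M[symmetric] flat_Band[OF p] using \<beta> eps_pos by (auto simp: strip_def xpos_def depth_def B_def)
      then show fd: "M \<beta> \<in> flat_domain ?e" using strip_subset[OF p] by blast
      have "mid p (Im \<beta>) (Re \<beta> / \<epsilon>) \<in> flat_star ?e"
        unfolding flat_star_def star_def mid_def using dom chart_cls[OF dom] M fd by auto
      moreover have "chart ?e (mid p (Im \<beta>) (Re \<beta> / \<epsilon>)) = M \<beta>" unfolding mid_def using chart_cls[OF dom] M by simp
      ultimately show "J ?e (M \<beta>) = mid p (Im \<beta>) (Re \<beta> / \<epsilon>)"
        unfolding J_def using planar_chart_inj[OF flat_star_chart(1)[OF e]] inv_into_f_f by metis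
    qed
    have J0: "J ?e (M (\<i> / 2)) \<in> U" using JM(2)[OF bB] U(2) by simp
    have deg: "local_degree (\<phi> \<circ> J ?e) (M (\<i> / 2)) (n ?e)"
      using n(2)[OF e JM(1)[OF bB] U(1) J0] .
    have pU: "planar_chart Surf U \<phi>" using A(1) U(1) by auto
    note T = transition_map_facts[OF flat_star_chart(1)[OF e] pU]
    have "J ?e (M (\<i> / 2)) \<in> flat_star ?e"
      unfolding J_def using JM(1)[OF bB] flat_star_chart(2)[OF e] by (metis inv_into_into)
    moreover have "chart ?e (J ?e (M (\<i> / 2))) = M (\<i> / 2)"
      unfolding J_def using JM(1)[OF bB] flat_star_chart(2)[OF e] by (metis f_inv_into_f)
    ultimately have "M (\<i> / 2) \<in> chart ?e ` (flat_star ?e \<inter> U)" using J0 by (metis IntI image_eqI)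
    then obtain R where R: "R > 0" "ball (M (\<i> / 2)) R \<subseteq> chart ?e ` (flat_star ?e \<inter> U)"
      using T(1) open_contains_ball by blast
    have degM: "local_degree M (\<i> / 2) (if at_side p b = Top then 1 else -1)"
    proof (cases "at_side p b = Top")
      case True
      then show ?thesis using local_degree_rotation[of a c "\<i> / 2"] ac(1) by (auto simp: M_def[abs_def])
    next
      case False
      then show ?thesis using local_degree_reflection[of a c "\<i> / 2"] ac(1) by (auto simp: M_def[abs_def])
    qed
    have "local_degree ((\<phi> \<circ> J ?e) \<circ> M) (\<i> / 2) ((if at_side p b = Top then 1 else -1) * n ?e)"
    proof (rule local_degree_compose[of _ 1 _ R])
      show "continuous_on (ball (\<i> / 2) 1) M"
        unfolding M_def by (cases "at_side p b = Top") (auto intro!: continuous_intros)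
      show "inj_on M (ball (\<i> / 2) 1)" using ac(1) by (auto simp: inj_on_def M_def split: if_splits)
      show "continuous_on (ball (M (\<i> / 2)) R) (\<phi> \<circ> J ?e)"
        using continuous_on_subset[OF T(2) R(2)] by (simp add: J_def)
      show "inj_on (\<phi> \<circ> J ?e) (ball (M (\<i> / 2)) R)"
        using inj_on_subset[OF T(3) R(2)] by (simp add: J_def)
    qed (use R deg degM in auto)
    moreover have "\<forall>\<^sub>F \<beta> in nhds (\<i> / 2). ((\<phi> \<circ> J ?e) \<circ> M) \<beta> = (\<phi> \<circ> (\<lambda>\<beta>. mid p (Im \<beta>) (Re \<beta> / \<epsilon>))) \<beta>"
      using eventually_nhds_in_open[OF oB bB] by eventually_elim (simp add: JM(2))
    ultimately show ?thesis using local_degree_cong by blast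
  qed
  have ends: "((at_side p b = Top) = (n (at_eye p b) = 1)) = ((at_side p b' = Top) = (n (at_eye p b') = 1))"
    if p: "p \<in> S" for p b b'
  proof -
    have "(Band p, 1/2, 0) \<in> star_dom (at_eye p True)"
      unfolding star_dom_Band using p by (auto simp: depth_def intro!: exI[of _ True])
    moreover have "flat (at_eye p True) (Band p, 1/2, 0) \<in> strip p True"
      unfolding flat_Band[OF p] using eps_pos by (auto simp: strip_def xpos_def depth_def)
    ultimately have "mid p (1/2) 0 \<in> flat_star (at_eye p True)"
      unfolding flat_star_def star_def mid_def using chart_cls strip_subset[OF p, of True] by auto
    then have "mid p (1/2) 0 \<in> manifold_interior Surf"
      unfolding manifold_interior_def using flat_star_chart(1)[OF at_eye_E[OF p]] by blast
    then obtain U \<phi> where U: "(U, \<phi>) \<in> A" "mid p (1/2) 0 \<in> U" unfolding A(2) by blast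
    have "(if at_side p b = Top then 1 else -1) * n (at_eye p b) = (if at_side p b' = Top then 1 else -1) * n (at_eye p b')"
      using local_degree_unique[OF sgn[OF p U, of b] sgn[OF p U, of b']] .
    then show ?thesis using n(1)[OF at_eye_E[OF p], of b] n(1)[OF at_eye_E[OF p], of b'] by (auto split: if_splits)
  qed
  show ?thesis
    unfolding coherent_orientation_def
  proof (intro exI[of _ "\<lambda>e. n e = 1"] ballI allI impI, elim conjE)
    fix p e \<sigma> e' \<sigma>'
    assume p: "p \<in> S" "arc_through E p e \<sigma>" "arc_through E p e' \<sigma>'"
    obtain b b' where "e = at_eye p b" "\<sigma> = at_side p b" "e' = at_eye p b'" "\<sigma>' = at_side p b'"
      using arcs[OF p(1,2)] arcs[OF p(1,3)] by blast
    then show "((\<sigma> = Top) = (n e = 1)) = ((\<sigma>' = Top) = (n e' = 1))" using ends[OF p(1)] by simp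
  qed
qed

end

section \<open>The front of a Legendrian knot\<close>

text \<open>
  Nearness on the circle of parameters: \<open>t\<close> is within \<open>\<delta>\<close> of \<open>c\<close> up to an integer.
\<close>

definition near_mod :: "real \<Rightarrow> real \<Rightarrow> real \<Rightarrow> bool" where
  "near_mod c \<delta> t \<longleftrightarrow> (\<exists>n::int. \<bar>t + of_int n - c\<bar> < \<delta>)"

lemma near_mod_periodic: "near_mod c \<delta> (t + of_int n) \<longleftrightarrow> near_mod c \<delta> t"
proof
  assume "near_mod c \<delta> t"
  then obtain m :: int where "\<bar>t + of_int m - c\<bar> < \<delta>" by (auto simp: near_mod_def)
  then show "near_mod c \<delta> (t + of_int n)"
    unfolding near_mod_def by (intro exI[of _ "m - n"]) (simp add: algebra_simps)
next
  assume "near_mod c \<delta> (t + of_int n)"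
  then obtain m :: int where "\<bar>t + of_int n + of_int m - c\<bar> < \<delta>" by (auto simp: near_mod_def)
  then show "near_mod c \<delta> t" unfolding near_mod_def by (intro exI[of _ "n + m"]) (simp add: algebra_simps)
qed

lemma eventually_near_mod:
  assumes "\<delta> > 0" "t - c \<in> \<int>"
  shows "\<forall>\<^sub>F s in nhds t. near_mod c \<delta> s"
proof -
  obtain n :: int where n: "t - c = of_int n" using assms(2) by (auto elim: Ints_cases)
  have "\<forall>\<^sub>F s in nhds t. s \<in> ball t \<delta>" using assms(1) by (intro eventually_nhds_in_open) auto
  then show ?thesis
  proof eventually_elim
    case (elim s)
    then show ?case using n unfolding near_mod_def
      by (intro exI[of _ "-n"]) (simp add: dist_real_def abs_minus_commute algebra_simps)
  qed
qed

lemma near_mod_disjoint: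
  assumes "s - t \<notin> \<int>"
  obtains \<delta> where "\<delta> > 0" "\<And>u. \<not> (near_mod s \<delta> u \<and> near_mod t \<delta> u)"
proof -
  have "open (- (\<int> :: real set))" by (simp add: closed_Ints open_Compl)
  then obtain r where r: "r > 0" "ball (s - t) r \<subseteq> - \<int>" using assms open_contains_ball by blast
  have "\<not> (near_mod s (r/2) u \<and> near_mod t (r/2) u)" for u
  proof
    assume "near_mod s (r/2) u \<and> near_mod t (r/2) u"
    then obtain m n :: int where mn: "\<bar>u + of_int m - s\<bar> < r/2" "\<bar>u + of_int n - t\<bar> < r/2"
      by (auto simp: near_mod_def)
    have "(s - t) - of_int (m - n) = - (u + of_int m - s) + (u + of_int n - t)" by simp
    then have "\<bar>(s - t) - of_int (m - n)\<bar> < r" using mn by linarith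
    then have "of_int (m - n) \<in> ball (s - t) r" by (simp add: dist_real_def)
    then show False using r(2) Ints_of_int by blast
  qed
  then show ?thesis using that[of "r/2"] r(1) by auto
qed

text \<open>
  Isolated exceptional points (crossings and cusps, where \<open>P\<close> may fail) do not disconnect an
  interval as long as the two sides of each of them agree.
\<close>

lemma punctured_locally_constant:
  fixes P :: "bool \<Rightarrow> real \<Rightarrow> bool"
  assumes I: "open I" "connected I"
    and excl: "\<And>x. x \<in> I \<Longrightarrow> \<not> (P True x \<and> P False x)"
    and loc: "\<And>x. x \<in> I \<Longrightarrow> \<exists>d. \<forall>\<^sub>F y in at x. P d y"
  shows "\<exists>d. \<forall>x\<in>I. \<forall>\<^sub>F y in at x. P d y"
proof -
  define T where "T d = {x. \<forall>\<^sub>F y in at x. P d y}" for d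
  have oT: "open (T d)" for d
  proof (rule openI)
    fix x assume "x \<in> T d"
    then obtain r where r: "r > 0" "\<And>y. y \<noteq> x \<Longrightarrow> dist y x < r \<Longrightarrow> P d y"
      by (auto simp: T_def eventually_at)
    have "y \<in> T d" if y: "y \<in> ball x r" for y
    proof (cases "y = x")
      case False
      have "open (ball x r - {x})" by auto
      then have "\<forall>\<^sub>F z in nhds y. z \<in> ball x r - {x}"
        using False y by (intro eventually_nhds_in_open) auto
      then have "\<forall>\<^sub>F z in nhds y. P d z"
        by eventually_elim (use r in \<open>auto simp: dist_commute\<close>)
      then show ?thesis by (simp add: T_def eventually_nhds_conv_at)
    qed (use \<open>x \<in> T d\<close> in simp)
    then show "\<exists>r>0. ball x r \<subseteq> T d" using r by blast
  qed
  have "T True \<inter> T False \<inter> I = {}"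
  proof -
    have False if "x \<in> I" "x \<in> T True" "x \<in> T False" for x
    proof -
      have "\<forall>\<^sub>F y in at x. y \<in> I"
        using eventually_nhds_in_open[OF I(1) that(1)] by (simp add: eventually_nhds_conv_at)
      moreover have "\<forall>\<^sub>F y in at x. P True y" "\<forall>\<^sub>F y in at x. P False y"
        using that by (auto simp: T_def)
      ultimately have "\<forall>\<^sub>F y in at x. False" by eventually_elim (use excl in blast)
      then show False by simp
    qed
    then show ?thesis by blast
  qed
  moreover have cov: "I \<subseteq> T True \<union> T False"
  proof
    fix x assume "x \<in> I"
    then obtain d where "x \<in> T d" using loc by (auto simp: T_def)
    then show "x \<in> T True \<union> T False" by (cases d) auto
  qed
  ultimately have "T True \<inter> I = {} \<or> T False \<inter> I = {}" by (rule connectedD[OF I(2) oT oT])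
  then have "I \<subseteq> T True \<or> I \<subseteq> T False" using cov by blast
  then show ?thesis unfolding T_def by blast
qed

locale legendrian_front =
  fixes \<gamma> :: "real \<Rightarrow> real^3"
  assumes legendrian: "legendrian_knot \<gamma>" and generic: "generic_front \<gamma>"
begin

abbreviation "X \<equiv> xco \<gamma>"
abbreviation "Y \<equiv> yco \<gamma>"
abbreviation "Z \<equiv> zco \<gamma>"
abbreviation "D \<equiv> deriv (xco \<gamma>)"

lemma front_eq: "front \<gamma> s = front \<gamma> t \<longleftrightarrow> X s = X t \<and> Z s = Z t"
  by (simp add: front_def)

lemma X_deriv: "(X has_real_derivative D t) (at t)"
proof -
  have "smooth X" using legendrian by (simp add: legendrian_knot_def)
  then have "((deriv ^^ 0) X) differentiable (at t)" unfolding smooth_def by blast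
  then show ?thesis by (simp add: DERIV_deriv_iff_real_differentiable)
qed

lemma D_deriv: "(D has_real_derivative deriv D t) (at t)"
proof -
  have "smooth X" using legendrian by (simp add: legendrian_knot_def)
  then have "((deriv ^^ 1) X) differentiable (at t)" unfolding smooth_def by blast
  then show ?thesis by (simp add: DERIV_deriv_iff_real_differentiable)
qed

lemma Z_deriv: "(Z has_real_derivative Y t * D t) (at t)"
proof -
  have "smooth Z" using legendrian by (simp add: legendrian_knot_def)
  then have "((deriv ^^ 0) Z) differentiable (at t)" unfolding smooth_def by blast
  then have "(Z has_real_derivative deriv Z t) (at t)" by (simp add: DERIV_deriv_iff_real_differentiable)
  then show ?thesis using legendrian by (simp add: legendrian_knot_def)
qed

lemma X_cont: "isCont X t" and D_cont: "isCont D t" and Z_cont: "isCont Z t"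
  using X_deriv D_deriv Z_deriv DERIV_isCont by blast+

lemma front_cont: "isCont (front \<gamma>) t"
proof -
  have "isCont (\<lambda>t. (X t, Z t)) t" by (intro continuous_intros X_cont Z_cont)
  then show ?thesis by (simp add: front_def[abs_def])
qed

lemma periodic: "\<gamma> (t + of_int n) = \<gamma> t"
proof -
  have shift: "\<gamma> (u + 1) = \<gamma> u" for u using legendrian by (simp add: legendrian_knot_def)
  show ?thesis
  proof (induction n rule: int_induct[where k=0])
    case (step1 i)
    have "t + of_int (i + 1) = (t + of_int i) + 1" by simp
    then show ?case using step1 shift by metis
  next
    case (step2 i)
    have "t + of_int i = (t + of_int (i - 1)) + 1" by simp
    then show ?case using step2 shift by metis
  qed simp
qed

lemma front_periodic: "front \<gamma> (t + of_int n) = front \<gamma> t"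
  by (simp add: front_def periodic)

lemma D_periodic: "D (t + of_int n) = D t"
proof -
  have "((\<lambda>t. X (t + of_int n)) has_real_derivative D (t + of_int n)) (at t)"
    using X_deriv[of "t + of_int n"] DERIV_shift[of X _ t "of_int n"] by blast
  then have "(X has_real_derivative D (t + of_int n)) (at t)" by (simp add: periodic)
  then show ?thesis using DERIV_unique X_deriv by blast
qed

lemma same_parameter: "s - t \<in> \<int> \<Longrightarrow> \<exists>n. s = t + of_int n"
  by (metis Ints_cases add.commute diff_add_cancel)

lemma D_same: "s - t \<in> \<int> \<Longrightarrow> D s = D t"
  using same_parameter D_periodic by blast

lemma crossing_sym: "crossing_parameters \<gamma> s t \<Longrightarrow> crossing_parameters \<gamma> t s"
  unfolding crossing_parameters_def by (metis Ints_minus minus_diff_eq)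

lemma crossing_transverse:
  assumes "crossing_parameters \<gamma> s t"
  shows "D s \<noteq> 0" "D t \<noteq> 0" "Y s \<noteq> Y t"
proof -
  have *: "D s * deriv Z t \<noteq> D t * deriv Z s"
    using assms generic by (simp add: generic_front_def)
  have "deriv Z t = Y t * D t" "deriv Z s = Y s * D s"
    using legendrian by (auto simp: legendrian_knot_def)
  with * show "D s \<noteq> 0" "D t \<noteq> 0" "Y s \<noteq> Y t" by auto
qed

lemma crossing_fibre:
  assumes "crossing_parameters \<gamma> s t" "front \<gamma> u = front \<gamma> s"
  shows "u - s \<in> \<int> \<or> u - t \<in> \<int>"
proof -
  have "\<forall>s t u. front \<gamma> s = front \<gamma> t \<and> front \<gamma> t = front \<gamma> u \<longrightarrow> s - t \<in> \<int> \<or> t - u \<in> \<int> \<or> s - u \<in> \<int>"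
    using generic by (simp add: generic_front_def)
  from this[rule_format, of u s t] assms show ?thesis by (auto simp: crossing_parameters_def)
qed

lemma noncrossing_fibre:
  assumes "front \<gamma> s \<notin> crossings \<gamma>" "front \<gamma> u = front \<gamma> s"
  shows "u - s \<in> \<int>"
  using assms unfolding crossings_def crossing_parameters_def by (metis (mono_tags, lifting) mem_Collect_eq)

lemma crossings_iff: "front \<gamma> s \<in> crossings \<gamma> \<longleftrightarrow> (\<exists>t. crossing_parameters \<gamma> s t)"
  (is "?l \<longleftrightarrow> ?r")
proof
  assume ?l
  then obtain s' t' where st: "front \<gamma> s = front \<gamma> s'" "crossing_parameters \<gamma> s' t'" by (auto simp: crossings_def)
  from crossing_fibre[OF st(2) st(1)] show ?r
  proof
    assume "s - s' \<in> \<int>"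
    moreover have "s' - t' = (s - t') - (s - s')" by simp
    ultimately have "s - t' \<notin> \<int>" using st(2) Ints_diff unfolding crossing_parameters_def by metis
    then show ?r using st by (auto simp: crossing_parameters_def)
  next
    assume "s - t' \<in> \<int>"
    moreover have "s' - t' = (s - t') - (s - s')" by simp
    ultimately have "s - s' \<notin> \<int>" using st(2) Ints_diff unfolding crossing_parameters_def by metis
    then show ?r using st by (auto simp: crossing_parameters_def)
  qed
qed (auto simp: crossings_def)

lemma cusp_not_crossing: "D c = 0 \<Longrightarrow> front \<gamma> c \<notin> crossings \<gamma>"
  using crossing_transverse(1) crossings_iff by blast

lemma crossing_cases:
  assumes "front \<gamma> s = front \<gamma> t"
  shows "s - t \<in> \<int> \<or> crossing_parameters \<gamma> s t"
  using assms by (auto simp: crossing_parameters_def)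

text \<open>
  The second derivative of \<open>X\<close> does not vanish at a cusp, so the knot reverses its horizontal
  direction there.
\<close>

lemma cusp_sign_change:
  assumes "D c = 0"
  obtains \<delta> k where "\<delta> > 0" "k \<in> {1,-1}" "\<And>t. t \<noteq> c \<Longrightarrow> \<bar>t - c\<bar> < \<delta> \<Longrightarrow> sgn (D t) = k * sgn (t - c)"
proof -
  define L where "L = deriv D c"
  have L: "L \<noteq> 0" using assms generic by (simp add: generic_front_def cusp_parameter_def L_def)
  have "((\<lambda>t. (D t - D c) / (t - c)) \<longlongrightarrow> L) (at c)"
    using D_deriv[of c] by (simp add: has_field_derivative_iff L_def)
  then have "((\<lambda>t. D t / (t - c) * L) \<longlongrightarrow> L * L) (at c)" using assms by (intro tendsto_mult) auto
  moreover have "L * L > 0" using L by (metis not_real_square_gt_zero)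
  ultimately have "\<forall>\<^sub>F t in at c. D t / (t - c) * L > 0" by (rule order_tendstoD)
  then obtain \<delta> where d: "\<delta> > 0" "\<And>t. t \<noteq> c \<Longrightarrow> dist t c < \<delta> \<Longrightarrow> D t / (t - c) * L > 0"
    by (auto simp: eventually_at)
  have "sgn (D t) = sgn L * sgn (t - c)" if "t \<noteq> c" "\<bar>t - c\<bar> < \<delta>" for t
    using d(2)[of t] that by (auto simp: dist_real_def sgn_if zero_less_mult_iff mult_less_0_iff zero_less_divide_iff divide_less_0_iff split: if_splits)
  then show ?thesis using that[of \<delta> "sgn L"] d(1) L by (auto simp: sgn_if split: if_splits)
qed

lemma eventually_not_cusp: "\<forall>\<^sub>F t in at t0. D t \<noteq> 0"
proof (cases "D t0 = 0")
  case True
  obtain \<delta> k where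
    *: "\<delta> > 0" "k \<in> {1,-1}" "\<And>t. t \<noteq> t0 \<Longrightarrow> \<bar>t - t0\<bar> < \<delta> \<Longrightarrow> sgn (D t) = k * sgn (t - t0)" using cusp_sign_change[OF True] by blast
  have "D t \<noteq> 0" if "t \<noteq> t0" "\<bar>t - t0\<bar> < \<delta>" for t
    using *(3)[OF that] *(2) that(1) by (auto simp: sgn_if split: if_splits)
  then show ?thesis using *(1) by (auto simp: eventually_at dist_real_def)
next
  case False
  then show ?thesis by (intro tendsto_imp_eventually_ne[OF D_cont[unfolded isCont_def]]) simp
qed

lemma rolle:
  assumes "s < t" "X s = X t"
  shows "\<exists>u. s < u \<and> u < t \<and> D u = 0"
proof -
  have "continuous_on {s..t} X" using X_cont by (simp add: continuous_at_imp_continuous_on)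
  then show ?thesis using assms X_deriv Rolle[of s t X]
    by (metis DERIV_unique real_differentiable_def)
qed

lemma eventually_X_ne: "\<forall>\<^sub>F t in at t0. X t \<noteq> x"
proof (cases "x = X t0")
  case True
  obtain \<delta> where d: "\<delta> > 0" "\<And>t. t \<noteq> t0 \<Longrightarrow> \<bar>t - t0\<bar> < \<delta> \<Longrightarrow> D t \<noteq> 0"
    using eventually_not_cusp[of t0] by (auto simp: eventually_at dist_real_def)
  have "X t \<noteq> x" if t: "t \<noteq> t0" "\<bar>t - t0\<bar> < \<delta>" for t
  proof
    assume eq: "X t = x"
    have "\<exists>u. (t0 < u \<and> u < t \<or> t < u \<and> u < t0) \<and> D u = 0"
    proof (cases "t0 < t")
      case True2: True
      then show ?thesis using rolle[of t0 t] eq True by auto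
    next
      case False
      then show ?thesis using rolle[of t t0] eq True t by auto
    qed
    then obtain u where "t0 < u \<and> u < t \<or> t < u \<and> u < t0" "D u = 0" by blast
    then show False using d(2)[of u] t by auto
  qed
  then show ?thesis using d(1) by (auto simp: eventually_at dist_real_def)
next
  case False
  then show ?thesis by (intro tendsto_imp_eventually_ne[OF X_cont[unfolded isCont_def]]) simp
qed

lemma finite_crossings: "finite (crossings \<gamma>)"
  using generic by (simp add: generic_front_def)

lemma eventually_not_crossing: "\<forall>\<^sub>F t in at t0. front \<gamma> t \<notin> crossings \<gamma>"
proof -
  have "\<forall>\<^sub>F t in at t0. \<forall>x\<in>fst ` crossings \<gamma>. X t \<noteq> x"
    using finite_crossings eventually_X_ne by (intro eventually_ball_finite) auto
  then show ?thesis by eventually_elim (force simp: front_def)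
qed

lemma eventually_vertical_not_crossing: "\<forall>\<^sub>F x in at x0. \<forall>z. (x, z) \<notin> crossings \<gamma>"
proof -
  have "\<forall>\<^sub>F x in at x0. \<forall>y\<in>fst ` crossings \<gamma>. x \<noteq> y"
    using finite_crossings by (intro eventually_ball_finite) (auto simp: eventually_neq_at_within)
  then show ?thesis by eventually_elim force
qed

lemma X_locally_injective:
  assumes "D t0 \<noteq> 0"
  obtains \<delta> where "\<delta> > 0" "inj_on X {t0-\<delta><..<t0+\<delta>}"
proof -
  have "\<forall>\<^sub>F t in nhds t0. D t \<noteq> 0" using eventually_not_cusp[of t0] assms by (simp add: eventually_nhds_conv_at)
  then obtain \<delta> where d: "\<delta> > 0" "\<And>t. \<bar>t - t0\<bar> < \<delta> \<Longrightarrow> D t \<noteq> 0"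
    by (auto simp: eventually_nhds_metric dist_real_def)
  have "\<not> s < t" if st: "s \<in> {t0-\<delta><..<t0+\<delta>}" "t \<in> {t0-\<delta><..<t0+\<delta>}" "X s = X t" for s t
  proof
    assume "s < t"
    then obtain u where "s < u" "u < t" "D u = 0" using rolle[OF \<open>s < t\<close> st(3)] by blast
    moreover have "\<bar>u - t0\<bar> < \<delta>"
      using \<open>s < u\<close> \<open>u < t\<close> st(1,2) unfolding greaterThanLessThan_iff by linarith
    ultimately show False using d(2) by blast
  qed
  then have "inj_on X {t0-\<delta><..<t0+\<delta>}" by (intro inj_onI) (metis linorder_neqE_linordered_idom)
  then show ?thesis using d that by blast
qed

text \<open>
  The contact condition makes \<open>y\<close> the slope of the front. Since the slopes at a crossing differ,
  they tell the branches apart.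
\<close>

lemma slope_limit:
  assumes "D t0 \<noteq> 0"
  shows "((\<lambda>t. (Z t - Z t0) / (X t - X t0)) \<longlongrightarrow> Y t0) (at t0)"
proof -
  have 1: "((\<lambda>t. (Z t - Z t0) / (t - t0)) \<longlongrightarrow> Y t0 * D t0) (at t0)"
    using Z_deriv[of t0] by (simp add: has_field_derivative_iff)
  have 2: "((\<lambda>t. (X t - X t0) / (t - t0)) \<longlongrightarrow> D t0) (at t0)"
    using X_deriv[of t0] by (simp add: has_field_derivative_iff)
  have "((\<lambda>t. ((Z t - Z t0) / (t - t0)) / ((X t - X t0) / (t - t0))) \<longlongrightarrow> Y t0 * D t0 / D t0) (at t0)"
    by (intro tendsto_divide 1 2 assms)
  moreover have "\<forall>\<^sub>F t in at t0. ((Z t - Z t0) / (t - t0)) / ((X t - X t0) / (t - t0)) = (Z t - Z t0) / (X t - X t0)"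
    by (auto simp: eventually_at_filter)
  ultimately have "((\<lambda>t. (Z t - Z t0) / (X t - X t0)) \<longlongrightarrow> Y t0 * D t0 / D t0) (at t0)"
    by (rule Lim_transform_eventually)
  then show ?thesis using assms by simp
qed

text \<open>
  Compactness of the circle: points of the front close to \<open>P\<close> have parameters close to the fibre
  over \<open>P\<close>.
\<close>

lemma eventually_front:
  assumes near: "\<And>t. front \<gamma> t = P \<Longrightarrow> \<forall>\<^sub>F s in nhds t. Q s"
    and per: "\<And>t n. Q (t + of_int n) \<longleftrightarrow> Q t"
  shows "\<forall>\<^sub>F v in nhds P. \<forall>t. front \<gamma> t = v \<longrightarrow> Q t"
proof -
  define O' where "O' = \<Union>{W. open W \<and> (\<forall>s\<in>W. Q s)}"
  have O': "open O'" "\<And>s. s \<in> O' \<Longrightarrow> Q s" by (auto simp: O'_def)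
  have fib: "t \<in> O'" if "front \<gamma> t = P" for t
    using near[OF that] by (auto simp: O'_def eventually_nhds)
  have "compact ({0..1} - O')" using O'(1) by (simp add: compact_diff)
  then have "compact (front \<gamma> ` ({0..1} - O'))"
    by (intro compact_continuous_image continuous_at_imp_continuous_on) (auto intro: front_cont)
  then have "open (- front \<gamma> ` ({0..1} - O'))" by (simp add: compact_imp_closed open_Compl)
  moreover have "P \<in> - front \<gamma> ` ({0..1} - O')" using fib by auto
  ultimately have "\<forall>\<^sub>F v in nhds P. v \<in> - front \<gamma> ` ({0..1} - O')" by (rule eventually_nhds_in_open)
  then show ?thesis
  proof eventually_elim
    case (elim v)
    show ?case
    proof (intro allI impI)
      fix t assume t: "front \<gamma> t = v"
      have fr: "t = frac t + of_int \<lfloor>t\<rfloor>" by (simp add: frac_def)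
      have "front \<gamma> (frac t) = v" using t fr front_periodic by metis
      moreover have "frac t \<in> {0..1}" using frac_ge_0[of t] frac_lt_1[of t] by auto
      ultimately have "frac t \<in> O'" using elim by blast
      then show "Q t" using O'(2) per fr by metis
    qed
  qed
qed

text \<open>
  By Rolle's theorem two points on one vertical line near a cusp lie on different sides of it.
\<close>

lemma fold_pair_signs:
  assumes "\<And>t. t \<noteq> c \<Longrightarrow> \<bar>t - c\<bar> < \<delta> \<Longrightarrow> sgn (D t) = k * sgn (t - c)" "k \<in> {1,-1}"
    and "\<bar>s - c\<bar> < \<delta>" "\<bar>t - c\<bar> < \<delta>" "s < t" "X s = X t"
  shows "s < c" "c < t" "D s \<noteq> 0" "D t \<noteq> 0" "(D s > 0) \<noteq> (D t > 0)"
proof -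
  obtain u where u: "s < u" "u < t" "D u = 0" using rolle[OF assms(5,6)] by blast
  have "u = c"
  proof (rule ccontr)
    assume "u \<noteq> c"
    moreover have "\<bar>u - c\<bar> < \<delta>" using assms(3-5) u by linarith
    ultimately show False using assms(1)[of u] assms(2) u by (auto simp: sgn_if split: if_splits)
  qed
  then show sc: "s < c" "c < t" using u by auto
  have "sgn (D s) = - k" "sgn (D t) = k" using assms sc by (auto simp: sgn_if)
  then show "D s \<noteq> 0" "D t \<noteq> 0" "(D s > 0) \<noteq> (D t > 0)" using assms(2) by (auto simp: sgn_if split: if_splits)
qed

text \<open>
  Both branches at a cusp leave in the same horizontal direction, so by the intermediate value
  theorem they have points on a common vertical line. These points differ as there are no crossings
  near a cusp.
\<close>

lemma fold_pair_exists:
  assumes c: "D c = 0" and \<eta>: "\<eta> > 0"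
  obtains s t where "c - \<eta> < s" "s < c" "c < t" "t < c + \<eta>" "X s = X t"
    "D s \<noteq> 0" "D t \<noteq> 0" "(D s > 0) \<noteq> (D t > 0)" "Z s \<noteq> Z t"
proof -
  obtain \<delta>1 k where
    d1: "\<delta>1 > 0" "k \<in> {1,-1}" "\<And>t. t \<noteq> c \<Longrightarrow> \<bar>t - c\<bar> < \<delta>1 \<Longrightarrow> sgn (D t) = k * sgn (t - c)" using cusp_sign_change[OF c] by blast
  obtain \<delta>2 where d2: "\<delta>2 > 0" "\<And>t. t \<noteq> c \<Longrightarrow> \<bar>t - c\<bar> < \<delta>2 \<Longrightarrow> front \<gamma> t \<notin> crossings \<gamma>"
    using eventually_not_crossing[of c] by (auto simp: eventually_at dist_real_def)
  \<comment> \<open>The bound \<open>1/2\<close> keeps the two parameters from differing by an integer.\<close>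
  define h where "h = min (min \<delta>1 \<delta>2) (min \<eta> (1/2)) / 2"
  have h: "h > 0" "h < \<delta>1" "h < \<delta>2" "h < \<eta>" "2 * h < 1"
    using d1 d2 \<eta> by (auto simp: h_def min_def)
  define F where "F t = k * X t" for t
  have Fd: "(F has_real_derivative k * D t) (at t)" for t
    unfolding F_def by (intro DERIV_cmult X_deriv)
  have kk: "k * k = 1" using d1(2) by auto
  have Fc: "isCont F t" for t using Fd DERIV_isCont by blast
  have pos: "k * D t > 0" if "c < t" "t < c + \<delta>1" for t
    using d1(3)[of t] d1(2) that by (auto simp: sgn_if split: if_splits)
  have neg: "k * D t < 0" if "c - \<delta>1 < t" "t < c" for t
    using d1(3)[of t] d1(2) that by (auto simp: sgn_if split: if_splits)
  have up: "F c < F (c + h)"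
    by (rule DERIV_pos_imp_increasing_open[of c "c + h"])
      (use h pos Fd Fc in \<open>auto intro!: continuous_at_imp_continuous_on exI\<close>)
  have dn: "F c < F (c - h)"
    by (rule DERIV_neg_imp_decreasing_open[of "c - h" c])
      (use h neg Fd Fc in \<open>auto intro!: continuous_at_imp_continuous_on exI\<close>)
  have "\<exists>s t. c - h \<le> s \<and> s < c \<and> c < t \<and> t \<le> c + h \<and> F s = F t"
  proof (cases "F (c - h) \<le> F (c + h)")
    case True
    have "\<exists>t\<ge>c. t \<le> c + h \<and> F t = F (c - h)"
      using True dn h by (intro IVT) (auto simp: Fc)
    then obtain t where "c \<le> t" "t \<le> c + h" "F t = F (c - h)" by blast
    moreover then have "t \<noteq> c" using dn by auto
    ultimately show ?thesis using h by (intro exI[of _ "c - h"] exI[of _ t]) auto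
  next
    case False
    have "\<exists>t\<ge>c-h. t \<le> c \<and> F t = F (c + h)"
      using False up h by (intro IVT2) (auto simp: Fc)
    then obtain s where "c - h \<le> s" "s \<le> c" "F s = F (c + h)" by blast
    moreover then have "s \<noteq> c" using up by auto
    ultimately show ?thesis using h by (intro exI[of _ s] exI[of _ "c + h"]) auto
  qed
  then obtain s t where st: "c - h \<le> s" "s < c" "c < t" "t \<le> c + h" "F s = F t" by blast
  then have Xst: "X s = X t" using d1(2) by (auto simp: F_def)
  note signs = fold_pair_signs[of c \<delta>1 k s t, OF d1(3) d1(2)]
  have "Z s \<noteq> Z t"
  proof
    assume "Z s = Z t"
    then have "front \<gamma> t = front \<gamma> s" using Xst by (simp add: front_eq)
    moreover have "front \<gamma> s \<notin> crossings \<gamma>" using d2(2)[of s] st h by auto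
    ultimately have "t - s \<in> \<int>" using noncrossing_fibre by blast
    then obtain n :: int where "t - s = of_int n" by (auto elim: Ints_cases)
    moreover have "0 < t - s" "t - s < 1" using st h by auto
    ultimately show False by auto
  qed
  then show ?thesis using that[of s t] st h signs Xst by auto
qed

end

context legendrian_front
begin

lemma same_branch_same_point:
  assumes inj: "inj_on X {c-\<delta><..<c+\<delta>}" and near: "near_mod c \<delta> s" "near_mod c \<delta> t" and eq: "X s = X t"
  shows "front \<gamma> s = front \<gamma> t"
proof -
  obtain m n :: int where mn: "\<bar>s + of_int m - c\<bar> < \<delta>" "\<bar>t + of_int n - c\<bar> < \<delta>"
    using near by (auto simp: near_mod_def)
  have "X (s + of_int m) = X (t + of_int n)" using eq by (simp add: periodic)
  then have "s + of_int m = t + of_int n"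
    by (rule inj_onD[OF inj]) (use mn in \<open>auto simp: abs_less_iff\<close>)
  then show ?thesis using front_periodic by metis
qed

text \<open>
  Away from cusps \<open>X\<close> is locally injective, hence open.
\<close>

lemma branch_covers_abscissae:
  assumes "D t1 \<noteq> 0" "\<forall>\<^sub>F t in nhds t1. Q t"
  shows "\<forall>\<^sub>F x in nhds (X t1). \<exists>t. X t = x \<and> Q t"
proof -
  obtain \<delta> where \<delta>: "\<delta> > 0" "inj_on X {t1-\<delta><..<t1+\<delta>}" using X_locally_injective[OF assms(1)] by blast
  obtain r where r: "r > 0" "\<And>t. \<bar>t - t1\<bar> < r \<Longrightarrow> Q t"
    using assms(2) by (auto simp: eventually_nhds_metric dist_real_def)
  define \<rho> where "\<rho> = min \<delta> r"
  have \<rho>: "\<rho> > 0" "\<rho> \<le> \<delta>" "\<rho> \<le> r" using \<delta> r by (auto simp: \<rho>_def)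
  have "open (X ` {t1-\<rho><..<t1+\<rho>})"
  proof (rule invariance_of_domain)
    show "continuous_on {t1-\<rho><..<t1+\<rho>} X" using X_cont by (simp add: continuous_at_imp_continuous_on)
    show "inj_on X {t1-\<rho><..<t1+\<rho>}" by (rule inj_on_subset[OF \<delta>(2)]) (use \<rho> in auto)
  qed auto
  moreover have "X t1 \<in> X ` {t1-\<rho><..<t1+\<rho>}" using \<rho> by auto
  ultimately have "\<forall>\<^sub>F x in nhds (X t1). x \<in> X ` {t1-\<rho><..<t1+\<rho>}" by (rule eventually_nhds_in_open)
  then show ?thesis
  proof eventually_elim
    case (elim x)
    then obtain t where t: "t \<in> {t1-\<rho><..<t1+\<rho>}" "X t = x" by auto
    have "\<bar>t - t1\<bar> < r" using t(1) \<rho> unfolding greaterThanLessThan_iff by linarith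
    then show ?case using r(2) t(2) by blast
  qed
qed

text \<open>
  The last clause of the definition of a Maslov potential settles the strands that run to the
  right. A strand that runs to the left ends at a cusp, across which the potential changes by one
  and the direction is reversed; since the modulus is even, parities make sense.
\<close>

lemma maslov_parity:
  assumes \<mu>: "maslov_potential \<gamma> \<mu>" and t: "D t \<noteq> 0"
  shows "even (\<mu> t) \<longleftrightarrow> D t > 0"
proof -
  define m where "m = 2 * rotation_number \<gamma>"
  have par: "even a \<longleftrightarrow> even b" if "[a = b] (mod m)" for a b
  proof -
    have "m dvd a - b" using that by (simp add: cong_iff_dvd_diff)
    then have "2 dvd a - b" by (rule dvd_trans[rotated]) (simp add: m_def)
    then show ?thesis by simp
  qed
  have M: "\<And>s t. s < t \<Longrightarrow> (\<forall>u\<in>{s..t}. \<not> cusp_parameter \<gamma> u) \<Longrightarrow> [\<mu> s = \<mu> t] (mod m)"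
    "\<And>c. cusp_parameter \<gamma> c \<Longrightarrow> \<exists>\<delta>>0. \<forall>s\<in>{c-\<delta><..<c+\<delta>}. \<forall>t\<in>{c-\<delta><..<c+\<delta>}.
       X s = X t \<and> Z s < Z t \<longrightarrow> [\<mu> t = \<mu> s + 1] (mod m)"
    "\<And>t. D t > 0 \<Longrightarrow> even (\<mu> t)"
    using \<mu> unfolding maslov_potential_def Let_def m_def[symmetric] by blast+
  show ?thesis
  proof (cases "D t > 0")
    case True
    then show ?thesis using M(3) by blast
  next
    case False
    then have neg: "D t < 0" using t by simp
    have "X t = X (t + 1)" using periodic[of t 1] by simp
    then obtain u where u: "t < u" "u < t + 1" "D u = 0" using rolle[of t "t + 1"] by auto
    \<comment> \<open>The first zero of \<open>D\<close> after \<open>t\<close> is the cusp at which the strand ends.\<close>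
    let ?K = "{u \<in> {t..t+1}. D u = 0}"
    have "continuous_on {t..t+1} D" using D_cont by (simp add: continuous_at_imp_continuous_on)
    then have "closed ?K" using continuous_closed_preimage[of "{t..t+1}" D "{0}"]
      by (simp add: vimage_def Int_def)
    then have "compact ({t..t+1} \<inter> ?K)" by (intro compact_Int_closed compact_Icc)
    moreover have "{t..t+1} \<inter> ?K = ?K" by auto
    ultimately have "compact ?K" by simp
    moreover have "u \<in> ?K" using u by simp
    then have "?K \<noteq> {}" by blast
    ultimately obtain c where c: "c \<in> ?K" "\<And>v. v \<in> ?K \<Longrightarrow> c \<le> v" using compact_attains_inf[of ?K] by blast
    have tc: "t < c" using c(1) neg by (cases "c = t") auto
    have free: "D v \<noteq> 0" if "t \<le> v" "v < c" for v using c(2)[of v] c(1) that by auto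
    have Dc: "D c = 0" "cusp_parameter \<gamma> c" using c(1) by (auto simp: cusp_parameter_def)
    obtain \<delta> where \<delta>: "\<delta> > 0" "\<And>s t. s \<in> {c-\<delta><..<c+\<delta>} \<Longrightarrow> t \<in> {c-\<delta><..<c+\<delta>} \<Longrightarrow>
       X s = X t \<and> Z s < Z t \<Longrightarrow> [\<mu> t = \<mu> s + 1] (mod m)"
      using M(2)[OF Dc(2)] by blast
    have "min \<delta> (c - t) > 0" using \<delta>(1) tc by simp
    then obtain s v where sv: "c - min \<delta> (c - t) < s" "s < c" "c < v" "v < c + min \<delta> (c - t)" "X s = X v"
      "D s \<noteq> 0" "D v \<noteq> 0" "(D s > 0) \<noteq> (D v > 0)" "Z s \<noteq> Z v"
      using fold_pair_exists[OF Dc(1)] by blast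
    have ts: "t < s" using sv(1) by (simp add: min_def split: if_splits)
    have Ds: "\<not> D s > 0"
    proof
      assume "D s > 0"
      then have "\<exists>x\<ge>t. x \<le> s \<and> D x = 0" using neg ts D_cont by (intro IVT) auto
      then show False using free sv(2) by force
    qed
    have "[\<mu> t = \<mu> s] (mod m)"
      by (rule M(1)) (use ts sv(2) free in \<open>auto simp: cusp_parameter_def\<close>)
    moreover have "even (\<mu> v)" using M(3) sv Ds by blast
    moreover have "[\<mu> v = \<mu> s + 1] (mod m) \<or> [\<mu> s = \<mu> v + 1] (mod m)"
      using \<delta>(2)[of s v] \<delta>(2)[of v s] sv by fastforce
    ultimately have "odd (\<mu> t)" using par by fastforce
    then show ?thesis using False by simp
  qed
qed

lemma two_graded_iff_same_direction:
  assumes \<mu>: "maslov_potential \<gamma> \<mu>"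
  shows "two_graded \<gamma> \<mu> S \<longleftrightarrow>
    (\<forall>s t. crossing_parameters \<gamma> s t \<and> front \<gamma> s \<in> S \<longrightarrow> (D s > 0) = (D t > 0))"
proof -
  have idx: "even (crossing_index \<mu> s t) \<longleftrightarrow> (D s > 0) = (D t > 0)" if "crossing_parameters \<gamma> s t" for s t
    using maslov_parity[OF \<mu>] crossing_transverse[OF that] by (simp add: crossing_index_def)
  show ?thesis
  proof (rule iffI, intro allI impI)
    fix s t assume tg: "two_graded \<gamma> \<mu> S" and st: "crossing_parameters \<gamma> s t \<and> front \<gamma> s \<in> S"
    consider "Y s < Y t" | "Y t < Y s" using crossing_transverse(3) st by fastforce
    then show "(D s > 0) = (D t > 0)"
    proof cases
      case 1
      then show ?thesis using tg st idx by (auto simp: two_graded_def upper_lower_at_crossing_def)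
    next
      case 2
      then have "upper_lower_at_crossing \<gamma> t s \<and> front \<gamma> t \<in> S"
        using st crossing_sym[of s t] unfolding upper_lower_at_crossing_def crossing_parameters_def by metis
      then show ?thesis using tg idx[of t s] by (auto simp: two_graded_def upper_lower_at_crossing_def)
    qed
  next
    assume R: "\<forall>s t. crossing_parameters \<gamma> s t \<and> front \<gamma> s \<in> S \<longrightarrow> (D s > 0) = (D t > 0)"
    then show "two_graded \<gamma> \<mu> S"
      unfolding two_graded_def upper_lower_at_crossing_def using idx by blast
  qed
qed

end

section \<open>The eyes of a ruling along the front\<close>

locale ruled_front = legendrian_front +
  fixes S :: "(real \<times> real) set" and E :: "eye set"
  assumes ruling: "ruling \<gamma> S E"
begin

lemma S_crossings: "S \<subseteq> crossings \<gamma>" and finite_E: "finite E"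
  and eyes: "e \<in> E \<Longrightarrow> is_eye \<gamma> e"
  and front_range: "range (front \<gamma>) = (\<Union>e\<in>E. eye_curve e)"
  using ruling by (auto simp: ruling_def)

lemma eyes_meet_at_crossings:
  "e \<in> E \<Longrightarrow> e' \<in> E \<Longrightarrow> e \<noteq> e' \<Longrightarrow> p \<in> eye_curve e \<Longrightarrow> p \<in> eye_curve e' \<Longrightarrow> p \<in> crossings \<gamma>"
  using ruling unfolding ruling_def by blast

lemma arc_differentiable:
  assumes "arc_through E p e \<sigma>" "p \<notin> S"
  shows "arc e \<sigma> differentiable (at (fst p))"
proof -
  have "\<forall>e\<in>E. \<forall>\<sigma>. \<forall>x\<in>{eye_left e<..<eye_right e}. (x, arc e \<sigma> x) \<notin> S \<longrightarrow> arc e \<sigma> differentiable (at x)"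
    using ruling by (simp add: ruling_def)
  then show ?thesis using assms by (auto simp: arc_through_def)
qed

lemma arcs_at_switch_ordered:
  assumes "p \<in> S" "arc_through E p e \<sigma>" "arc_through E p e' \<sigma>'" "e \<noteq> e'"
  shows "arc_above p e \<sigma> e' \<sigma>' \<or> arc_above p e' \<sigma>' e \<sigma>"
  using ruling assms unfolding ruling_def by blast

lemma eye_facts:
  assumes "e \<in> E"
  shows eye_nonempty: "eye_left e < eye_right e"
    and arc_continuous: "continuous_on {eye_left e..eye_right e} (arc e \<sigma>)"
    and eye_ends: "eye_top e (eye_left e) = eye_bot e (eye_left e)" "eye_top e (eye_right e) = eye_bot e (eye_right e)"
    and eye_inside: "\<And>x. eye_left e < x \<Longrightarrow> x < eye_right e \<Longrightarrow> eye_bot e x < eye_top e x"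
    and eye_in_front: "eye_curve e \<subseteq> range (front \<gamma>)"
  using eyes[OF assms] by (auto simp: is_eye_def)

lemma eye_left_cusp:
  assumes "e \<in> E" shows "\<exists>c. D c = 0 \<and> front \<gamma> c = (eye_left e, arc e \<sigma> (eye_left e))"
proof -
  have "(eye_left e, arc e \<sigma> (eye_left e)) \<in> left_cusps \<gamma>" using eyes[OF assms] unfolding is_eye_def by blast
  then obtain c where "(eye_left e, arc e \<sigma> (eye_left e)) = front \<gamma> c" "cusp_parameter \<gamma> c"
    unfolding left_cusps_def by blast
  then show ?thesis unfolding cusp_parameter_def by (intro exI[of _ c]) simp
qed

lemma eye_right_cusp:
  assumes "e \<in> E" shows "\<exists>c. D c = 0 \<and> front \<gamma> c = (eye_right e, arc e \<sigma> (eye_right e))"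
proof -
  have "(eye_right e, arc e \<sigma> (eye_right e)) \<in> right_cusps \<gamma>" using eyes[OF assms] unfolding is_eye_def by blast
  then obtain c where "(eye_right e, arc e \<sigma> (eye_right e)) = front \<gamma> c" "cusp_parameter \<gamma> c"
    unfolding right_cusps_def by blast
  then show ?thesis unfolding cusp_parameter_def by (intro exI[of _ c]) simp
qed

lemma arc_avoids_cusps:
  assumes "arc_through E p e \<sigma>" "front \<gamma> t = p"
  shows "D t \<noteq> 0"
proof
  assume "D t = 0"
  then have "p \<in> left_cusps \<gamma> \<union> right_cusps \<gamma>"
  proof (cases "deriv D t > 0")
    case True
    then show ?thesis using \<open>D t = 0\<close> assms(2) unfolding left_cusps_def cusp_parameter_def by blast
  next
    case False
    moreover have "deriv D t \<noteq> 0"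
      using generic \<open>D t = 0\<close> by (simp add: generic_front_def cusp_parameter_def)
    ultimately show ?thesis
      using \<open>D t = 0\<close> assms(2) unfolding right_cusps_def cusp_parameter_def by force
  qed
  moreover have "(fst p, arc e \<sigma> (fst p)) \<notin> left_cusps \<gamma> \<union> right_cusps \<gamma>"
    using assms(1) eyes[of e] unfolding is_eye_def arc_through_def by (meson greaterThanLessThan_iff)
  ultimately show False using assms(1) by (simp add: arc_through_def)
qed

lemma arc_point_in_front:
  assumes "e \<in> E" "eye_left e \<le> x" "x \<le> eye_right e"
  obtains t where "front \<gamma> t = (x, arc e \<sigma> x)"
proof -
  have "(x, arc e \<sigma> x) \<in> eye_curve e" using assms by (auto simp: eye_curve_def)
  then show ?thesis using eye_in_front[OF assms(1)] that by fastforce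
qed

lemma arc_through_in_curve: "arc_through E p e \<sigma> \<Longrightarrow> e \<in> E \<and> p \<in> eye_curve e"
  by (cases p) (auto simp: arc_through_def eye_curve_def)

lemma arc_through_same_eye:
  assumes "arc_through E p e \<sigma>" "arc_through E p e \<sigma>'"
  shows "\<sigma> = \<sigma>'"
  using assms eye_inside[of e "fst p"] by (cases \<sigma>; cases \<sigma>') (auto simp: arc_through_def)

lemma arc_through_noncrossing:
  assumes "arc_through E p e \<sigma>" "arc_through E p e' \<sigma>'" "p \<notin> crossings \<gamma>"
  shows "e = e' \<and> \<sigma> = \<sigma>'"
  using assms arc_through_in_curve eyes_meet_at_crossings arc_through_same_eye by metis

text \<open>
  The eyes cover the front, and only cusps can be end points of arcs.
\<close>

lemma exists_arc_through:
  assumes "D t \<noteq> 0"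
  shows "\<exists>e \<sigma>. arc_through E (front \<gamma> t) e \<sigma>"
proof -
  have "front \<gamma> t \<in> (\<Union>e\<in>E. eye_curve e)" using front_range by blast
  then obtain e x \<sigma> where e: "e \<in> E" "front \<gamma> t = (x, arc e \<sigma> x)" "eye_left e \<le> x" "x \<le> eye_right e"
    by (auto simp: eye_curve_def)
  have no_cusp: "front \<gamma> t \<noteq> front \<gamma> c" if "D c = 0" for c
    using noncrossing_fibre[OF cusp_not_crossing[OF that], of t] D_same[of t c] assms that by metis
  have "x \<noteq> eye_left e" using eye_left_cusp[OF e(1), of \<sigma>] no_cusp e(2) by metis
  moreover have "x \<noteq> eye_right e" using eye_right_cusp[OF e(1), of \<sigma>] no_cusp e(2) by metis
  ultimately show ?thesis using e by (intro exI[of _ e] exI[of _ \<sigma>]) (auto simp: arc_through_def)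
qed

definition on_closed_arc :: "real \<times> real \<Rightarrow> eye \<Rightarrow> side \<Rightarrow> bool" where
  "on_closed_arc P e \<sigma> \<longleftrightarrow> e \<in> E \<and> eye_left e \<le> fst P \<and> fst P \<le> eye_right e \<and> arc e \<sigma> (fst P) = snd P"

text \<open>
  There are finitely many arcs and each is a compact set, so those that avoid \<open>P\<close> stay away from
  \<open>P\<close>. The closed arcs include the cusps at their ends.
\<close>

lemma arcs_near_point:
  "\<forall>\<^sub>F v in nhds P. \<forall>e \<sigma>. arc_through E v e \<sigma> \<longrightarrow> on_closed_arc P e \<sigma>"
proof -
  define G where "G e \<sigma> = (\<lambda>x. (x, arc e \<sigma> x)) ` {eye_left e..eye_right e}" for e \<sigma>
  have cl: "closed (G e \<sigma>)" if "e \<in> E" for e \<sigma>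
    unfolding G_def using arc_continuous[OF that]
    by (intro compact_imp_closed compact_continuous_image continuous_intros) auto
  have one: "\<forall>\<^sub>F v in nhds P. v \<in> G e \<sigma> \<longrightarrow> P \<in> G e \<sigma>" if "e \<in> E" for e \<sigma>
  proof (cases "P \<in> G e \<sigma>")
    case False
    then have "\<forall>\<^sub>F v in nhds P. v \<in> - G e \<sigma>"
      using cl[OF that] by (intro eventually_nhds_in_open) auto
    then show ?thesis by eventually_elim auto
  qed simp
  have "\<forall>\<^sub>F v in nhds P. \<forall>e\<in>E. \<forall>\<sigma>\<in>{Top, Bot}. v \<in> G e \<sigma> \<longrightarrow> P \<in> G e \<sigma>"
    by (intro eventually_ball_finite ballI one finite_E) auto
  then show ?thesis
  proof eventually_elim
    case (elim v)
    show ?case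
    proof (intro allI impI)
      fix e \<sigma> assume a: "arc_through E v e \<sigma>"
      then have "v \<in> G e \<sigma>" by (cases v) (auto simp: arc_through_def G_def)
      moreover have "\<sigma> \<in> {Top, Bot}" by (cases \<sigma>) auto
      ultimately have "P \<in> G e \<sigma>" using elim a by (auto simp: arc_through_def)
      then show "on_closed_arc P e \<sigma>" using a by (auto simp: on_closed_arc_def G_def arc_through_def)
    qed
  qed
qed

lemma on_closed_arc_noncusp:
  assumes "on_closed_arc P e \<sigma>" "front \<gamma> t = P" "D t \<noteq> 0"
  shows "arc_through E P e \<sigma>"
proof -
  have e: "e \<in> E" "P = (fst P, arc e \<sigma> (fst P))" using assms by (auto simp: on_closed_arc_def)
  have no_cusp: "front \<gamma> t \<noteq> front \<gamma> c" if "D c = 0" for c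
    using noncrossing_fibre[OF cusp_not_crossing[OF that], of t] D_same[of t c] assms that by metis
  have "fst P \<noteq> eye_left e" using eye_left_cusp[OF e(1), of \<sigma>] no_cusp e(2) assms(2) by metis
  moreover have "fst P \<noteq> eye_right e" using eye_right_cusp[OF e(1), of \<sigma>] no_cusp e(2) assms(2) by metis
  ultimately show ?thesis using assms(1) by (auto simp: arc_through_def on_closed_arc_def)
qed

lemma arc_point_tendsto:
  assumes "arc_through E P e \<sigma>"
  shows "((\<lambda>x. (x, arc e \<sigma> x)) \<longlongrightarrow> P) (nhds (fst P))"
proof -
  have e: "e \<in> E" "fst P \<in> {eye_left e<..<eye_right e}" "P = (fst P, arc e \<sigma> (fst P))"
    using assms by (auto simp: arc_through_def)
  have "continuous_on {eye_left e<..<eye_right e} (arc e \<sigma>)"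
    using arc_continuous[OF e(1)] by (rule continuous_on_subset) auto
  then have "isCont (arc e \<sigma>) (fst P)" using e(2) by (simp add: continuous_on_eq_continuous_at)
  then have "isCont (\<lambda>x. (x, arc e \<sigma> x)) (fst P)" by (intro continuous_intros)
  then have "((\<lambda>x. (x, arc e \<sigma> x)) \<longlongrightarrow> (fst P, arc e \<sigma> (fst P))) (nhds (fst P))"
    using tendsto_at_iff_tendsto_nhds[of "\<lambda>x. (x, arc e \<sigma> x)" "fst P"] by (simp add: isCont_def)
  then show ?thesis using e(3) by simp
qed

lemma eventually_arc_parameters:
  assumes "arc_through E P e \<sigma>"
    and "\<And>t. front \<gamma> t = P \<Longrightarrow> \<forall>\<^sub>F s in nhds t. Q s"
    and "\<And>t n. Q (t + of_int n) \<longleftrightarrow> Q t"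
  shows "\<forall>\<^sub>F x in nhds (fst P). \<forall>t. front \<gamma> t = (x, arc e \<sigma> x) \<longrightarrow> Q t"
  using eventually_front[OF assms(2,3), of P] arc_point_tendsto[OF assms(1)]
  unfolding filterlim_iff by blast

lemma eventually_arc_through:
  assumes "arc_through E P e \<sigma>"
  shows "\<forall>\<^sub>F x in nhds (fst P). arc_through E (x, arc e \<sigma> x) e \<sigma>"
proof -
  have "\<forall>\<^sub>F x in nhds (fst P). x \<in> {eye_left e<..<eye_right e}"
    using assms by (intro eventually_nhds_in_open) (auto simp: arc_through_def)
  then show ?thesis using assms by (auto elim!: eventually_mono simp: arc_through_def)
qed

text \<open>
  Near \<open>P\<close> a point of the arc has a parameter near \<open>t1\<close> or near \<open>t2\<close>. On the second branch the
  slope of the chord to \<open>P\<close> tends to \<open>Y t2\<close>, but along the arc it tends to \<open>A\<close>; so the arc stays on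
  the first branch, and on both sides of \<open>P\<close>.
\<close>

lemma arc_follows_branch:
  assumes cr: "crossing_parameters \<gamma> t1 t2" and P: "front \<gamma> t1 = P"
    and arc: "arc_through E P e \<sigma>" and slope: "(arc e \<sigma> has_real_derivative A) (at (fst P))" "A \<noteq> Y t2"
    and near: "\<forall>\<^sub>F t in nhds t1. Q t" and per: "\<And>t n. Q (t + of_int n) \<longleftrightarrow> Q t"
  shows "\<forall>\<^sub>F x in at (fst P). \<forall>t. front \<gamma> t = (x, arc e \<sigma> x) \<longrightarrow> Q t"
proof -
  define \<eta> where "\<eta> = \<bar>A - Y t2\<bar> / 2"
  have \<eta>: "\<eta> > 0" using slope(2) by (simp add: \<eta>_def)
  define m where "m v = (snd v - snd P) / (fst v - fst P)" for v :: "real \<times> real"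
  \<comment> \<open>A property that holds near both branches, but on the arc can only hold because of \<open>Q\<close>.\<close>
  define Q' where "Q' t \<longleftrightarrow> Q t \<or> X t = fst P \<or> \<bar>m (front \<gamma> t) - A\<bar> > \<eta>" for t
  have P2: "front \<gamma> t2 = P" using cr P by (simp add: crossing_parameters_def)
  have Q1: "\<forall>\<^sub>F t in nhds t1. Q' t" using near by eventually_elim (simp add: Q'_def)
  have Q2: "\<forall>\<^sub>F t in nhds t2. Q' t"
  proof -
    have "((\<lambda>t. m (front \<gamma> t)) \<longlongrightarrow> Y t2) (at t2)"
      using slope_limit[OF crossing_transverse(2)[OF cr]] P2 by (auto simp: m_def front_def)
    then have "((\<lambda>t. \<bar>m (front \<gamma> t) - A\<bar>) \<longlongrightarrow> \<bar>Y t2 - A\<bar>) (at t2)" by (intro tendsto_intros)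
    then have "\<forall>\<^sub>F t in at t2. \<bar>m (front \<gamma> t) - A\<bar> > \<eta>"
      by (rule order_tendstoD) (use slope(2) in \<open>simp add: \<eta>_def abs_minus_commute\<close>)
    then have "\<forall>\<^sub>F t in at t2. Q' t" by eventually_elim (simp add: Q'_def)
    moreover have "Q' t2" using P2 by (auto simp: Q'_def front_def)
    ultimately show ?thesis by (simp add: eventually_nhds_conv_at)
  qed
  have shift: "\<forall>\<^sub>F s in nhds (u + of_int n). Q' s" if "\<forall>\<^sub>F s in nhds u. Q' s" for u n
  proof -
    have Q'per: "Q' (t + of_int n) \<longleftrightarrow> Q' t" for t n by (simp add: Q'_def per periodic front_periodic)
    have "((\<lambda>s. s - of_int n) \<longlongrightarrow> u) (nhds (u + of_int n))"
      by (rule tendsto_eq_intros filterlim_ident refl | simp)+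
    then have "\<forall>\<^sub>F s in nhds (u + of_int n). Q' (s - of_int n)"
      using that unfolding filterlim_iff by blast
    then show ?thesis by eventually_elim (use Q'per[of _ n] in \<open>metis diff_add_cancel\<close>)
  qed
  have "\<forall>\<^sub>F x in nhds (fst P). \<forall>t. front \<gamma> t = (x, arc e \<sigma> x) \<longrightarrow> Q' t"
  proof (rule eventually_arc_parameters[OF arc])
    fix t assume "front \<gamma> t = P"
    then have "t - t1 \<in> \<int> \<or> t - t2 \<in> \<int>" using crossing_fibre[OF cr] P by simp
    then show "\<forall>\<^sub>F s in nhds t. Q' s" using same_parameter shift Q1 Q2 by blast
  qed (simp add: Q'_def per periodic front_periodic)
  then have 1: "\<forall>\<^sub>F x in at (fst P). \<forall>t. front \<gamma> t = (x, arc e \<sigma> x) \<longrightarrow> Q' t"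
    by (simp add: eventually_nhds_conv_at)
  have 2: "\<forall>\<^sub>F x in at (fst P). \<bar>m (x, arc e \<sigma> x) - A\<bar> < \<eta>"
  proof -
    have "((\<lambda>x. m (x, arc e \<sigma> x)) \<longlongrightarrow> A) (at (fst P))"
      using slope(1) arc by (simp add: has_field_derivative_iff m_def arc_through_def)
    then show ?thesis using \<eta> unfolding tendsto_iff by (auto simp: dist_real_def)
  qed
  have 3: "\<forall>\<^sub>F x in at (fst P). x \<noteq> fst P" by (simp add: eventually_neq_at_within)
  from 1 2 3 show ?thesis
  proof eventually_elim
    case (elim x)
    show ?case
    proof (intro allI impI)
      fix t assume t: "front \<gamma> t = (x, arc e \<sigma> x)"
      then have "Q' t" using elim by blast
      moreover have "X t = x" using t by (simp add: front_def)
      ultimately show "Q t" using elim t by (auto simp: Q'_def)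
    qed
  qed
qed

lemma eventually_same_direction:
  assumes "D t \<noteq> 0"
  shows "\<forall>\<^sub>F s in nhds t. D s \<noteq> 0 \<and> (D s > 0) = (D t > 0)"
proof (cases "D t > 0")
  case True
  have "\<forall>\<^sub>F s in nhds t. D s > 0"
    using D_cont[of t] True by (intro order_tendstoD) (simp_all add: isCont_def tendsto_at_iff_tendsto_nhds)
  then show ?thesis by eventually_elim (use True in auto)
next
  case False
  then have n: "D t < 0" using assms by simp
  have "\<forall>\<^sub>F s in nhds t. D s < 0"
    using D_cont[of t] n by (intro order_tendstoD) (simp_all add: isCont_def tendsto_at_iff_tendsto_nhds)
  then show ?thesis by eventually_elim (use n in auto)
qed

definition arc_direction :: "eye \<Rightarrow> side \<Rightarrow> bool \<Rightarrow> real \<Rightarrow> bool" where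
  "arc_direction e \<sigma> d x \<longleftrightarrow> (\<forall>t. front \<gamma> t = (x, arc e \<sigma> x) \<longrightarrow> D t \<noteq> 0 \<and> (D t > 0) = d)"

lemma arc_direction_common:
  assumes "arc_through E P e \<sigma>" "\<And>t. front \<gamma> t = P \<Longrightarrow> (D t > 0) = d"
  shows "\<forall>\<^sub>F x in at (fst P). arc_direction e \<sigma> d x"
proof -
  have "\<forall>\<^sub>F x in nhds (fst P). \<forall>t. front \<gamma> t = (x, arc e \<sigma> x) \<longrightarrow> D t \<noteq> 0 \<and> (D t > 0) = d"
  proof (rule eventually_arc_parameters[OF assms(1)])
    fix t assume t: "front \<gamma> t = P"
    show "\<forall>\<^sub>F s in nhds t. D s \<noteq> 0 \<and> (D s > 0) = d"
      using eventually_same_direction[OF arc_avoids_cusps[OF assms(1) t]] assms(2)[OF t] by simp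
  qed (simp add: D_periodic)
  then show ?thesis by (simp add: eventually_nhds_conv_at arc_direction_def)
qed

text \<open>
  At a crossing that is not a switch the arc follows one branch, along which the direction is
  constant. At a switch the arc changes branches, but both branches have the same direction.
\<close>

lemma arc_direction_locally_constant:
  assumes switches: "\<And>s t. crossing_parameters \<gamma> s t \<Longrightarrow> front \<gamma> s \<in> S \<Longrightarrow> (D s > 0) = (D t > 0)"
    and arc: "arc_through E P e \<sigma>"
  shows "\<exists>d. \<forall>\<^sub>F x in at (fst P). arc_direction e \<sigma> d x"
proof -
  obtain t1 where t1: "front \<gamma> t1 = P"
    using arc_point_in_front[of e "fst P" \<sigma>] arc
    by (metis arc_through_def less_imp_le prod.collapse)
  show ?thesis
  proof (cases "P \<in> crossings \<gamma> \<and> P \<notin> S")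
    case False
    have "(D t > 0) = (D t1 > 0)" if t: "front \<gamma> t = P" for t
      using crossing_cases[of t t1] False t t1 D_same[of t t1] switches[of t t1] crossings_iff[of t] by auto
    then show ?thesis using arc_direction_common[OF arc] by blast
  next
    case True
    then obtain t2 where cr: "crossing_parameters \<gamma> t1 t2" using t1 crossings_iff by blast
    obtain A where A: "(arc e \<sigma> has_real_derivative A) (at (fst P))"
      using arc_differentiable[OF arc] True by (auto simp: real_differentiable_def)
    have main: "\<exists>d. \<forall>\<^sub>F x in at (fst P). arc_direction e \<sigma> d x"
      if cr: "crossing_parameters \<gamma> t1 t2" and t1: "front \<gamma> t1 = P" and A': "A \<noteq> Y t2" for t1 t2
      unfolding arc_direction_def
      using arc_follows_branch[OF cr t1 arc A A' eventually_same_direction[OF crossing_transverse(1)[OF cr]]]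
      by (auto simp: D_periodic)
    show ?thesis
    proof (cases "A = Y t2")
      case False
      then show ?thesis using main[OF cr t1] by blast
    next
      case True
      then show ?thesis using main[OF crossing_sym[OF cr]] crossing_transverse(3)[OF cr] cr t1
        by (auto simp: crossing_parameters_def)
    qed
  qed
qed

lemma arc_direction_constant:
  assumes switches: "\<And>s t. crossing_parameters \<gamma> s t \<Longrightarrow> front \<gamma> s \<in> S \<Longrightarrow> (D s > 0) = (D t > 0)"
    and e: "e \<in> E"
  shows "\<exists>d. \<forall>x\<in>{eye_left e<..<eye_right e}. \<forall>\<^sub>F y in at x. arc_direction e \<sigma> d y"
proof (rule punctured_locally_constant)
  fix x assume x: "x \<in> {eye_left e<..<eye_right e}"
  obtain t where "front \<gamma> t = (x, arc e \<sigma> x)" using arc_point_in_front[OF e, of x \<sigma>] x by auto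
  then show "\<not> (arc_direction e \<sigma> True x \<and> arc_direction e \<sigma> False x)"
    by (auto simp: arc_direction_def)
  have "arc_through E (x, arc e \<sigma> x) e \<sigma>" using e x by (auto simp: arc_through_def)
  from arc_direction_locally_constant[OF switches this]
  show "\<exists>d. \<forall>\<^sub>F y in at x. arc_direction e \<sigma> d y" by simp
qed auto

text \<open>
  Near the left cusp the two arcs are the two branches of the knot at that cusp.
\<close>

lemma opposite_arcs_opposite_directions:
  assumes e: "e \<in> E"
    and top: "\<forall>x\<in>{eye_left e<..<eye_right e}. \<forall>\<^sub>F y in at x. arc_direction e Top d y"
    and bot: "\<forall>x\<in>{eye_left e<..<eye_right e}. \<forall>\<^sub>F y in at x. arc_direction e Bot d' y"
  shows "d' = (\<not> d)"
proof -
  obtain c where c: "D c = 0" "front \<gamma> c = (eye_left e, eye_top e (eye_left e))"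
    using eye_left_cusp[OF e, of Top] by auto
  obtain \<delta> k where dk: "\<delta> > 0" "k \<in> {1,-1}" "\<And>t. t \<noteq> c \<Longrightarrow> \<bar>t - c\<bar> < \<delta> \<Longrightarrow> sgn (D t) = k * sgn (t - c)"
    using cusp_sign_change[OF c(1)] by blast
  let ?Q = "near_mod c \<delta>"
  have ev: "\<forall>\<^sub>F v in nhds (front \<gamma> c). \<forall>t. front \<gamma> t = v \<longrightarrow> ?Q t"
  proof (rule eventually_front[OF _ near_mod_periodic])
    fix t assume "front \<gamma> t = front \<gamma> c"
    then have "t - c \<in> \<int>" using noncrossing_fibre[OF cusp_not_crossing[OF c(1)]] by blast
    then show "\<forall>\<^sub>F s in nhds t. ?Q s" by (rule eventually_near_mod[OF dk(1)])
  qed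
  have lim: "((\<lambda>x. (x, arc e \<sigma> x)) \<longlongrightarrow> front \<gamma> c) (at_right (eye_left e))" for \<sigma>
  proof -
    have "(arc e \<sigma> \<longlongrightarrow> arc e \<sigma> (eye_left e)) (at_right (eye_left e))"
      using arc_continuous[OF e, of \<sigma>] eye_nonempty[OF e]
      by (metis atLeastAtMost_iff at_within_Icc_at_right continuous_on_def order_refl less_imp_le)
    moreover have "front \<gamma> c = (eye_left e, arc e \<sigma> (eye_left e))"
      using c eye_ends(1)[OF e] by (cases \<sigma>) auto
    ultimately show ?thesis by (auto intro!: tendsto_intros)
  qed
  have near: "\<forall>\<^sub>F x in at_right (eye_left e). \<forall>t. front \<gamma> t = (x, arc e \<sigma> x) \<longrightarrow> ?Q t" for \<sigma>
    using ev lim[of \<sigma>] unfolding filterlim_iff by blast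
  have "\<forall>\<^sub>F x in at_right (eye_left e). x \<in> {eye_left e<..<eye_right e}"
    using eventually_at_right_real[OF eye_nonempty[OF e]] .
  with near[of Top] near[of Bot]
  have "\<forall>\<^sub>F x in at_right (eye_left e). x \<in> {eye_left e<..<eye_right e} \<and>
      (\<forall>t. front \<gamma> t = (x, eye_top e x) \<longrightarrow> ?Q t) \<and> (\<forall>t. front \<gamma> t = (x, eye_bot e x) \<longrightarrow> ?Q t)"
    by eventually_elim auto
  then obtain b where b: "b > eye_left e"
    "\<And>x. eye_left e < x \<Longrightarrow> x < b \<Longrightarrow> x \<in> {eye_left e<..<eye_right e} \<and>
      (\<forall>t. front \<gamma> t = (x, eye_top e x) \<longrightarrow> ?Q t) \<and> (\<forall>t. front \<gamma> t = (x, eye_bot e x) \<longrightarrow> ?Q t)"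
    unfolding eventually_at_right_field by blast
  \<comment> \<open>The directions are known only near, not at, a given abscissa; any one close to the cusp serves.\<close>
  define x0 where "x0 = (eye_left e + b) / 2"
  have x0: "x0 \<in> {eye_left e<..<b}" using b(1) by (auto simp: x0_def)
  have "\<forall>\<^sub>F x in at x0. x \<in> {eye_left e<..<b}"
    using eventually_nhds_in_open[of "{eye_left e<..<b}" x0] x0 by (simp add: eventually_nhds_conv_at)
  moreover have "\<forall>\<^sub>F y in at x0. arc_direction e Top d y" "\<forall>\<^sub>F y in at x0. arc_direction e Bot d' y"
    using top bot b(2)[of x0] x0 by auto
  ultimately have "\<forall>\<^sub>F x in at x0. x \<in> {eye_left e<..<b} \<and> arc_direction e Top d x \<and> arc_direction e Bot d' x"
    by eventually_elim auto
  then obtain x where x: "x \<in> {eye_left e<..<b}" "arc_direction e Top d x" "arc_direction e Bot d' x"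
    using eventually_happens'[OF at_neq_bot] by blast
  have xin: "eye_left e < x" "x < eye_right e" using x(1) b(2)[of x] by auto
  obtain t0 where t0: "front \<gamma> t0 = (x, eye_top e x)" using arc_point_in_front[OF e, of x Top] xin by auto
  obtain s0 where s0: "front \<gamma> s0 = (x, eye_bot e x)" using arc_point_in_front[OF e, of x Bot] xin by auto
  have "?Q t0" "?Q s0" using b(2)[of x] x(1) t0 s0 by auto
  then obtain m n :: int where mn: "\<bar>t0 + of_int m - c\<bar> < \<delta>" "\<bar>s0 + of_int n - c\<bar> < \<delta>" by (auto simp: near_mod_def)
  define t where "t = t0 + of_int m"
  define s where "s = s0 + of_int n"
  have t: "front \<gamma> t = (x, eye_top e x)" "\<bar>t - c\<bar> < \<delta>" using t0 mn by (auto simp: t_def front_periodic)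
  have s: "front \<gamma> s = (x, eye_bot e x)" "\<bar>s - c\<bar> < \<delta>" using s0 mn by (auto simp: s_def front_periodic)
  have "s \<noteq> t" using t s eye_inside[OF e xin] by auto
  moreover have "X s = X t" using s t by (simp add: front_def)
  ultimately have "(D s > 0) \<noteq> (D t > 0)"
    using fold_pair_signs(5)[OF dk(3,2) s(2) t(2)] fold_pair_signs(5)[OF dk(3,2) t(2) s(2)]
    by (cases "s < t") auto
  moreover have "(D t > 0) = d" "(D s > 0) = d'"
    using x(2,3) t(1) s(1) by (auto simp: arc_direction_def)
  ultimately show ?thesis by auto
qed

lemma coherent_orientation_exists:
  assumes switches: "\<And>s t. crossing_parameters \<gamma> s t \<Longrightarrow> front \<gamma> s \<in> S \<Longrightarrow> (D s > 0) = (D t > 0)"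
  shows "\<exists>\<kappa>. coherent_orientation S E \<kappa>"
proof -
  have "\<forall>e\<in>E. \<exists>d. \<forall>x\<in>{eye_left e<..<eye_right e}. \<forall>\<^sub>F y in at x. arc_direction e Top d y"
    using arc_direction_constant[OF switches] by blast
  then obtain \<kappa> where \<kappa>: "\<And>e x. e \<in> E \<Longrightarrow> x \<in> {eye_left e<..<eye_right e} \<Longrightarrow> \<forall>\<^sub>F y in at x. arc_direction e Top (\<kappa> e) y"
    by metis
  have dir: "\<forall>\<^sub>F y in at x. arc_direction e \<sigma> ((\<sigma> = Top) = \<kappa> e) y"
    if e: "e \<in> E" and x: "x \<in> {eye_left e<..<eye_right e}" for e \<sigma> x
  proof (cases \<sigma>)
    case Top then show ?thesis using \<kappa>[OF e x] by simp
  next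
    case Bot
    obtain d' where d': "\<forall>x\<in>{eye_left e<..<eye_right e}. \<forall>\<^sub>F y in at x. arc_direction e Bot d' y"
      using arc_direction_constant[OF switches e] by blast
    then have "d' = (\<not> \<kappa> e)" using opposite_arcs_opposite_directions[OF e] \<kappa>[OF e] by blast
    then show ?thesis using d' x Bot by auto
  qed
  have at_switch: "((\<sigma> = Top) = \<kappa> e) = (D s > 0)"
    if p: "front \<gamma> s \<in> S" and arc: "arc_through E (front \<gamma> s) e \<sigma>" for s e \<sigma>
  proof -
    have e: "e \<in> E" "fst (front \<gamma> s) \<in> {eye_left e<..<eye_right e}" using arc by (auto simp: arc_through_def)
    have "(D t > 0) = (D s > 0)" if "front \<gamma> t = front \<gamma> s" for t
      using crossing_cases[OF that] D_same[of t s] switches[of t s] p that by auto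
    then have "\<forall>\<^sub>F x in at (fst (front \<gamma> s)). arc_direction e \<sigma> (D s > 0) x"
      using arc_direction_common[OF arc] by blast
    moreover have "\<forall>\<^sub>F x in at (fst (front \<gamma> s)). x \<in> {eye_left e<..<eye_right e}"
      using eventually_nhds_in_open[OF _ e(2)] by (simp add: eventually_nhds_conv_at)
    ultimately have "\<forall>\<^sub>F x in at (fst (front \<gamma> s)). ((\<sigma> = Top) = \<kappa> e) = (D s > 0)"
      using dir[OF e, of \<sigma>]
    proof eventually_elim
      case (elim x)
      obtain t where "front \<gamma> t = (x, arc e \<sigma> x)" using arc_point_in_front[OF e(1), of x \<sigma>] elim(2) by auto
      then show ?case using elim by (auto simp: arc_direction_def)
    qed
    then show ?thesis by simp
  qed
  show ?thesis
    unfolding coherent_orientation_def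
  proof (intro exI[of _ \<kappa>] ballI allI impI, elim conjE)
    fix p e \<sigma> e' \<sigma>'
    assume p: "p \<in> S" and arcs: "arc_through E p e \<sigma>" "arc_through E p e' \<sigma>'"
    obtain s where "p = front \<gamma> s" using p S_crossings by (auto simp: crossings_def)
    then show "((\<sigma> = Top) = \<kappa> e) = ((\<sigma>' = Top) = \<kappa> e')" using at_switch p arcs by blast
  qed
qed

end

context ruled_front
begin

text \<open>
  The direction of the knot at \<open>t\<close> agrees with the direction that \<open>\<kappa>\<close> assigns to the arc on which
  \<open>t\<close> lies iff \<open>d\<close>.
\<close>

definition knot_sign :: "(eye \<Rightarrow> bool) \<Rightarrow> bool \<Rightarrow> real \<Rightarrow> bool" where
  "knot_sign \<kappa> d t \<longleftrightarrow> D t \<noteq> 0 \<and>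
     (\<forall>e \<sigma>. arc_through E (front \<gamma> t) e \<sigma> \<longrightarrow> ((D t > 0) = ((\<sigma> = Top) = \<kappa> e)) = d)"

lemma knot_sign_exclusive: "\<not> (knot_sign \<kappa> True t \<and> knot_sign \<kappa> False t)"
  using exists_arc_through[of t] unfolding knot_sign_def by blast

lemma eventually_arcs_through:
  assumes "D t0 \<noteq> 0"
  shows "\<forall>\<^sub>F t in nhds t0. \<forall>e \<sigma>. arc_through E (front \<gamma> t) e \<sigma> \<longrightarrow> arc_through E (front \<gamma> t0) e \<sigma>"
proof -
  have "(front \<gamma> \<longlongrightarrow> front \<gamma> t0) (nhds t0)"
    using front_cont[of t0] tendsto_at_iff_tendsto_nhds[of "front \<gamma>" t0] by (simp add: isCont_def)
  then have "\<forall>\<^sub>F t in nhds t0. \<forall>e \<sigma>. arc_through E (front \<gamma> t) e \<sigma> \<longrightarrow> on_closed_arc (front \<gamma> t0) e \<sigma>"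
    using arcs_near_point unfolding filterlim_iff by blast
  then show ?thesis by eventually_elim (use on_closed_arc_noncusp assms in blast)
qed

lemma knot_sign_common:
  assumes t0: "D t0 \<noteq> 0" and arcs: "\<And>e \<sigma>. arc_through E (front \<gamma> t0) e \<sigma> \<Longrightarrow> ((\<sigma> = Top) = \<kappa> e) = b"
  shows "\<forall>\<^sub>F t in nhds t0. knot_sign \<kappa> ((D t0 > 0) = b) t"
  using eventually_arcs_through[OF t0] eventually_same_direction[OF t0]
proof eventually_elim
  case (elim t)
  then show ?case using arcs unfolding knot_sign_def by blast
qed

lemma knot_sign_noncrossing:
  assumes "D t0 \<noteq> 0" "front \<gamma> t0 \<notin> crossings \<gamma>"
  shows "\<exists>d. \<forall>\<^sub>F t in nhds t0. knot_sign \<kappa> d t"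
proof -
  obtain e \<sigma> where e: "arc_through E (front \<gamma> t0) e \<sigma>" using exists_arc_through[OF assms(1)] by blast
  have "((\<sigma>' = Top) = \<kappa> e') = ((\<sigma> = Top) = \<kappa> e)" if "arc_through E (front \<gamma> t0) e' \<sigma>'" for e' \<sigma>'
    using arc_through_noncrossing[OF that e assms(2)] by simp
  then show ?thesis using knot_sign_common[OF assms(1)] by blast
qed

text \<open>
  Two arcs that are tangent to the same branch follow it, so they share points that are no crossings.
\<close>

lemma arcs_along_branch_unique:
  assumes cr: "crossing_parameters \<gamma> t1 t2"
    and arc: "arc_through E (front \<gamma> t1) e \<sigma>" "arc_through E (front \<gamma> t1) e' \<sigma>'"
    and slope: "(arc e \<sigma> has_real_derivative Y t1) (at (X t1))" "(arc e' \<sigma>' has_real_derivative Y t1) (at (X t1))"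
  shows "e = e' \<and> \<sigma> = \<sigma>'"
proof -
  have f: "fst (front \<gamma> t1) = X t1" by (simp add: front_def)
  obtain \<delta> where \<delta>: "\<delta> > 0" "inj_on X {t1-\<delta><..<t1+\<delta>}" using X_locally_injective crossing_transverse(1)[OF cr] by blast
  have near: "\<forall>\<^sub>F t in nhds t1. near_mod t1 \<delta> t" using \<delta>(1) by (intro eventually_near_mod) auto
  note branch = arc_follows_branch[where Q="near_mod t1 \<delta>", OF cr refl _ _ crossing_transverse(3)[OF cr] near near_mod_periodic, unfolded f]
  have "\<forall>\<^sub>F x in at (X t1). e = e' \<and> \<sigma> = \<sigma>'"
    using branch[OF arc(1) slope(1)] branch[OF arc(2) slope(2)] eventually_vertical_not_crossing[of "X t1"]
      eventually_arc_through[OF arc(1), unfolded f, THEN eventually_nhds_conv_at[THEN iffD1, THEN conjunct1]]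
      eventually_arc_through[OF arc(2), unfolded f, THEN eventually_nhds_conv_at[THEN iffD1, THEN conjunct1]]
  proof eventually_elim
    case (elim x)
    obtain t where t: "front \<gamma> t = (x, arc e \<sigma> x)"
      using arc_point_in_front[of e x \<sigma>] elim(4) by (auto simp: arc_through_def)
    obtain t' where t': "front \<gamma> t' = (x, arc e' \<sigma>' x)"
      using arc_point_in_front[of e' x \<sigma>'] elim(5) by (auto simp: arc_through_def)
    have "near_mod t1 \<delta> t" "near_mod t1 \<delta> t'" using elim(1,2) t t' by blast+
    moreover have "X t = X t'" using t t' by (simp add: front_def)
    ultimately have "front \<gamma> t = front \<gamma> t'" by (rule same_branch_same_point[OF \<delta>(2)])
    then have "arc e \<sigma> x = arc e' \<sigma>' x" using t t' by simp
    then show ?case using arc_through_noncrossing[of "(x, arc e \<sigma> x)"] elim(3,4,5) by metis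
  qed
  then show ?thesis by simp
qed

lemma arcs_off_branch:
  assumes cr: "crossing_parameters \<gamma> t1 t2" and arc: "arc_through E (front \<gamma> t1) e \<sigma>"
    and slope: "(arc e \<sigma> has_real_derivative A) (at (X t1))" "A \<noteq> Y t1"
  shows "\<forall>\<^sub>F t in at t1. \<not> arc_through E (front \<gamma> t) e \<sigma>"
proof -
  have f: "front \<gamma> t2 = front \<gamma> t1" "X t2 = X t1" "fst (front \<gamma> t1) = X t1"
    using cr by (auto simp: crossing_parameters_def front_def)
  obtain \<delta> where \<delta>: "\<delta> > 0" "\<And>u. \<not> (near_mod t1 \<delta> u \<and> near_mod t2 \<delta> u)"
    using near_mod_disjoint cr unfolding crossing_parameters_def by metis
  have near: "\<forall>\<^sub>F t in nhds t2. near_mod t2 \<delta> t" using \<delta>(1) by (intro eventually_near_mod) auto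
  have "\<forall>\<^sub>F x in at (X t1). \<forall>t. front \<gamma> t = (x, arc e \<sigma> x) \<longrightarrow> near_mod t2 \<delta> t"
    using arc_follows_branch[where Q="near_mod t2 \<delta>", OF crossing_sym[OF cr] f(1) _ _ _ near near_mod_periodic, of e \<sigma> A] slope f(3) arc
    by simp
  moreover have "filterlim X (at (X t1)) (at t1)"
    using X_cont[of t1] eventually_X_ne[of "X t1" t1] by (simp add: filterlim_at isCont_def)
  ultimately have "\<forall>\<^sub>F t in at t1. \<forall>s. front \<gamma> s = (X t, arc e \<sigma> (X t)) \<longrightarrow> near_mod t2 \<delta> s"
    unfolding filterlim_iff by blast
  moreover have "\<forall>\<^sub>F t in at t1. near_mod t1 \<delta> t"
    using eventually_near_mod[OF \<delta>(1), of t1 t1] by (simp add: eventually_nhds_conv_at)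
  ultimately show ?thesis
  proof eventually_elim
    case (elim t)
    show ?case
    proof
      assume "arc_through E (front \<gamma> t) e \<sigma>"
      then have "front \<gamma> t = (X t, arc e \<sigma> (X t))" by (simp add: arc_through_def front_def)
      then show False using elim \<delta>(2) by blast
    qed
  qed
qed

text \<open>
  Exactly one arc follows the branch at \<open>t1\<close>, so all points of the knot near \<open>t1\<close> lie on that arc.
\<close>

lemma knot_sign_plain_crossing:
  assumes cr: "crossing_parameters \<gamma> t1 t2" and nS: "front \<gamma> t1 \<notin> S"
  shows "\<exists>d. \<forall>\<^sub>F t in at t1. knot_sign \<kappa> d t"
proof -
  have f: "fst (front \<gamma> t1) = X t1" by (simp add: front_def)
  define R where "R e \<sigma> \<longleftrightarrow> arc_through E (front \<gamma> t1) e \<sigma> \<and> (arc e \<sigma> has_real_derivative Y t1) (at (X t1))" for e \<sigma>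
  have D1: "D t1 \<noteq> 0" using crossing_transverse(1)[OF cr] .
  have one: "\<forall>\<^sub>F t in at t1. arc_through E (front \<gamma> t) e \<sigma> \<longrightarrow> R e \<sigma>" for e \<sigma>
  proof (cases "arc_through E (front \<gamma> t1) e \<sigma>")
    case True
    obtain A where A: "(arc e \<sigma> has_real_derivative A) (at (X t1))"
      using arc_differentiable[OF True nS] f by (auto simp: real_differentiable_def)
    show ?thesis
    proof (cases "A = Y t1")
      case True2: True
      then show ?thesis using True A by (simp add: R_def)
    next
      case False
      show ?thesis using arcs_off_branch[OF cr True A False] by eventually_elim simp
    qed
  next
    case False
    have "\<forall>\<^sub>F t in at t1. \<forall>e \<sigma>. arc_through E (front \<gamma> t) e \<sigma> \<longrightarrow> arc_through E (front \<gamma> t1) e \<sigma>"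
      using eventually_arcs_through[OF D1] by (simp only: eventually_nhds_conv_at)
    then show ?thesis by eventually_elim (use False in blast)
  qed
  have "\<forall>\<^sub>F t in at t1. \<forall>e\<in>E. \<forall>\<sigma>\<in>{Top,Bot}. arc_through E (front \<gamma> t) e \<sigma> \<longrightarrow> R e \<sigma>"
    by (intro eventually_ball_finite ballI one finite_E) auto
  then have all: "\<forall>\<^sub>F t in at t1. \<forall>e \<sigma>. arc_through E (front \<gamma> t) e \<sigma> \<longrightarrow> R e \<sigma>"
  proof eventually_elim
    case (elim t)
    have "R e \<sigma>" if "arc_through E (front \<gamma> t) e \<sigma>" for e \<sigma>
      using elim that by (cases \<sigma>) (auto simp: arc_through_def)
    then show ?case by blast
  qed
  have uniq: "e = e' \<and> \<sigma> = \<sigma>'" if "R e \<sigma>" "R e' \<sigma>'" for e \<sigma> e' \<sigma>'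
    using arcs_along_branch_unique[OF cr] that unfolding R_def by blast
  obtain b where b: "\<And>e \<sigma>. R e \<sigma> \<Longrightarrow> ((\<sigma> = Top) = \<kappa> e) = b"
  proof (cases "\<exists>e \<sigma>. R e \<sigma>")
    case True
    then obtain e \<sigma> where "R e \<sigma>" by blast
    then show ?thesis using uniq by (intro that[of "(\<sigma> = Top) = \<kappa> e"]) blast
  qed (use that in blast)
  have "\<forall>\<^sub>F t in at t1. D t \<noteq> 0 \<and> (D t > 0) = (D t1 > 0)"
    using eventually_same_direction[OF D1] by (simp add: eventually_nhds_conv_at)
  with all have "\<forall>\<^sub>F t in at t1. knot_sign \<kappa> ((D t1 > 0) = b) t"
  proof eventually_elim
    case (elim t)
    then show ?case using b unfolding knot_sign_def by blast
  qed
  then show ?thesis by blast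
qed

lemma knot_sign_interval:
  assumes I: "open I" "connected I" and t: "\<And>t. t \<in> I \<Longrightarrow> D t \<noteq> 0 \<and> front \<gamma> t \<notin> crossings \<gamma>"
  shows "\<exists>d. \<forall>t\<in>I. knot_sign \<kappa> d t"
proof -
  have "\<exists>d. \<forall>t\<in>I. \<forall>\<^sub>F s in at t. knot_sign \<kappa> d s"
  proof (rule punctured_locally_constant[OF I])
    show "\<exists>d. \<forall>\<^sub>F s in at x. knot_sign \<kappa> d s" if "x \<in> I" for x
      using knot_sign_noncrossing[of x \<kappa>] t[OF that] by (auto simp: eventually_nhds_conv_at)
  qed (rule knot_sign_exclusive)
  then obtain d where d: "\<And>t. t \<in> I \<Longrightarrow> \<forall>\<^sub>F s in at t. knot_sign \<kappa> d s" by blast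
  have "knot_sign \<kappa> d s" if s: "s \<in> I" for s
  proof -
    obtain d' where d': "\<forall>\<^sub>F r in nhds s. knot_sign \<kappa> d' r" using knot_sign_noncrossing t[OF s] by blast
    then have "\<forall>\<^sub>F r in at s. knot_sign \<kappa> d' r" by (simp add: eventually_nhds_conv_at)
    with d[OF s] have "\<forall>\<^sub>F r in at s. d' = d"
    proof eventually_elim
      case (elim r)
      then show ?case using knot_sign_exclusive[of \<kappa> r] by (cases d; cases d') auto
    qed
    then have "d' = d" by simp
    then show ?thesis using d' by (simp add: eventually_nhds_conv_at)
  qed
  then show ?thesis by blast
qed

lemma on_closed_arc_in_curve: "on_closed_arc P e \<sigma> \<Longrightarrow> e \<in> E \<and> P \<in> eye_curve e"
  by (cases P) (auto simp: on_closed_arc_def eye_curve_def)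

text \<open>
  Both sides of the cusp lie on one eye, but one of them on the top and the other on the bottom arc.
  So both directions that \<open>knot_sign\<close> compares are reversed.
\<close>

lemma knot_sign_cusp:
  assumes c: "D c = 0"
  shows "\<exists>d. \<forall>\<^sub>F t in at c. knot_sign \<kappa> d t"
proof -
  have lim: "(front \<gamma> \<longlongrightarrow> front \<gamma> c) (at c)" using front_cont[of c] by (simp add: isCont_def)
  have arcs: "\<forall>\<^sub>F t in at c. \<forall>e \<sigma>. arc_through E (front \<gamma> t) e \<sigma> \<longrightarrow> on_closed_arc (front \<gamma> c) e \<sigma>"
    using arcs_near_point lim unfolding filterlim_iff by blast
  have "\<forall>\<^sub>F t in at c. D t \<noteq> 0 \<and> front \<gamma> t \<notin> crossings \<gamma> \<and>
      (\<forall>e \<sigma>. arc_through E (front \<gamma> t) e \<sigma> \<longrightarrow> on_closed_arc (front \<gamma> c) e \<sigma>)"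
    using eventually_not_cusp[of c] eventually_not_crossing[of c] arcs by eventually_elim blast
  then obtain \<delta> where \<delta>: "\<delta> > 0" "\<And>t. t \<noteq> c \<Longrightarrow> \<bar>t - c\<bar> < \<delta> \<Longrightarrow> D t \<noteq> 0 \<and> front \<gamma> t \<notin> crossings \<gamma> \<and>
      (\<forall>e \<sigma>. arc_through E (front \<gamma> t) e \<sigma> \<longrightarrow> on_closed_arc (front \<gamma> c) e \<sigma>)"
    unfolding eventually_at dist_real_def by blast
  have "\<exists>d. \<forall>t\<in>{c<..<c+\<delta>}. knot_sign \<kappa> d t"
    by (rule knot_sign_interval) (use \<delta>(2) in auto)
  then obtain d where d: "\<And>t. t \<in> {c<..<c+\<delta>} \<Longrightarrow> knot_sign \<kappa> d t" by blast
  have "\<exists>d. \<forall>t\<in>{c-\<delta><..<c}. knot_sign \<kappa> d t"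
    by (rule knot_sign_interval) (use \<delta>(2) in auto)
  then obtain d' where d': "\<And>t. t \<in> {c-\<delta><..<c} \<Longrightarrow> knot_sign \<kappa> d' t" by blast
  obtain s t where st: "c - \<delta> < s" "s < c" "c < t" "t < c + \<delta>" "X s = X t"
    "D s \<noteq> 0" "D t \<noteq> 0" "(D s > 0) \<noteq> (D t > 0)" "Z s \<noteq> Z t"
    using fold_pair_exists[OF c \<delta>(1)] by blast
  obtain e \<sigma> where e: "arc_through E (front \<gamma> s) e \<sigma>" using exists_arc_through st by blast
  obtain e' \<sigma>' where e': "arc_through E (front \<gamma> t) e' \<sigma>'" using exists_arc_through st by blast
  have "on_closed_arc (front \<gamma> c) e \<sigma>" "on_closed_arc (front \<gamma> c) e' \<sigma>'"
    using \<delta>(2)[of s] \<delta>(2)[of t] st e e' by auto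
  then have "front \<gamma> c \<in> eye_curve e" "front \<gamma> c \<in> eye_curve e'" "e \<in> E" "e' \<in> E"
    using on_closed_arc_in_curve by blast+
  then have "e = e'" using eyes_meet_at_crossings[of e e'] cusp_not_crossing[OF c] by blast
  moreover have "\<sigma> \<noteq> \<sigma>'"
    using e e' \<open>e = e'\<close> st(5,9) by (auto simp: arc_through_def front_def)
  ultimately have "((\<sigma> = Top) = \<kappa> e) \<noteq> ((\<sigma>' = Top) = \<kappa> e')" by (cases \<sigma>; cases \<sigma>') auto
  moreover have "knot_sign \<kappa> d' s" "knot_sign \<kappa> d t" using d d' st by auto
  ultimately have "d = d'" using e e' st(8) unfolding knot_sign_def by metis
  have "knot_sign \<kappa> d t" if "t \<noteq> c" "\<bar>t - c\<bar> < \<delta>" for t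
  proof (cases "t < c")
    case True
    then show ?thesis using d'[of t] \<open>d = d'\<close> that by auto
  next
    case False
    then show ?thesis using d[of t] that by auto
  qed
  then show ?thesis using \<delta>(1) unfolding eventually_at dist_real_def by blast
qed

lemma coherent_imp_same_direction:
  assumes coh: "coherent_orientation S E \<kappa>" and cr: "crossing_parameters \<gamma> s t" and sw: "front \<gamma> s \<in> S"
  shows "(D s > 0) = (D t > 0)"
proof -
  have switch: "\<exists>b. \<forall>e \<sigma>. arc_through E (front \<gamma> u) e \<sigma> \<longrightarrow> ((\<sigma> = Top) = \<kappa> e) = b" if "front \<gamma> u \<in> S" for u
  proof (cases "\<exists>e \<sigma>. arc_through E (front \<gamma> u) e \<sigma>")
    case True
    then obtain e \<sigma> where "arc_through E (front \<gamma> u) e \<sigma>" by blast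
    then show ?thesis using coh that unfolding coherent_orientation_def
      by (intro exI[of _ "(\<sigma> = Top) = \<kappa> e"]) blast
  qed blast
  have "\<exists>d. \<forall>u\<in>UNIV. \<forall>\<^sub>F r in at u. knot_sign \<kappa> d r"
  proof (rule punctured_locally_constant)
    fix u :: real
    show "\<exists>d. \<forall>\<^sub>F r in at u. knot_sign \<kappa> d r"
    proof (cases "D u = 0")
      case True
      then show ?thesis using knot_sign_cusp by blast
    next
      case False
      show ?thesis
      proof (cases "front \<gamma> u \<in> S")
        case True
        then obtain b where "\<And>e \<sigma>. arc_through E (front \<gamma> u) e \<sigma> \<Longrightarrow> ((\<sigma> = Top) = \<kappa> e) = b" using switch[OF True] by blast
        then show ?thesis using knot_sign_common[OF False, of \<kappa> b] by (auto simp: eventually_nhds_conv_at)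
      next
        case nS: False
        show ?thesis
        proof (cases "front \<gamma> u \<in> crossings \<gamma>")
          case True
          then show ?thesis using knot_sign_plain_crossing nS crossings_iff by blast
        next
          case nc: False
          then show ?thesis using knot_sign_noncrossing[OF False] by (auto simp: eventually_nhds_conv_at)
        qed
      qed
    qed
  qed (auto simp: knot_sign_exclusive)
  then obtain d where d: "\<And>u. \<forall>\<^sub>F r in at u. knot_sign \<kappa> d r" by blast
  obtain b where b: "\<And>e \<sigma>. arc_through E (front \<gamma> s) e \<sigma> \<Longrightarrow> ((\<sigma> = Top) = \<kappa> e) = b" using switch[OF sw] by blast
  have "((D u > 0) = b) = d" if u: "D u \<noteq> 0" "front \<gamma> u = front \<gamma> s" for u
  proof -
    have "\<forall>\<^sub>F r in at u. knot_sign \<kappa> ((D u > 0) = b) r"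
      using knot_sign_common[OF u(1), of \<kappa> b] b u(2) by (auto simp: eventually_nhds_conv_at)
    with d[of u] have "\<forall>\<^sub>F r in at u. ((D u > 0) = b) = d"
    proof eventually_elim
      case (elim r)
      then show ?case using knot_sign_exclusive[of \<kappa> r] by (cases d; cases "(D u > 0) = b") auto
    qed
    then show ?thesis by simp
  qed
  from this[of s] this[of t] show ?thesis
    using crossing_transverse[OF cr] cr by (auto simp: crossing_parameters_def)
qed

lemma two_graded_iff_coherent:
  assumes "maslov_potential \<gamma> \<mu>"
  shows "two_graded \<gamma> \<mu> S \<longleftrightarrow> (\<exists>\<kappa>. coherent_orientation S E \<kappa>)"
  unfolding two_graded_iff_same_direction[OF assms]
  using coherent_orientation_exists coherent_imp_same_direction by blast

text \<open>
  On a vertical line close to the crossing there are exactly two points of the front near the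
  crossing, one on each branch. They are no crossings, so each lies on a single arc. The two arcs
  belong to different eyes because the top and the bottom arc of an eye are disjoint over its
  interior.
\<close>

lemma two_arcs_at_crossing:
  assumes cr: "crossing_parameters \<gamma> t1 t2"
  shows "\<exists>e \<sigma> e' \<sigma>'. e \<noteq> e' \<and> arc_through E (front \<gamma> t1) e \<sigma> \<and> arc_through E (front \<gamma> t1) e' \<sigma>' \<and>
    (\<forall>a s. arc_through E (front \<gamma> t1) a s \<longrightarrow> a = e \<and> s = \<sigma> \<or> a = e' \<and> s = \<sigma>')"
proof -
  let ?p = "front \<gamma> t1"
  have f: "fst ?p = X t1" "front \<gamma> t2 = ?p" "X t2 = X t1" using cr by (auto simp: crossing_parameters_def front_def)
  note D12 = crossing_transverse[OF cr]
  obtain \<delta>0 where \<delta>0: "\<delta>0 > 0" "\<And>u. \<not> (near_mod t1 \<delta>0 u \<and> near_mod t2 \<delta>0 u)"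
    using near_mod_disjoint cr unfolding crossing_parameters_def by metis
  obtain \<delta>1 where \<delta>1: "\<delta>1 > 0" "inj_on X {t1-\<delta>1<..<t1+\<delta>1}" using X_locally_injective D12(1) by blast
  obtain \<delta>2 where \<delta>2: "\<delta>2 > 0" "inj_on X {t2-\<delta>2<..<t2+\<delta>2}" using X_locally_injective D12(2) by blast
  have a1: "\<forall>\<^sub>F t in nhds t1. D t \<noteq> 0 \<and> near_mod t1 \<delta>0 t \<and> (\<forall>e \<sigma>. arc_through E (front \<gamma> t) e \<sigma> \<longrightarrow> arc_through E ?p e \<sigma>)"
    using eventually_same_direction[OF D12(1)] eventually_near_mod[OF \<delta>0(1), of t1 t1, simplified]
      eventually_arcs_through[OF D12(1)]
    by eventually_elim auto
  have a2: "\<forall>\<^sub>F t in nhds t2. D t \<noteq> 0 \<and> near_mod t2 \<delta>0 t \<and> (\<forall>e \<sigma>. arc_through E (front \<gamma> t) e \<sigma> \<longrightarrow> arc_through E ?p e \<sigma>)"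
    using eventually_same_direction[OF D12(2)] eventually_near_mod[OF \<delta>0(1), of t2 t2, simplified]
      eventually_arcs_through[OF D12(2), unfolded f(2)]
    by eventually_elim auto
  have "\<forall>\<^sub>F x in at (X t1). (\<exists>t. X t = x \<and> D t \<noteq> 0 \<and> near_mod t1 \<delta>0 t \<and> (\<forall>e \<sigma>. arc_through E (front \<gamma> t) e \<sigma> \<longrightarrow> arc_through E ?p e \<sigma>))"
    using branch_covers_abscissae[OF D12(1) a1] by (simp add: eventually_nhds_conv_at)
  moreover have "\<forall>\<^sub>F x in at (X t1). (\<exists>t. X t = x \<and> D t \<noteq> 0 \<and> near_mod t2 \<delta>0 t \<and> (\<forall>e \<sigma>. arc_through E (front \<gamma> t) e \<sigma> \<longrightarrow> arc_through E ?p e \<sigma>))"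
    using branch_covers_abscissae[OF D12(2) a2] f(3) by (simp add: eventually_nhds_conv_at)
  ultimately have "\<forall>\<^sub>F x in at (X t1). \<exists>e \<sigma> e' \<sigma>'. e \<noteq> e' \<and> arc_through E ?p e \<sigma> \<and> arc_through E ?p e' \<sigma>'"
    using eventually_vertical_not_crossing[of "X t1"]
  proof eventually_elim
    case (elim x)
    then obtain t s where t: "X t = x" "D t \<noteq> 0" "near_mod t1 \<delta>0 t" "\<And>e \<sigma>. arc_through E (front \<gamma> t) e \<sigma> \<Longrightarrow> arc_through E ?p e \<sigma>"
      and s: "X s = x" "D s \<noteq> 0" "near_mod t2 \<delta>0 s" "\<And>e \<sigma>. arc_through E (front \<gamma> s) e \<sigma> \<Longrightarrow> arc_through E ?p e \<sigma>"
      by blast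
    obtain e \<sigma> where e: "arc_through E (front \<gamma> t) e \<sigma>" using exists_arc_through t by blast
    obtain e' \<sigma>' where e': "arc_through E (front \<gamma> s) e' \<sigma>'" using exists_arc_through s by blast
    have "front \<gamma> t \<noteq> front \<gamma> s"
    proof
      assume eq: "front \<gamma> t = front \<gamma> s"
      have "front \<gamma> s \<notin> crossings \<gamma>" using elim(3) by (auto simp: front_def s(1))
      then obtain n where "t = s + of_int n" using noncrossing_fibre[OF _ eq] same_parameter by blast
      then have "near_mod t1 \<delta>0 s" using t(3) near_mod_periodic by metis
      then show False using \<delta>0(2) s(3) by blast
    qed
    moreover have "front \<gamma> t = front \<gamma> s" if "e = e'"
    proof -
      have "\<sigma> = \<sigma>'" using arc_through_same_eye t(4)[OF e] s(4)[OF e'] that by blast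
      then show ?thesis using e e' that t(1) s(1) by (auto simp: arc_through_def front_def)
    qed
    ultimately show ?case using t(4)[OF e] s(4)[OF e'] by blast
  qed
  then obtain e \<sigma> e' \<sigma>' where ee: "e \<noteq> e'" and arcs: "arc_through E ?p e \<sigma>" "arc_through E ?p e' \<sigma>'"
    by (auto simp: eventually_const_iff)
  define Q where "Q t \<longleftrightarrow> near_mod t1 \<delta>1 t \<or> near_mod t2 \<delta>2 t" for t
  have params: "\<forall>\<^sub>F x in at (X t1). arc_through E (x, arc a b x) a b \<and> (\<exists>t. front \<gamma> t = (x, arc a b x) \<and> Q t)"
    if arc: "arc_through E ?p a b" for a b
  proof -
    have "\<forall>\<^sub>F x in nhds (X t1). \<forall>t. front \<gamma> t = (x, arc a b x) \<longrightarrow> Q t"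
    proof (rule eventually_arc_parameters[OF arc, unfolded f(1)])
      fix t assume "front \<gamma> t = ?p"
      then have "t - t1 \<in> \<int> \<or> t - t2 \<in> \<int>" using crossing_fibre[OF cr] by blast
      then show "\<forall>\<^sub>F s in nhds t. Q s"
        using eventually_near_mod[OF \<delta>1(1), of t t1] eventually_near_mod[OF \<delta>2(1), of t t2]
        by (auto simp: Q_def elim: eventually_mono)
    qed (simp add: Q_def near_mod_periodic)
    with eventually_arc_through[OF arc, unfolded f(1)]
    have "\<forall>\<^sub>F x in nhds (X t1). arc_through E (x, arc a b x) a b \<and> (\<exists>t. front \<gamma> t = (x, arc a b x) \<and> Q t)"
    proof eventually_elim
      case (elim x)
      obtain t where "front \<gamma> t = (x, arc a b x)"
        using arc_point_in_front[of a x b] elim(1) by (auto simp: arc_through_def)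
      then show ?case using elim by blast
    qed
    then show ?thesis by (simp add: eventually_nhds_conv_at)
  qed
  have "a = e \<and> b = \<sigma> \<or> a = e' \<and> b = \<sigma>'" if arc: "arc_through E ?p a b" for a b
  proof -
    have "\<forall>\<^sub>F x in at (X t1). a = e \<and> b = \<sigma> \<or> a = e' \<and> b = \<sigma>'"
      using params[OF arc] params[OF arcs(1)] params[OF arcs(2)] eventually_vertical_not_crossing[of "X t1"]
    proof eventually_elim
      case (elim x)
      obtain t s r where t: "front \<gamma> t = (x, arc a b x)" "Q t" and s: "front \<gamma> s = (x, arc e \<sigma> x)" "Q s"
        and r: "front \<gamma> r = (x, arc e' \<sigma>' x)" "Q r" using elim by blast
      have Xs: "X t = x" "X s = x" "X r = x" using t s r by (auto simp: front_def)
      have same: "front \<gamma> u = front \<gamma> v" if "near_mod t1 \<delta>1 u \<and> near_mod t1 \<delta>1 v \<or> near_mod t2 \<delta>2 u \<and> near_mod t2 \<delta>2 v" "X u = X v" for u v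
        using same_branch_same_point[OF \<delta>1(2)] same_branch_same_point[OF \<delta>2(2)] that by blast
      \<comment> \<open>Three points on two branches.\<close>
      have "front \<gamma> t = front \<gamma> s \<or> front \<gamma> t = front \<gamma> r \<or> front \<gamma> s = front \<gamma> r"
        using same Xs t(2) s(2) r(2) unfolding Q_def by metis
      then have "arc a b x = arc e \<sigma> x \<or> arc a b x = arc e' \<sigma>' x \<or> arc e \<sigma> x = arc e' \<sigma>' x"
        using t s r by auto
      then show ?case using elim ee
          arc_through_noncrossing[of "(x, arc e \<sigma> x)"] arc_through_noncrossing[of "(x, arc e' \<sigma>' x)"] by metis
    qed
    then show ?thesis by (simp add: eventually_const_iff)
  qed
  with ee arcs show ?thesis by blast
qed

text \<open>
  The band at a switch is thus attached along a single arc at each end, and to two different disks.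
\<close>

lemma switch_arcs:
  assumes p: "p \<in> S"
  shows "\<exists>e \<sigma> e' \<sigma>'. e \<noteq> e' \<and> (\<forall>a b. upper_at E p a b \<longleftrightarrow> a = e \<and> b = \<sigma>) \<and>
    (\<forall>a b. lower_at E p a b \<longleftrightarrow> a = e' \<and> b = \<sigma>') \<and>
    (\<forall>a b. arc_through E p a b \<longrightarrow> a = e \<and> b = \<sigma> \<or> a = e' \<and> b = \<sigma>')"
proof -
  obtain t1 t2 where cr: "crossing_parameters \<gamma> t1 t2" "p = front \<gamma> t1"
    using p S_crossings by (auto simp: crossings_def)
  obtain e \<sigma> e' \<sigma>' where A: "e \<noteq> e'" "arc_through E p e \<sigma>" "arc_through E p e' \<sigma>'"
    "\<And>a s. arc_through E p a s \<Longrightarrow> a = e \<and> s = \<sigma> \<or> a = e' \<and> s = \<sigma>'"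
    using two_arcs_at_crossing[OF cr(1)] unfolding cr(2)[symmetric] by blast
  have asym: False if "arc_above p a s b t" "arc_above p b t a s" for a s b t
  proof -
    have "\<forall>\<^sub>F x in at (fst p). False"
      using that unfolding arc_above_def by eventually_elim simp
    then show False by simp
  qed
  have self: "\<not> arc_above p a s a s" for a s using asym by blast
  have ends: "(\<forall>a b. upper_at E p a b \<longleftrightarrow> a = e1 \<and> b = s1) \<and> (\<forall>a b. lower_at E p a b \<longleftrightarrow> a = e2 \<and> b = s2)"
    if arcs: "arc_through E p e1 s1" "arc_through E p e2 s2"
      "\<And>a s. arc_through E p a s \<Longrightarrow> a = e1 \<and> s = s1 \<or> a = e2 \<and> s = s2"
      and above: "arc_above p e1 s1 e2 s2"
    for e1 s1 e2 s2
  proof (intro conjI allI)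
    have neg: "\<not> arc_above p e2 s2 e1 s1" using above asym by blast
    show "upper_at E p a b \<longleftrightarrow> a = e1 \<and> b = s1" for a b
      using arcs above self neg unfolding upper_at_def by blast
    show "lower_at E p a b \<longleftrightarrow> a = e2 \<and> b = s2" for a b
      using arcs above self neg unfolding lower_at_def by blast
  qed
  from arcs_at_switch_ordered[OF p A(2,3,1)] show ?thesis
  proof
    assume above: "arc_above p e \<sigma> e' \<sigma>'"
    show ?thesis
    proof (rule exI[of _ e], rule exI[of _ \<sigma>], rule exI[of _ e'], rule exI[of _ \<sigma>'], intro conjI)
      show "e \<noteq> e'" by (rule A(1))
      show "\<forall>a b. upper_at E p a b \<longleftrightarrow> a = e \<and> b = \<sigma>" using ends[OF A(2-4) above] by blast
      show "\<forall>a b. lower_at E p a b \<longleftrightarrow> a = e' \<and> b = \<sigma>'" using ends[OF A(2-4) above] by blast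
      show "\<forall>a b. arc_through E p a b \<longrightarrow> a = e \<and> b = \<sigma> \<or> a = e' \<and> b = \<sigma>'" using A(4) by blast
    qed
  next
    assume above: "arc_above p e' \<sigma>' e \<sigma>"
    have swapped: "\<And>a s. arc_through E p a s \<Longrightarrow> a = e' \<and> s = \<sigma>' \<or> a = e \<and> s = \<sigma>"
      using A(4) by blast
    show ?thesis
    proof (rule exI[of _ e'], rule exI[of _ \<sigma>'], rule exI[of _ e], rule exI[of _ \<sigma>], intro conjI)
      show "e' \<noteq> e" using A(1) by simp
      show "\<forall>a b. upper_at E p a b \<longleftrightarrow> a = e' \<and> b = \<sigma>'" using ends[OF A(3,2) swapped above] by blast
      show "\<forall>a b. lower_at E p a b \<longleftrightarrow> a = e \<and> b = \<sigma>" using ends[OF A(3,2) swapped above] by blast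
      show "\<forall>a b. arc_through E p a b \<longrightarrow> a = e' \<and> b = \<sigma>' \<or> a = e \<and> b = \<sigma>" using swapped by blast
    qed
  qed
qed

end

section \<open>2-graded rulings and orientability\<close>

text \<open>
  A choice of names for the two arcs at a switch: the upper one is \<open>f True\<close>, in agreement with the
  end \<open>True\<close> of the band.
\<close>

definition switch_ends :: "eye set \<Rightarrow> real \<times> real \<Rightarrow> (bool \<Rightarrow> eye \<times> side) \<Rightarrow> bool" where
  "switch_ends E p f \<longleftrightarrow> fst (f True) \<noteq> fst (f False) \<and>
     (\<forall>e \<sigma>. upper_at E p e \<sigma> \<longleftrightarrow> (e, \<sigma>) = f True) \<and>
     (\<forall>e \<sigma>. lower_at E p e \<sigma> \<longleftrightarrow> (e, \<sigma>) = f False) \<and>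
     (\<forall>e \<sigma>. arc_through E p e \<sigma> \<longrightarrow> (\<exists>b. (e, \<sigma>) = f b))"

theorem corollary2p4:
  fixes \<gamma> :: "real \<Rightarrow> real^3" and \<mu> :: "real \<Rightarrow> int"
    and S :: "(real \<times> real) set" and E :: "eye set" and \<epsilon> :: real
  assumes "legendrian_knot \<gamma>" and "generic_front \<gamma>"
    and "maslov_potential \<gamma> \<mu>"
    and "ruling \<gamma> S E"
    and "admissible_width \<epsilon> S E"
  shows "two_graded \<gamma> \<mu> S \<longleftrightarrow> orientable_surface (ruling_surface \<epsilon> S E)"
proof -
  have front: "ruled_front \<gamma> S E"
    by (intro ruled_front.intro legendrian_front.intro ruled_front_axioms.intro assms)
  have front': "legendrian_front \<gamma>" using front by (simp add: ruled_front_def)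
  have "\<forall>p\<in>S. \<exists>f. switch_ends E p f"
  proof
    fix p assume "p \<in> S"
    from ruled_front.switch_arcs[OF front this]
    obtain e \<sigma> e' \<sigma>' where *: "e \<noteq> e' \<and> (\<forall>a b. upper_at E p a b \<longleftrightarrow> a = e \<and> b = \<sigma>) \<and>
      (\<forall>a b. lower_at E p a b \<longleftrightarrow> a = e' \<and> b = \<sigma>') \<and>
      (\<forall>a b. arc_through E p a b \<longrightarrow> a = e \<and> b = \<sigma> \<or> a = e' \<and> b = \<sigma>')"
      by (elim exE)
    have "switch_ends E p (\<lambda>b. if b then (e, \<sigma>) else (e', \<sigma>'))"
      unfolding switch_ends_def using * by (auto simp: ex_bool_eq)
    then show "\<exists>f. switch_ends E p f" by blast
  qed
  then obtain f where "\<forall>p\<in>S. switch_ends E p (f p)" by (rule bchoice[THEN exE])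
  then have f: "switch_ends E p (f p)" if "p \<in> S" for p using that by blast
  have disks: "banded_disks S E \<epsilon> (\<lambda>p b. fst (f p b)) (\<lambda>p b. snd (f p b))"
  proof (rule banded_disks.intro)
    show "finite S"
      using ruled_front.S_crossings[OF front] legendrian_front.finite_crossings[OF front'] by (rule finite_subset)
    show "upper_at E p e \<sigma> \<longleftrightarrow> e = fst (f p True) \<and> \<sigma> = snd (f p True)" if "p \<in> S" for p e \<sigma>
      using f[OF that] unfolding switch_ends_def by (cases "f p True") simp
    show "lower_at E p e \<sigma> \<longleftrightarrow> e = fst (f p False) \<and> \<sigma> = snd (f p False)" if "p \<in> S" for p e \<sigma>
      using f[OF that] unfolding switch_ends_def by (cases "f p False") simp
    show "\<exists>b. e = fst (f p b) \<and> \<sigma> = snd (f p b)" if arc: "p \<in> S" "arc_through E p e \<sigma>" for p e \<sigma>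
    proof -
      obtain b where "(e, \<sigma>) = f p b" using f[OF arc(1)] arc(2) unfolding switch_ends_def by blast
      then show ?thesis by (intro exI[of _ b]) (simp flip: \<open>(e, \<sigma>) = f p b\<close>)
    qed
    show "fst (f p True) \<noteq> fst (f p False)" if "p \<in> S" for p
      using f[OF that] unfolding switch_ends_def by blast
  qed (fact ruled_front.eye_facts[OF front] assms(5))+
  obtain \<eta> where \<eta>: "\<eta> > 0" "\<forall>p\<in>S. \<forall>b. \<forall>x\<in>{fst p - \<epsilon>..fst p + \<epsilon>}.
      \<eta> \<le> eye_top (fst (f p b)) x - eye_bot (fst (f p b)) x"
    using banded_disks.thickness_exists[OF disks] by blast
  have flat: "flattened_disks S E \<epsilon> (\<lambda>p b. fst (f p b)) (\<lambda>p b. snd (f p b)) \<eta>"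
    by (intro flattened_disks.intro disks flattened_disks_axioms.intro) (use \<eta> in auto)
  show ?thesis
    using ruled_front.two_graded_iff_coherent[OF front assms(3)]
      flattened_disks.orientable_if_coherent[OF flat] flattened_disks.coherent_if_orientable[OF flat]
    by blast
qed

end
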